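(* If $I\subset\mathbb{R}$ is a bounded interval, then $\mathcal{D}^{1,2}_{cyl}(\mathbb{R}^2\times I)$ is compactly embedded in $L^p+L^q(\mathbb{R}^2\times I)$, for every $1<p<6<q$.
   Context: Functions are real-valued; $I$ is taken open, so that $\Omega=\mathbb{R}^2\times I$ is a domain of $\mathbb{R}^3$. $\mathcal{D}^{1,2}(\Omega)$ is the completion of $C_0^\infty(\Omega)$ with respect to the norm $\|u\|=\left(\int_\Omega|\nabla u|^2\,dx\right)^{1/2}$, and $$\mathcal{D}^{1,2}_{cyl}(\mathbb{R}^2\times I)=\{u\in\mathcal{D}^{1,2}(\mathbb{R}^2\times I)\mid u(\cdot,\cdot,z)\text{ is radial (in }\mathbb{R}^2)\text{ for a.e. }z\in I\},$$ endowed with the norm of $\mathcal{D}^{1,2}$. $L^p+L^q(\Omega)$ is the Banach space of functions $v:\Omega\to\mathbb{R}$ of the form $v=v_1+v_2$ with $v_1\in L^p(\Omega)$, $v_2\in L^q(\Omega)$, with norm $\|v\|_{L^p+L^q}=\inf\{\|v_1\|_{L^p}+\|v_2\|_{L^q}\mid v_1\in L^p(\Omega),\,v_2\in L^q(\Omega),\,v_1+v_2=v\}$. *)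

theory Defs
  imports "HOL-Analysis.Analysis"
begin

text \<open>
  Elements of the function spaces are represented by functions on the whole type, of which only the
  values almost everywhere on the domain matter. Membership in these spaces and their norms depend only on
  the class of a function modulo equality almost everywhere on the domain.
\<close>

section \<open>Test functions\<close>

primrec Ck :: "nat \<Rightarrow> ('a::euclidean_space \<Rightarrow> real) \<Rightarrow> bool" where
  "Ck 0 f \<longleftrightarrow> continuous_on UNIV f"
| "Ck (Suc k) f \<longleftrightarrow>
     f differentiable_on UNIV \<and> (\<forall>i\<in>Basis. Ck k (\<lambda>x. frechet_derivative f (at x) i))"

definition test_functions :: "'a::euclidean_space set \<Rightarrow> ('a \<Rightarrow> real) set" where
  "test_functions \<Omega> =
     {\<phi>. (\<forall>k. Ck k \<phi>) \<and> compact (closure {x. \<phi> x \<noteq> 0}) \<and> closure {x. \<phi> x \<noteq> 0} \<subseteq> \<Omega>}"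

definition gradient :: "('a::euclidean_space \<Rightarrow> real) \<Rightarrow> 'a \<Rightarrow> 'a" where
  "gradient f x = (\<Sum>i\<in>Basis. frechet_derivative f (at x) i *\<^sub>R i)"

definition dirichlet_norm :: "'a::euclidean_space set \<Rightarrow> ('a \<Rightarrow> real) \<Rightarrow> real" where
  "dirichlet_norm \<Omega> \<phi> = sqrt (LINT x|lebesgue_on \<Omega>. (norm (gradient \<phi> x))\<^sup>2)"

section \<open>The completion of the test functions\<close>

text \<open>
  The coordinates of three-dimensional space are grouped as a point of the plane and a height; the
  inner product of the product type is the Euclidean one.
\<close>

type_synonym space3 = "(real^2) \<times> real"

text \<open>
  The completion is realised as a space of functions in the usual way: a function represents the
  class of a Cauchy sequence of test functions if it is an almost everywhere limit of a
  representative of this class. In dimension three this is a faithful realisation: by the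
  Sobolev inequality every Cauchy sequence converges in $L^6$, hence a subsequence converges almost
  everywhere, and the limit determines the class of the sequence. (In dimension
  at most two, this fails for the whole space, hence the restriction of the type.)
\<close>

definition D12_represents :: "space3 set \<Rightarrow> (nat \<Rightarrow> space3 \<Rightarrow> real) \<Rightarrow> (space3 \<Rightarrow> real) \<Rightarrow> bool" where
  "D12_represents \<Omega> \<phi> u \<longleftrightarrow>
     (\<forall>n. \<phi> n \<in> test_functions \<Omega>) \<and>
     (\<forall>e>0. \<exists>N. \<forall>m\<ge>N. \<forall>n\<ge>N. dirichlet_norm \<Omega> (\<lambda>x. \<phi> m x - \<phi> n x) < e) \<and>
     (AE x in lebesgue_on \<Omega>. (\<lambda>n. \<phi> n x) \<longlonglongrightarrow> u x)"

definition D12 :: "space3 set \<Rightarrow> (space3 \<Rightarrow> real) set" where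
  "D12 \<Omega> = {u \<in> borel_measurable (lebesgue_on \<Omega>). \<exists>\<phi>. D12_represents \<Omega> \<phi> u}"

text \<open>
  The norm of the completion: the limit of the norms along a representing Cauchy
  sequence, which does not depend on the choice of that sequence.
\<close>

definition D12_norm :: "space3 set \<Rightarrow> (space3 \<Rightarrow> real) \<Rightarrow> real" where
  "D12_norm \<Omega> u =
     (THE r. \<exists>\<phi>. D12_represents \<Omega> \<phi> u \<and> (\<lambda>n. dirichlet_norm \<Omega> (\<phi> n)) \<longlonglongrightarrow> r)"

text \<open>
  A class of functions modulo null sets is radial if it contains a function of the radius.
\<close>

definition radial_ae :: "(real^2 \<Rightarrow> real) \<Rightarrow> bool" where
  "radial_ae v \<longleftrightarrow> (\<exists>g :: real \<Rightarrow> real. AE y in lebesgue. v y = g (norm y))"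

definition D12_cyl :: "real set \<Rightarrow> (space3 \<Rightarrow> real) set" where
  "D12_cyl I =
     {u \<in> D12 (UNIV \<times> I). AE z in lebesgue_on I. radial_ae (\<lambda>y. u (y, z))}"

section \<open>Sums of Lebesgue spaces\<close>

definition Lp :: "real \<Rightarrow> 'a::euclidean_space set \<Rightarrow> ('a \<Rightarrow> real) set" where
  "Lp p \<Omega> =
     {f \<in> borel_measurable (lebesgue_on \<Omega>). integrable (lebesgue_on \<Omega>) (\<lambda>x. \<bar>f x\<bar> powr p)}"

definition Lp_norm :: "real \<Rightarrow> 'a::euclidean_space set \<Rightarrow> ('a \<Rightarrow> real) \<Rightarrow> real" where
  "Lp_norm p \<Omega> f = (LINT x|lebesgue_on \<Omega>. \<bar>f x\<bar> powr p) powr (1 / p)"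

definition Lsum_decomp ::
    "real \<Rightarrow> real \<Rightarrow> 'a::euclidean_space set \<Rightarrow> ('a \<Rightarrow> real) \<Rightarrow> (('a \<Rightarrow> real) \<times> ('a \<Rightarrow> real)) set" where
  "Lsum_decomp p q \<Omega> v =
     {(v\<^sub>1, v\<^sub>2). v\<^sub>1 \<in> Lp p \<Omega> \<and> v\<^sub>2 \<in> Lp q \<Omega> \<and> (AE x in lebesgue_on \<Omega>. v x = v\<^sub>1 x + v\<^sub>2 x)}"

definition Lsum :: "real \<Rightarrow> real \<Rightarrow> 'a::euclidean_space set \<Rightarrow> ('a \<Rightarrow> real) set" where
  "Lsum p q \<Omega> = {v. Lsum_decomp p q \<Omega> v \<noteq> {}}"

definition Lsum_norm ::
    "real \<Rightarrow> real \<Rightarrow> 'a::euclidean_space set \<Rightarrow> ('a \<Rightarrow> real) \<Rightarrow> real" where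
  "Lsum_norm p q \<Omega> v =
     (INF (v\<^sub>1, v\<^sub>2) \<in> Lsum_decomp p q \<Omega> v. Lp_norm p \<Omega> v\<^sub>1 + Lp_norm q \<Omega> v\<^sub>2)"

section \<open>Compact embeddings\<close>

text \<open>
  The spaces are given by sets of representatives together with norms that vanish on the
  representatives of zero. The first three conditions say that the inclusion of representatives
  induces a map between the normed spaces of classes which is bounded and injective; the last one
  says that this map is compact.
\<close>

definition compactly_embedded ::
    "('a \<Rightarrow> real) set \<Rightarrow> (('a \<Rightarrow> real) \<Rightarrow> real) \<Rightarrow> ('a \<Rightarrow> real) set \<Rightarrow> (('a \<Rightarrow> real) \<Rightarrow> real) \<Rightarrow> bool"
  where
  "compactly_embedded X normX Y normY \<longleftrightarrow>
     X \<subseteq> Y \<and>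
     (\<exists>C. \<forall>u\<in>X. normY u \<le> C * normX u) \<and>
     (\<forall>u\<in>X. normY u = 0 \<longrightarrow> normX u = 0) \<and>
     (\<forall>u. (\<forall>n::nat. u n \<in> X) \<and> (\<exists>B. \<forall>n. normX (u n) \<le> B) \<longrightarrow>
        (\<exists>r v. strict_mono r \<and> v \<in> Y \<and> (\<lambda>n. normY (\<lambda>x. u (r n) x - v x)) \<longlonglongrightarrow> 0))"

end

theory Submission
  imports Defs "HOL-Library.Diagonal_Subsequence"
begin

text \<open>
  A function \<open>u\<close> of the space, extended by zero, satisfies the translation estimate
  \<open>\<integral> \<bar>u (x + t) - u x\<bar>\<^sup>2 \<le> \<bar>t\<bar>\<^sup>2 \<parallel>u\<parallel>\<^sup>2\<close> and the Sobolev inequality \<open>\<integral> u\<^sup>6 \<le> 4096 \<parallel>u\<parallel>\<^sup>6\<close>; on a bounded strip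
  the former, for a vertical translation, contains the Poincare inequality. Cut space into
  half-open cubes of side \<open>h\<close> and let \<open>E u\<close> be the function of cube means. The translation estimate gives
  \<open>\<integral> \<bar>u - E u\<bar>\<^sup>2 \<le> C h\<^sup>2 \<parallel>u\<parallel>\<^sup>2\<close>. For a bounded sequence a diagonal subsequence has convergent means on
  every cube with \<open>h = 1 / k\<close>, and by radial symmetry the means are uniformly small on cubes far from the axis,
  because such a cube has many disjoint rotated copies carrying the same mass. So for the differences \<open>d\<close> of
  the subsequence \<open>E d\<close> tends to zero uniformly, and for \<open>2 < s < 6\<close> the pointwise inequality
  \<open>\<bar>d\<bar>\<^sup>s \<le> \<epsilon> d\<^sup>2 + K \<bar>d - E d\<bar>\<^sup>2 + \<epsilon> d\<^sup>6\<close>, valid where \<open>E d\<close> is small, shows that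
  the subsequence is Cauchy in \<open>L\<^sup>s\<close>. Finally \<open>L\<^sup>s\<close> embeds in the sum space for \<open>p \<le> s \<le> q\<close>, by
  cutting a function at the height of its norm.
\<close>

section \<open>Integration preliminaries\<close>

text \<open>Two things threaten compactness: concentration at a point, under which the norms in the
  completion and in exponent 6 can both stay constant, and escape to infinity. Concentration is
  harmless in an exponent \<open>s\<close> strictly below 6. Escape along the plane is excluded by
  symmetry, vertical escape by the boundedness of \<open>I\<close>. The same boundedness yields the
  bound in exponent 2 that controls small values, which is why \<open>s\<close> must stay strictly
  above 2. The exponent 6 itself enters only through boundedness. An element of the completion is
  just an almost everywhere limit and comes with no derivative. Hence only inequalities that are
  stable under Fatou's lemma are transferred to it, and the translation estimate takes the place of
  the gradient. The encoding adds two tasks: \<open>D12_norm\<close> is a definite description, so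
  it must first be shown that sequences with the same limit have the same limiting norm; and
  elements are only Lebesgue measurable, so each is replaced by a Borel function before translations
  and slices are taken.\<close>

lemma nn_integral_lborel_shift:
  fixes f :: "'a::euclidean_space \<Rightarrow> ennreal"
  assumes "f \<in> borel_measurable borel"
  shows "(\<integral>\<^sup>+x. f (x + t) \<partial>lborel) = (\<integral>\<^sup>+x. f x \<partial>lborel)"
proof -
  have "(\<integral>\<^sup>+x. f x \<partial>lborel) = (\<integral>\<^sup>+x. f x \<partial>distr lborel borel ((+) t))"
    by (simp add: lborel_distr_plus)
  also have "\<dots> = (\<integral>\<^sup>+x. f (x + t) \<partial>lborel)"
    using assms by (subst nn_integral_distr) (auto simp: add.commute)
  finally show ?thesis by simp
qed

lemma AE_lborel_shift:
  fixes t :: "'a::euclidean_space"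
  assumes "AE x in lborel. P x"
  shows "AE x in lborel. P (x + t)"
proof -
  have "AE x in distr lborel borel ((+) t). P x"
    using assms by (subst lborel_distr_plus)
  from AE_distrD[OF _ this] show ?thesis by (simp add: add.commute)
qed

text \<open>The value at \<open>top\<close> is set separately because \<open>enn2real\<close> sends
  \<open>top\<close> to 0. With a root on the whole extended half-line, Cauchy-Schwarz can be
  iterated without checking that any integral is finite.\<close>

definition esqrt :: "ennreal \<Rightarrow> ennreal" where
  "esqrt x = (if x = top then top else ennreal (sqrt (enn2real x)))"

lemma esqrt_measurable [measurable]: "esqrt \<in> borel_measurable borel"
  unfolding esqrt_def by measurable

lemma esqrt_power2 [simp]: "(esqrt x)\<^sup>2 = x"
  by (cases x) (auto simp: esqrt_def ennreal_power)

lemma ennreal_power2_le_imp_le: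
  fixes x y :: ennreal
  assumes "x\<^sup>2 \<le> y\<^sup>2" shows "x \<le> y"
  using assms by (cases x; cases y) (auto simp: ennreal_power top_unique power2_le_iff_abs_le)

lemma le_esqrt: "x\<^sup>2 \<le> y \<Longrightarrow> x \<le> esqrt y"
  by (rule ennreal_power2_le_imp_le) simp

lemma esqrt_mult: "esqrt (x * y) = esqrt x * esqrt y"
  by (rule antisym; rule ennreal_power2_le_imp_le) (simp_all add: power_mult_distrib)

lemma Cauchy_Schwarz_esqrt:
  assumes "f \<in> borel_measurable M" "g \<in> borel_measurable M"
  shows "(\<integral>\<^sup>+x. f x * g x \<partial>M) \<le> esqrt (\<integral>\<^sup>+x. f x ^ 2 \<partial>M) * esqrt (\<integral>\<^sup>+x. g x ^ 2 \<partial>M)"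
  using Cauchy_Schwarz_nn_integral[OF assms] by (simp add: le_esqrt flip: esqrt_mult)

text \<open>Each factor misses exactly one variable. So Cauchy-Schwarz applies in \<open>a\<close>,
  then in \<open>b\<close>, then in \<open>z\<close>: each time the factor free of the current
  variable leaves the integral and the other two are separated.\<close>

lemma Loomis_Whitney_nn_integral:
  fixes f g h :: "real \<Rightarrow> real \<Rightarrow> ennreal"
  assumes [measurable]: "case_prod f \<in> borel_measurable borel"
    "case_prod g \<in> borel_measurable borel" "case_prod h \<in> borel_measurable borel"
  shows "(\<integral>\<^sup>+z. \<integral>\<^sup>+b. \<integral>\<^sup>+a. f b z * g a z * h a b \<partial>lborel \<partial>lborel \<partial>lborel)\<^sup>2
    \<le> (\<integral>\<^sup>+z. \<integral>\<^sup>+b. (f b z)\<^sup>2 \<partial>lborel \<partial>lborel) * (\<integral>\<^sup>+z. \<integral>\<^sup>+a. (g a z)\<^sup>2 \<partial>lborel \<partial>lborel)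
      * (\<integral>\<^sup>+b. \<integral>\<^sup>+a. (h a b)\<^sup>2 \<partial>lborel \<partial>lborel)"
proof -
  have [measurable]: "case_prod f \<in> borel_measurable (borel \<Otimes>\<^sub>M borel)"
    "case_prod g \<in> borel_measurable (borel \<Otimes>\<^sub>M borel)"
    "case_prod h \<in> borel_measurable (borel \<Otimes>\<^sub>M borel)"
    using assms by (simp_all add: borel_prod)
  define G where "G z = (\<integral>\<^sup>+a. (g a z)\<^sup>2 \<partial>lborel)" for z
  define F where "F z = (\<integral>\<^sup>+b. (f b z)\<^sup>2 \<partial>lborel)" for z
  define H where "H b = (\<integral>\<^sup>+a. (h a b)\<^sup>2 \<partial>lborel)" for b
  have [measurable]: "F \<in> borel_measurable borel" "G \<in> borel_measurable borel"
    "H \<in> borel_measurable borel"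
    unfolding F_def G_def H_def by measurable
  have 1: "(\<integral>\<^sup>+a. f b z * g a z * h a b \<partial>lborel) \<le> f b z * (esqrt (G z) * esqrt (H b))" for b z
    using Cauchy_Schwarz_esqrt[of "\<lambda>a. g a z" lborel "\<lambda>a. h a b"]
    by (simp add: G_def H_def mult.assoc nn_integral_cmult mult_left_mono)
  have 2: "(\<integral>\<^sup>+b. \<integral>\<^sup>+a. f b z * g a z * h a b \<partial>lborel \<partial>lborel)
      \<le> esqrt (G z) * (esqrt (F z) * esqrt (\<integral>\<^sup>+b. H b \<partial>lborel))" for z
  proof -
    have "(\<integral>\<^sup>+b. \<integral>\<^sup>+a. f b z * g a z * h a b \<partial>lborel \<partial>lborel)
        \<le> (\<integral>\<^sup>+b. f b z * (esqrt (G z) * esqrt (H b)) \<partial>lborel)"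
      by (intro nn_integral_mono 1)
    also have "\<dots> = esqrt (G z) * (\<integral>\<^sup>+b. f b z * esqrt (H b) \<partial>lborel)"
      by (simp add: mult.left_commute nn_integral_cmult)
    also have "\<dots> \<le> esqrt (G z) * (esqrt (F z) * esqrt (\<integral>\<^sup>+b. H b \<partial>lborel))"
      using Cauchy_Schwarz_esqrt[of "\<lambda>b. f b z" lborel "\<lambda>b. esqrt (H b)"]
      by (intro mult_left_mono) (simp_all add: F_def)
    finally show ?thesis .
  qed
  have "(\<integral>\<^sup>+z. \<integral>\<^sup>+b. \<integral>\<^sup>+a. f b z * g a z * h a b \<partial>lborel \<partial>lborel \<partial>lborel)
      \<le> (\<integral>\<^sup>+z. esqrt (G z) * (esqrt (F z) * esqrt (\<integral>\<^sup>+b. H b \<partial>lborel)) \<partial>lborel)"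
    by (intro nn_integral_mono 2)
  also have "\<dots> = (\<integral>\<^sup>+z. esqrt (G z) * esqrt (F z) \<partial>lborel) * esqrt (\<integral>\<^sup>+b. H b \<partial>lborel)"
    by (simp add: nn_integral_multc flip: mult.assoc)
  also have "\<dots> \<le> (esqrt (\<integral>\<^sup>+z. G z \<partial>lborel) * esqrt (\<integral>\<^sup>+z. F z \<partial>lborel)) * esqrt (\<integral>\<^sup>+b. H b \<partial>lborel)"
    using Cauchy_Schwarz_esqrt[of "\<lambda>z. esqrt (G z)" lborel "\<lambda>z. esqrt (F z)"]
    by (intro mult_right_mono) simp_all
  finally have "(\<integral>\<^sup>+z. \<integral>\<^sup>+b. \<integral>\<^sup>+a. f b z * g a z * h a b \<partial>lborel \<partial>lborel \<partial>lborel)\<^sup>2 \<le>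
     ((esqrt (\<integral>\<^sup>+z. G z \<partial>lborel) * esqrt (\<integral>\<^sup>+z. F z \<partial>lborel)) * esqrt (\<integral>\<^sup>+b. H b \<partial>lborel))\<^sup>2"
    by (rule power_mono) simp
  then show ?thesis
    by (simp add: power_mult_distrib F_def G_def H_def mult_ac)
qed


lemma abs_diff_le_nn_integral_derivative:
  fixes f :: "real \<Rightarrow> real"
  assumes "a \<le> b" and "\<And>x. (f has_real_derivative f' x) (at x)" and "continuous_on UNIV f'"
  shows "ennreal \<bar>f b - f a\<bar> \<le> (\<integral>\<^sup>+x. ennreal \<bar>f' x\<bar> * indicator {a..b} x \<partial>lborel)"
proof -
  have *: "has_bochner_integral lborel (\<lambda>x. f' x * indicator {a..b} x) (f b - f a)"
    using assms
    by (intro has_bochner_integral_FTC_Icc_real) (auto simp: continuous_on_eq_continuous_at)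
  have "ennreal \<bar>f b - f a\<bar> \<le> (\<integral>\<^sup>+x. norm (f' x * indicator {a..b} x) \<partial>lborel)"
    using has_bochner_integral_norm_bound[OF *] by simp
  also have "\<dots> = (\<integral>\<^sup>+x. ennreal \<bar>f' x\<bar> * indicator {a..b} x \<partial>lborel)"
    by (intro nn_integral_cong) (simp split: split_indicator)
  finally show ?thesis .
qed

text \<open>Fatou's lemma with bounds that vary with \<open>n\<close>, so that an inequality whose
  constant is the norm of the \<open>n\<close>-th approximant passes to the limit norm.\<close>

lemma nn_integral_le_of_AE_tendsto:
  fixes f :: "nat \<Rightarrow> 'a \<Rightarrow> ennreal"
  assumes "\<And>n. f n \<in> borel_measurable M" and "AE x in M. (\<lambda>n. f n x) \<longlonglongrightarrow> g x"
    and "eventually (\<lambda>n. (\<integral>\<^sup>+x. f n x \<partial>M) \<le> c n) sequentially" and "c \<longlonglongrightarrow> d"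
  shows "(\<integral>\<^sup>+x. g x \<partial>M) \<le> d"
proof -
  have "(\<integral>\<^sup>+x. g x \<partial>M) = (\<integral>\<^sup>+x. liminf (\<lambda>n. f n x) \<partial>M)"
    using assms(2) by (intro nn_integral_cong_AE) (auto simp: lim_imp_Liminf)
  also have "\<dots> \<le> liminf (\<lambda>n. \<integral>\<^sup>+x. f n x \<partial>M)"
    using assms(1) by (rule nn_integral_liminf)
  also have "\<dots> \<le> liminf c"
    using assms(3) by (rule Liminf_mono)
  also have "\<dots> = d"
    using assms(4) by (intro lim_imp_Liminf) auto
  finally show ?thesis .
qed

section \<open>Compactly supported functions of class C1\<close>

text \<open>The first derivative is all that is used of a test function. \<open>K\<close> may be any
  compact set off which both functions vanish, rather than the support, so that a difference needs
  only the union of two such sets.\<close>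

definition C1c :: "'a::euclidean_space set \<Rightarrow> ('a \<Rightarrow> real) \<Rightarrow> ('a \<Rightarrow> 'a) \<Rightarrow> bool" where
  "C1c \<Omega> \<phi> G \<longleftrightarrow> (\<forall>x. (\<phi> has_derivative (\<lambda>h. G x \<bullet> h)) (at x)) \<and> continuous_on UNIV G \<and>
     (\<exists>K. compact K \<and> K \<subseteq> \<Omega> \<and> (\<forall>x. x \<notin> K \<longrightarrow> \<phi> x = 0 \<and> G x = 0))"

lemma C1c_has_derivative: "C1c \<Omega> \<phi> G \<Longrightarrow> (\<phi> has_derivative (\<lambda>h. G x \<bullet> h)) (at x)"
  by (simp add: C1c_def)

lemma C1c_continuous: "C1c \<Omega> \<phi> G \<Longrightarrow> continuous_on UNIV G" "C1c \<Omega> \<phi> G \<Longrightarrow> continuous_on UNIV \<phi>"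
  by (auto simp: C1c_def intro: has_derivative_continuous continuous_at_imp_continuous_on)

lemma C1c_measurable:
  assumes "C1c \<Omega> \<phi> G" 
  shows "G \<in> borel_measurable borel" "\<phi> \<in> borel_measurable borel"
  using C1c_continuous[OF assms] by (auto intro: borel_measurable_continuous_onI)

lemma C1c_diff:
  assumes "C1c \<Omega> \<phi> G" "C1c \<Omega> \<psi> H"
  shows "C1c \<Omega> (\<lambda>x. \<phi> x - \<psi> x) (\<lambda>x. G x - H x)"
proof -
  obtain K L where "compact K" "K \<subseteq> \<Omega>" "\<And>x. x \<notin> K \<Longrightarrow> \<phi> x = 0 \<and> G x = 0"
    and "compact L" "L \<subseteq> \<Omega>" "\<And>x. x \<notin> L \<Longrightarrow> \<psi> x = 0 \<and> H x = 0"
    using assms unfolding C1c_def by metis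
  then have "compact (K \<union> L) \<and> K \<union> L \<subseteq> \<Omega> \<and>
      (\<forall>x. x \<notin> K \<union> L \<longrightarrow> \<phi> x - \<psi> x = 0 \<and> G x - H x = 0)"
    by (auto intro: compact_Un)
  moreover have "((\<lambda>x. \<phi> x - \<psi> x) has_derivative (\<lambda>h. (G x - H x) \<bullet> h)) (at x)" for x
    using has_derivative_diff[OF assms[THEN C1c_has_derivative]] by (simp add: inner_diff_left)
  moreover have "continuous_on UNIV (\<lambda>x. G x - H x)"
    by (intro continuous_on_diff assms[THEN C1c_continuous(1)])
  ultimately show ?thesis
    unfolding C1c_def by blast
qed

section \<open>Translations of compactly supported functions\<close>

lemma C1c_has_real_derivative:
  assumes "C1c \<Omega> \<phi> G"
  shows "((\<lambda>s. \<phi> (x + s *\<^sub>R t)) has_real_derivative G (x + s *\<^sub>R t) \<bullet> t) (at s)"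
proof -
  have "((\<lambda>s. \<phi> (x + s *\<^sub>R t)) has_derivative (\<lambda>h. G (x + s *\<^sub>R t) \<bullet> (h *\<^sub>R t))) (at s)"
    by (rule has_derivative_compose[OF _ C1c_has_derivative[OF assms], where f = "\<lambda>s. x + s *\<^sub>R t"])
      (auto intro!: derivative_eq_intros)
  then show ?thesis
    by (simp add: has_field_derivative_def mult.commute[of _ "G _ \<bullet> _"] fun_eq_iff) 
qed

text \<open>The increment is the integral of \<open>G \<bullet> t\<close> along the segment from
  \<open>x\<close> to \<open>x + t\<close>. Cauchy-Schwarz on the unit interval squares it at no
  cost, and after Fubini all translates of \<open>G\<close> have the same integral.\<close>

lemma C1c_translation:
  assumes C: "C1c \<Omega> \<phi> G"
  shows "(\<integral>\<^sup>+x. ennreal ((\<phi> (x + t) - \<phi> x)\<^sup>2) \<partial>lborel)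
    \<le> ennreal ((norm t)\<^sup>2) * (\<integral>\<^sup>+x. ennreal ((norm (G x))\<^sup>2) \<partial>lborel)"
proof -
  note [measurable] = C1c_measurable[OF C]
  have pt: "ennreal ((\<phi> (x + t) - \<phi> x)\<^sup>2)
      \<le> (\<integral>\<^sup>+s. ennreal ((norm t)\<^sup>2) * (ennreal ((norm (G (x + s *\<^sub>R t)))\<^sup>2) * indicator {0..1} s) \<partial>lborel)" for x
  proof -
    have "ennreal \<bar>\<phi> (x + 1 *\<^sub>R t) - \<phi> (x + 0 *\<^sub>R t)\<bar>
        \<le> (\<integral>\<^sup>+s. ennreal \<bar>G (x + s *\<^sub>R t) \<bullet> t\<bar> * indicator {0..1} s \<partial>lborel)"
      by (intro abs_diff_le_nn_integral_derivative C1c_has_real_derivative[OF C])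
        (auto intro!: continuous_intros continuous_on_compose2[OF C1c_continuous(1)[OF C]])
    \<comment> \<open>The indicator is doubled so that one copy can be the second factor in
      Cauchy-Schwarz, where its square has integral 1.\<close>
    then have "(ennreal \<bar>\<phi> (x + t) - \<phi> x\<bar>)\<^sup>2 
        \<le> (\<integral>\<^sup>+s. (ennreal \<bar>G (x + s *\<^sub>R t) \<bullet> t\<bar> * indicator {0..1} s) * indicator {0..1} s \<partial>lborel)\<^sup>2"
      by (intro power_mono) (simp_all add: mult.assoc flip: indicator_inter_arith)
    also have "\<dots> \<le> (\<integral>\<^sup>+s. (ennreal \<bar>G (x + s *\<^sub>R t) \<bullet> t\<bar> * indicator {0..1} s)\<^sup>2 \<partial>lborel) *
        (\<integral>\<^sup>+s. (indicator {0..1::real} s)\<^sup>2 \<partial>lborel)"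
      by (intro Cauchy_Schwarz_nn_integral) measurable
    also have "(\<integral>\<^sup>+s. (indicator {0..1::real} s)\<^sup>2 \<partial>lborel) = (1 :: ennreal)"
      by (simp add: power2_eq_square flip: indicator_inter_arith)
    also have "(\<integral>\<^sup>+s. (ennreal \<bar>G (x + s *\<^sub>R t) \<bullet> t\<bar> * indicator {0..1} s)\<^sup>2 \<partial>lborel) * 1
       \<le> (\<integral>\<^sup>+s. ennreal ((norm t)\<^sup>2) * (ennreal ((norm (G (x + s *\<^sub>R t)))\<^sup>2) * indicator {0..1} s) \<partial>lborel)"
    proof (simp, intro nn_integral_mono)
      fix s
      have "(G (x + s *\<^sub>R t) \<bullet> t)\<^sup>2 \<le> (norm t)\<^sup>2 * (norm (G (x + s *\<^sub>R t)))\<^sup>2"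
        using Cauchy_Schwarz_ineq[of "G (x + s *\<^sub>R t)" t] by (simp add: power2_norm_eq_inner mult.commute)
      then show "(ennreal \<bar>G (x + s *\<^sub>R t) \<bullet> t\<bar> * indicator {0..1} s)\<^sup>2 \<le>
          ennreal ((norm t)\<^sup>2) * (ennreal ((norm (G (x + s *\<^sub>R t)))\<^sup>2) * indicator {0..1} s)"
        by (auto simp: ennreal_power simp flip: ennreal_mult split: split_indicator intro!: ennreal_leI)
    qed
    finally show ?thesis by (simp add: ennreal_power)
  qed
  have "(\<integral>\<^sup>+x. ennreal ((\<phi> (x + t) - \<phi> x)\<^sup>2) \<partial>lborel) \<le>
    (\<integral>\<^sup>+x. \<integral>\<^sup>+s. ennreal ((norm t)\<^sup>2) * (ennreal ((norm (G (x + s *\<^sub>R t)))\<^sup>2) * indicator {0..1} s) \<partial>lborel \<partial>lborel)"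
    by (intro nn_integral_mono pt)
  also have "\<dots> = (\<integral>\<^sup>+s. \<integral>\<^sup>+x. ennreal ((norm t)\<^sup>2) * (ennreal ((norm (G (x + s *\<^sub>R t)))\<^sup>2) * indicator {0..1} s) \<partial>lborel \<partial>lborel)"
    by (rule lborel_pair.Fubini') measurable
  also have "\<dots> = (\<integral>\<^sup>+s. ennreal ((norm t)\<^sup>2) * ((\<integral>\<^sup>+x. ennreal ((norm (G (x + s *\<^sub>R t)))\<^sup>2) \<partial>lborel) * indicator {0..1} s) \<partial>lborel)"
    by (simp add: nn_integral_cmult nn_integral_multc)
  also have "\<dots> = (\<integral>\<^sup>+s. ennreal ((norm t)\<^sup>2) * ((\<integral>\<^sup>+x. ennreal ((norm (G x))\<^sup>2) \<partial>lborel) * indicator {0..1::real} s) \<partial>lborel)"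
    by (subst nn_integral_lborel_shift[where f = "\<lambda>x. ennreal ((norm (G x))\<^sup>2)"]) measurable
  also have "\<dots> = ennreal ((norm t)\<^sup>2) * (\<integral>\<^sup>+x. ennreal ((norm (G x))\<^sup>2) \<partial>lborel)"
    by (simp add: nn_integral_cmult)
  finally show ?thesis .
qed

section \<open>Integration in coordinates and the Sobolev inequality\<close>

lemma lborel_real2:
  "(lborel :: (real^2) measure) = distr (lborel \<Otimes>\<^sub>M lborel) borel (\<lambda>(a, b). a *\<^sub>R axis 1 1 + b *\<^sub>R axis 2 1)"
proof (rule lborel_eqI)
  fix l u :: "real^2"
  assume le: "\<And>b. b \<in> Basis \<Longrightarrow> l \<bullet> b \<le> u \<bullet> b"
  have B: "(Basis :: (real^2) set) = {axis 1 1, axis 2 1}"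
    by (auto simp: Basis_vec_def UNIV_2)
  have ne: "axis 1 1 \<noteq> (axis 2 1 :: real^2)"
    by (simp add: axis_eq_axis)
  have le': "l $ 1 \<le> u $ 1" "l $ 2 \<le> u $ 2"
    using le[of "axis 1 1"] le[of "axis 2 1"] by (auto simp: B inner_axis)
  have m: "(\<lambda>(a, b). a *\<^sub>R axis 1 1 + b *\<^sub>R axis 2 1 :: real^2) \<in> lborel \<Otimes>\<^sub>M lborel \<rightarrow>\<^sub>M borel"
    by measurable
  \<comment> \<open>The preimage of a box is a rectangle, so the image measure gives each box the
    product of its side lengths, which characterises Lebesgue measure.\<close>
  have "(\<lambda>(a, b). a *\<^sub>R axis 1 1 + b *\<^sub>R axis 2 1 :: real^2) -` box l u \<inter> space (lborel \<Otimes>\<^sub>M lborel)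
      = {l $ 1<..<u $ 1} \<times> {l $ 2<..<u $ 2}"
    by (auto simp: mem_box_cart forall_2 axis_def space_pair_measure)
  then have "emeasure (distr (lborel \<Otimes>\<^sub>M lborel) borel (\<lambda>(a, b). a *\<^sub>R axis 1 1 + b *\<^sub>R axis 2 1)) (box l u)
      = ennreal (u $ 1 - l $ 1) * ennreal (u $ 2 - l $ 2)"
    using le' by (subst emeasure_distr[OF m]) (simp_all add: lborel.emeasure_pair_measure_Times)
  then show "emeasure (distr (lborel \<Otimes>\<^sub>M lborel) borel (\<lambda>(a, b). a *\<^sub>R axis 1 1 + b *\<^sub>R axis 2 1)) (box l u)
      = (\<Prod>b\<in>Basis. (u - l) \<bullet> b)"
    using le' ne by (simp add: B inner_axis ennreal_mult)
qed simp

definition coords3 :: "real \<Rightarrow> real \<Rightarrow> real \<Rightarrow> space3" where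
  "coords3 a b z = (a *\<^sub>R axis 1 1 + b *\<^sub>R axis 2 1, z)"

lemma coords3_measurable [measurable (raw)]:
  assumes [measurable]: "f \<in> borel_measurable M" "g \<in> borel_measurable M" "h \<in> borel_measurable M"
  shows "(\<lambda>x. coords3 (f x) (g x) (h x)) \<in> borel_measurable M"
  unfolding coords3_def by (simp add: borel_prod[symmetric])

lemma nn_integral_coords3:
  assumes [measurable]: "f \<in> borel_measurable borel"
  shows "(\<integral>\<^sup>+x. f x \<partial>(lborel :: space3 measure))
    = (\<integral>\<^sup>+z. \<integral>\<^sup>+b. \<integral>\<^sup>+a. f (coords3 a b z) \<partial>lborel \<partial>lborel \<partial>lborel)"
proof -
  have [measurable]: "f \<in> borel_measurable (borel \<Otimes>\<^sub>M borel)"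
    by (simp add: borel_prod)
  have "(\<integral>\<^sup>+x. f x \<partial>(lborel :: space3 measure)) = (\<integral>\<^sup>+x. f x \<partial>(lborel \<Otimes>\<^sub>M lborel))"
    by (simp add: lborel_prod)
  also have "\<dots> = (\<integral>\<^sup>+z. \<integral>\<^sup>+y. f (y, z) \<partial>lborel \<partial>lborel)"
    by (subst lborel_pair.nn_integral_snd[symmetric]) simp_all
  also have "\<dots> = (\<integral>\<^sup>+z. \<integral>\<^sup>+b. \<integral>\<^sup>+a. f (coords3 a b z) \<partial>lborel \<partial>lborel \<partial>lborel)"
  proof (intro nn_integral_cong)
    fix z
    have "(\<integral>\<^sup>+y. f (y, z) \<partial>lborel) = (\<integral>\<^sup>+p. f (case p of (a, b) \<Rightarrow> a *\<^sub>R axis 1 1 + b *\<^sub>R axis 2 1, z) \<partial>(lborel \<Otimes>\<^sub>M lborel))"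
      by (subst lborel_real2, subst nn_integral_distr) measurable
    also have "\<dots> = (\<integral>\<^sup>+b. \<integral>\<^sup>+a. f (coords3 a b z) \<partial>lborel \<partial>lborel)"
      by (subst lborel_pair.nn_integral_snd[symmetric]) (simp_all add: coords3_def)
    finally show "(\<integral>\<^sup>+y. f (y, z) \<partial>lborel) = (\<integral>\<^sup>+b. \<integral>\<^sup>+a. f (coords3 a b z) \<partial>lborel \<partial>lborel)" .
  qed
  finally show ?thesis .
qed

text \<open>Far enough back on the line \<open>\<phi>\<close> vanishes, so its fourth power is the
  integral of its derivative. The exponent is 4 because the derivative then contains
  \<open>\<phi> ^ 3\<close>, whose square is the sixth power to be estimated.\<close>

lemma C1c_power4_le:
  assumes C: "C1c \<Omega> \<phi> G" and e: "norm e = 1"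
  shows "ennreal (\<phi> x ^ 4) \<le> (\<integral>\<^sup>+s. ennreal \<bar>4 * \<phi> (x + s *\<^sub>R e) ^ 3 * (G (x + s *\<^sub>R e) \<bullet> e)\<bar> \<partial>lborel)"
proof -
  obtain K where K: "compact K" "\<And>x. x \<notin> K \<Longrightarrow> \<phi> x = 0"
    using C unfolding C1c_def by metis
  obtain r where r: "\<And>y. y \<in> K \<Longrightarrow> norm y \<le> r"
    using compact_imp_bounded[OF K(1)] by (auto simp: bounded_iff)
  \<comment> \<open>A step of length \<open>T\<close> from \<open>x\<close> leaves the ball of
    radius \<open>r\<close> around 0 that contains \<open>K\<close>.\<close>
  define T where "T = \<bar>r\<bar> + norm x + 1"
  have "norm (x - T *\<^sub>R e) \<ge> T - norm x"
    using norm_triangle_ineq2[of "T *\<^sub>R e" x] norm_minus_commute[of x "T *\<^sub>R e"] e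
    by (simp add: T_def del: scaleR_left_distrib)
  then have "x - T *\<^sub>R e \<notin> K"
    using r[of "x - T *\<^sub>R e"] by (auto simp: T_def)
  then have "x + (- T) *\<^sub>R e \<notin> K"
    by simp
  then have 0: "\<phi> (x + (- T) *\<^sub>R e) = 0"
    by (rule K(2))
  have "ennreal \<bar>\<phi> (x + 0 *\<^sub>R e) ^ 4 - \<phi> (x + (- T) *\<^sub>R e) ^ 4\<bar>
     \<le> (\<integral>\<^sup>+s. ennreal \<bar>4 * \<phi> (x + s *\<^sub>R e) ^ 3 * (G (x + s *\<^sub>R e) \<bullet> e)\<bar> * indicator {-T..0} s \<partial>lborel)"
  proof (rule abs_diff_le_nn_integral_derivative)
    show "- T \<le> 0" unfolding T_def using norm_ge_zero[of x] abs_ge_zero[of r] by linarith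
    show "((\<lambda>s. \<phi> (x + s *\<^sub>R e) ^ 4) has_real_derivative 4 * \<phi> (x + s *\<^sub>R e) ^ 3 * (G (x + s *\<^sub>R e) \<bullet> e)) (at s)" for s
      by (rule derivative_eq_intros C1c_has_real_derivative[OF C] refl | simp)+
    show "continuous_on UNIV (\<lambda>s. 4 * \<phi> (x + s *\<^sub>R e) ^ 3 * (G (x + s *\<^sub>R e) \<bullet> e))"
      by (auto intro!: continuous_intros continuous_on_compose2[OF C1c_continuous(1)[OF C]]
          continuous_on_compose2[OF C1c_continuous(2)[OF C]])
  qed
  also have "\<dots> \<le> (\<integral>\<^sup>+s. ennreal \<bar>4 * \<phi> (x + s *\<^sub>R e) ^ 3 * (G (x + s *\<^sub>R e) \<bullet> e)\<bar> \<partial>lborel)"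
    by (intro nn_integral_mono) (simp split: split_indicator)
  finally show ?thesis using 0 by simp
qed

lemma nn_integral_finite_compact_support:
  fixes f :: "'a::euclidean_space \<Rightarrow> real"
  assumes "continuous_on UNIV f" "compact K" "\<And>x. x \<notin> K \<Longrightarrow> f x = 0"
  shows "(\<integral>\<^sup>+x. ennreal \<bar>f x\<bar> \<partial>lborel) < \<infinity>"
proof -
  obtain B where B: "\<And>x. x \<in> K \<Longrightarrow> \<bar>f x\<bar> \<le> B"
    using compact_imp_bounded[OF compact_continuous_image[OF continuous_on_subset[OF assms(1)] assms(2)]]
    by (auto simp: bounded_iff)
  have K: "K \<in> sets borel"
    using assms(2) by (simp add: borel_compact)
  have "(\<integral>\<^sup>+x. ennreal \<bar>f x\<bar> \<partial>lborel) \<le> (\<integral>\<^sup>+x. ennreal B * indicator K x \<partial>lborel)"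
    using B assms(3) by (intro nn_integral_mono) (auto intro: ennreal_leI split: split_indicator)
  also have "\<dots> = ennreal B * emeasure lborel K"
    using K by (simp add: nn_integral_cmult_indicator)
  also have "\<dots> < \<infinity>"
    using emeasure_bounded_finite[OF compact_imp_bounded[OF assms(2)]] by (simp add: ennreal_mult_less_top)
  finally show ?thesis .
qed

lemma C1c_nn_integral_finite:
  assumes "C1c \<Omega> \<phi> G"
  shows "(\<integral>\<^sup>+x. ennreal ((norm (G x))\<^sup>2) \<partial>lborel) < \<infinity>" "(\<integral>\<^sup>+x. ennreal (\<phi> x ^ 6) \<partial>lborel) < \<infinity>"
proof -
  obtain K where K: "compact K" "\<And>x. x \<notin> K \<Longrightarrow> \<phi> x = 0" "\<And>x. x \<notin> K \<Longrightarrow> G x = 0"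
    using assms unfolding C1c_def by metis
  show "(\<integral>\<^sup>+x. ennreal ((norm (G x))\<^sup>2) \<partial>lborel) < \<infinity>"
    using nn_integral_finite_compact_support[of "\<lambda>x. (norm (G x))\<^sup>2" K] K
    by (simp add: continuous_intros C1c_continuous[OF assms])
  show "(\<integral>\<^sup>+x. ennreal (\<phi> x ^ 6) \<partial>lborel) < \<infinity>"
    using nn_integral_finite_compact_support[of "\<lambda>x. \<phi> x ^ 6" K] K
    by (simp add: continuous_intros C1c_continuous[OF assms])
qed

text \<open>
  The argument of Gagliardo and Nirenberg: the fourth power of \<open>\<phi>\<close> is bounded by the integral of its
  derivative along each coordinate line, and the three bounds are combined by Loomis--Whitney.
\<close>

lemma C1c_Sobolev:
  fixes \<phi> :: "space3 \<Rightarrow> real"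
  assumes C: "C1c \<Omega> \<phi> G"
  shows "(\<integral>\<^sup>+x. ennreal (\<phi> x ^ 6) \<partial>lborel) \<le> 4096 * (\<integral>\<^sup>+x. ennreal ((norm (G x))\<^sup>2) \<partial>lborel) ^ 3"
proof -
  note [measurable] = C1c_measurable[OF C]
  define S where "S = (\<integral>\<^sup>+x. ennreal (\<phi> x ^ 6) \<partial>lborel)"
  define E where "E = (\<integral>\<^sup>+x. ennreal ((norm (G x))\<^sup>2) \<partial>lborel)"
  define D where "D e x = ennreal \<bar>4 * \<phi> x ^ 3 * (G x \<bullet> e)\<bar>" for e x
  have [measurable]: "D e \<in> borel_measurable borel" for e
    unfolding D_def by measurable
  define P where "P e = (\<integral>\<^sup>+x. D e x \<partial>lborel)" for e
  \<comment> \<open>Splitting off the cube of \<open>\<phi>\<close> in Cauchy-Schwarz brings back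
    \<open>S\<close> itself; 16 is the square of the factor 4 from the derivative.\<close>
  have P: "(P e)\<^sup>2 \<le> 16 * S * E" if "norm e = 1" for e
  proof -
    have "(P e)\<^sup>2 = (\<integral>\<^sup>+x. ennreal \<bar>\<phi> x ^ 3\<bar> * ennreal (4 * \<bar>G x \<bullet> e\<bar>) \<partial>lborel)\<^sup>2"
      unfolding P_def D_def by (simp add: abs_mult mult_ac flip: ennreal_mult')
    also have "\<dots> \<le> (\<integral>\<^sup>+x. (ennreal \<bar>\<phi> x ^ 3\<bar>)\<^sup>2 \<partial>lborel) * (\<integral>\<^sup>+x. (ennreal (4 * \<bar>G x \<bullet> e\<bar>))\<^sup>2 \<partial>lborel)"
      by (intro Cauchy_Schwarz_nn_integral) measurable
    also have "\<dots> \<le> S * (16 * E)"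
    proof (intro mult_mono)
      show "(\<integral>\<^sup>+x. (ennreal \<bar>\<phi> x ^ 3\<bar>)\<^sup>2 \<partial>lborel) \<le> S"
        unfolding S_def by (simp add: ennreal_power flip: power_mult)
      have "(\<integral>\<^sup>+x. (ennreal (4 * \<bar>G x \<bullet> e\<bar>))\<^sup>2 \<partial>lborel) \<le> (\<integral>\<^sup>+x. 16 * ennreal ((norm (G x))\<^sup>2) \<partial>lborel)"
      proof (intro nn_integral_mono)
        fix x
        have "(4 * \<bar>G x \<bullet> e\<bar>)\<^sup>2 \<le> 16 * (norm (G x))\<^sup>2"
          using Cauchy_Schwarz_ineq[of "G x" e] that by (simp add: power_mult_distrib flip: power2_norm_eq_inner)
        then have "ennreal ((4 * \<bar>G x \<bullet> e\<bar>)\<^sup>2) \<le> ennreal (16 * (norm (G x))\<^sup>2)"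
          by (rule ennreal_leI)
        then show "(ennreal (4 * \<bar>G x \<bullet> e\<bar>))\<^sup>2 \<le> 16 * ennreal ((norm (G x))\<^sup>2)"
          by (simp add: ennreal_power ennreal_mult)
      qed
      then show "(\<integral>\<^sup>+x. (ennreal (4 * \<bar>G x \<bullet> e\<bar>))\<^sup>2 \<partial>lborel) \<le> 16 * E"
        unfolding E_def by (simp add: nn_integral_cmult)
    qed simp_all
    finally show ?thesis by (simp add: mult_ac)
  qed
  let ?e1 = "(axis 1 1, 0) :: space3" and ?e2 = "(axis 2 1, 0) :: space3" and ?e3 = "(0, 1) :: space3"
  have n: "norm ?e1 = 1" "norm ?e2 = 1" "norm ?e3 = 1"
    by (simp_all add: norm_Pair norm_axis_1)
  \<comment> \<open>Each of the three functions integrates out one coordinate and so depends on the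
    other two, which is the shape that Loomis-Whitney asks for.\<close>
  define F1 where "F1 b z = (\<integral>\<^sup>+a. D ?e1 (coords3 a b z) \<partial>lborel)" for b z
  define F2 where "F2 a z = (\<integral>\<^sup>+b. D ?e2 (coords3 a b z) \<partial>lborel)" for a z
  define F3 where "F3 a b = (\<integral>\<^sup>+z. D ?e3 (coords3 a b z) \<partial>lborel)" for a b
  have [measurable]: "case_prod F1 \<in> borel_measurable (borel \<Otimes>\<^sub>M borel)" 
    "case_prod F2 \<in> borel_measurable (borel \<Otimes>\<^sub>M borel)"
    "case_prod F3 \<in> borel_measurable (borel \<Otimes>\<^sub>M borel)"
    unfolding F1_def F2_def F3_def by measurable
  have c: "coords3 a b z + s *\<^sub>R ?e1 = coords3 (a + s) b z" "coords3 a b z + s *\<^sub>R ?e2 = coords3 a (b + s) z"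
     "coords3 a b z + s *\<^sub>R ?e3 = coords3 a b (z + s)" for a b z s
    by (simp_all add: coords3_def algebra_simps)
  have F: "ennreal (\<phi> (coords3 a b z) ^ 4) \<le> F1 b z" "ennreal (\<phi> (coords3 a b z) ^ 4) \<le> F2 a z"
     "ennreal (\<phi> (coords3 a b z) ^ 4) \<le> F3 a b" for a b z
  proof -
    have "(\<integral>\<^sup>+s. D ?e1 (coords3 (s + a) b z) \<partial>lborel) = F1 b z"
      unfolding F1_def by (rule nn_integral_lborel_shift) measurable
    then show "ennreal (\<phi> (coords3 a b z) ^ 4) \<le> F1 b z"
      using C1c_power4_le[OF C n(1), of "coords3 a b z"] unfolding c D_def by (simp add: add.commute)
    have "(\<integral>\<^sup>+s. D ?e2 (coords3 a (s + b) z) \<partial>lborel) = F2 a z"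
      unfolding F2_def by (rule nn_integral_lborel_shift) measurable
    then show "ennreal (\<phi> (coords3 a b z) ^ 4) \<le> F2 a z"
      using C1c_power4_le[OF C n(2), of "coords3 a b z"] unfolding c D_def by (simp add: add.commute)
    have "(\<integral>\<^sup>+s. D ?e3 (coords3 a b (s + z)) \<partial>lborel) = F3 a b"
      unfolding F3_def by (rule nn_integral_lborel_shift) measurable
    then show "ennreal (\<phi> (coords3 a b z) ^ 4) \<le> F3 a b"
      using C1c_power4_le[OF C n(3), of "coords3 a b z"] unfolding c D_def by (simp add: add.commute)
  qed
  \<comment> \<open>The sixth power is a product of three copies of the square, and each copy is at
    most the root of one line integral.\<close>
  have le: "ennreal (\<phi> (coords3 a b z) ^ 6) \<le> esqrt (F1 b z) * esqrt (F2 a z) * esqrt (F3 a b)" for a b z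
  proof -
    let ?p = "ennreal ((\<phi> (coords3 a b z))\<^sup>2)"
    have "?p \<le> esqrt (F1 b z)" "?p \<le> esqrt (F2 a z)" "?p \<le> esqrt (F3 a b)"
      using F[of a b z] by (auto intro!: le_esqrt simp: ennreal_power simp flip: power_mult)
    then have "?p * ?p * ?p \<le> esqrt (F1 b z) * esqrt (F2 a z) * esqrt (F3 a b)"
      by (intro mult_mono) simp_all
    also have "?p * ?p * ?p = ennreal (\<phi> (coords3 a b z) ^ 6)"
      by (subst ennreal_mult[symmetric], simp, simp)+ (simp add: numeral_eq_Suc mult.assoc)
    finally show ?thesis .
  qed
  have "S = (\<integral>\<^sup>+z. \<integral>\<^sup>+b. \<integral>\<^sup>+a. ennreal (\<phi> (coords3 a b z) ^ 6) \<partial>lborel \<partial>lborel \<partial>lborel)"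
    unfolding S_def by (rule nn_integral_coords3) measurable
  also have "\<dots> \<le> (\<integral>\<^sup>+z. \<integral>\<^sup>+b. \<integral>\<^sup>+a. esqrt (F1 b z) * esqrt (F2 a z) * esqrt (F3 a b) \<partial>lborel \<partial>lborel \<partial>lborel)"
    by (intro nn_integral_mono le)
  finally have "S\<^sup>2 \<le> (\<integral>\<^sup>+z. \<integral>\<^sup>+b. \<integral>\<^sup>+a. esqrt (F1 b z) * esqrt (F2 a z) * esqrt (F3 a b) \<partial>lborel \<partial>lborel \<partial>lborel)\<^sup>2"
    by (rule power_mono) simp
  also have "\<dots> \<le> (\<integral>\<^sup>+z. \<integral>\<^sup>+b. (esqrt (F1 b z))\<^sup>2 \<partial>lborel \<partial>lborel) * (\<integral>\<^sup>+z. \<integral>\<^sup>+a. (esqrt (F2 a z))\<^sup>2 \<partial>lborel \<partial>lborel)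
      * (\<integral>\<^sup>+b. \<integral>\<^sup>+a. (esqrt (F3 a b))\<^sup>2 \<partial>lborel \<partial>lborel)"
    by (intro Loomis_Whitney_nn_integral) (simp_all add: borel_prod[symmetric])
  also have "\<dots> = P ?e1 * P ?e2 * P ?e3"
  proof (intro arg_cong2[where f = "(*)"])
    have "P ?e1 = (\<integral>\<^sup>+z. \<integral>\<^sup>+b. F1 b z \<partial>lborel \<partial>lborel)"
      unfolding P_def F1_def by (rule nn_integral_coords3) measurable
    then show "(\<integral>\<^sup>+z. \<integral>\<^sup>+b. (esqrt (F1 b z))\<^sup>2 \<partial>lborel \<partial>lborel) = P ?e1" by simp
    have "P ?e2 = (\<integral>\<^sup>+z. \<integral>\<^sup>+b. \<integral>\<^sup>+a. D ?e2 (coords3 a b z) \<partial>lborel \<partial>lborel \<partial>lborel)"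
      unfolding P_def by (rule nn_integral_coords3) measurable
    also have "\<dots> = (\<integral>\<^sup>+z. \<integral>\<^sup>+a. F2 a z \<partial>lborel \<partial>lborel)"
      unfolding F2_def by (intro nn_integral_cong lborel_pair.Fubini') measurable
    finally show "(\<integral>\<^sup>+z. \<integral>\<^sup>+a. (esqrt (F2 a z))\<^sup>2 \<partial>lborel \<partial>lborel) = P ?e2" by simp
    have "P ?e3 = (\<integral>\<^sup>+z. \<integral>\<^sup>+b. \<integral>\<^sup>+a. D ?e3 (coords3 a b z) \<partial>lborel \<partial>lborel \<partial>lborel)"
      unfolding P_def by (rule nn_integral_coords3) measurable
    also have "\<dots> = (\<integral>\<^sup>+b. \<integral>\<^sup>+z. \<integral>\<^sup>+a. D ?e3 (coords3 a b z) \<partial>lborel \<partial>lborel \<partial>lborel)"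
      by (intro lborel_pair.Fubini') measurable
    also have "\<dots> = (\<integral>\<^sup>+b. \<integral>\<^sup>+a. F3 a b \<partial>lborel \<partial>lborel)"
      unfolding F3_def by (intro nn_integral_cong lborel_pair.Fubini') measurable
    finally show "(\<integral>\<^sup>+b. \<integral>\<^sup>+a. (esqrt (F3 a b))\<^sup>2 \<partial>lborel \<partial>lborel) = P ?e3" by simp
  qed
  finally have "(S\<^sup>2)\<^sup>2 \<le> (P ?e1 * P ?e2 * P ?e3)\<^sup>2"
    by (rule power_mono) simp
  also have "\<dots> = (P ?e1)\<^sup>2 * (P ?e2)\<^sup>2 * (P ?e3)\<^sup>2"
    by (simp add: power_mult_distrib)
  also have "\<dots> \<le> (16 * S * E) * (16 * S * E) * (16 * S * E)"
    by (intro mult_mono P n) simp_all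
  finally have main: "(S\<^sup>2)\<^sup>2 \<le> (16 * S * E) * (16 * S * E) * (16 * S * E)" .
  \<comment> \<open>The estimate now reads S^4 \<le> 16^3 S^3 E^3. Compact support makes
    \<open>S\<close> finite, so that S^3 can be cancelled; 4096 is 16^3.\<close>
  have "S < \<infinity>" "E < \<infinity>"
    using C1c_nn_integral_finite[OF C] by (simp_all add: S_def E_def)
  then obtain s t where st: "S = ennreal s" "E = ennreal t" "0 \<le> s" "0 \<le> t"
    by (cases S; cases E) auto
  have 16: "(16::ennreal) = ennreal 16" by simp
  have "(s\<^sup>2)\<^sup>2 \<le> (16 * s * t) * (16 * s * t) * (16 * s * t)"
    using main st(3,4) unfolding st 16 by (simp add: ennreal_power flip: ennreal_mult del: ennreal_numeral)
  then have "s ^ 3 * s \<le> s ^ 3 * (4096 * t ^ 3)"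
    by (simp add: numeral_eq_Suc algebra_simps)
  then have "s \<le> 4096 * t ^ 3"
    using st(3,4) by (cases "s = 0") auto
  then have "ennreal s \<le> ennreal (4096 * t ^ 3)"
    by (rule ennreal_leI)
  then show ?thesis
    using st(3,4) unfolding S_def[symmetric] E_def[symmetric] st
    by (simp add: ennreal_power ennreal_mult)
qed

lemma Minkowski_esqrt:
  assumes [measurable]: "f \<in> borel_measurable M" "g \<in> borel_measurable M"
  shows "esqrt (\<integral>\<^sup>+x. (f x + g x)\<^sup>2 \<partial>M) \<le> esqrt (\<integral>\<^sup>+x. (f x)\<^sup>2 \<partial>M) + esqrt (\<integral>\<^sup>+x. (g x)\<^sup>2 \<partial>M)"
proof -
  let ?F = "\<integral>\<^sup>+x. (f x)\<^sup>2 \<partial>M" and ?G = "\<integral>\<^sup>+x. (g x)\<^sup>2 \<partial>M"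
  have "(\<integral>\<^sup>+x. (f x + g x)\<^sup>2 \<partial>M) = ?F + ?G + 2 * (\<integral>\<^sup>+x. f x * g x \<partial>M)"
    by (simp add: power2_sum nn_integral_add nn_integral_cmult mult.assoc)
  also have "\<dots> \<le> ?F + ?G + 2 * (esqrt ?F * esqrt ?G)"
    by (intro add_left_mono mult_left_mono Cauchy_Schwarz_esqrt) simp_all
  also have "\<dots> = (esqrt ?F + esqrt ?G)\<^sup>2"
    by (simp add: power2_sum mult.assoc)
  finally have "(esqrt (\<integral>\<^sup>+x. (f x + g x)\<^sup>2 \<partial>M))\<^sup>2 \<le> (esqrt ?F + esqrt ?G)\<^sup>2"
    by simp
  then show ?thesis
    by (rule ennreal_power2_le_imp_le)
qed

lemma C1c_gradient:
  assumes "C1c \<Omega> \<phi> G" shows "gradient \<phi> = G"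
proof
  fix x
  have "frechet_derivative \<phi> (at x) = (\<lambda>h. G x \<bullet> h)"
    using frechet_derivative_at[OF C1c_has_derivative[OF assms]] by simp
  then show "gradient \<phi> x = G x"
    by (simp add: gradient_def euclidean_representation)
qed

section \<open>The norm of the completion\<close>

lemma test_functions_C1c:
  assumes "\<phi> \<in> test_functions \<Omega>"
  shows "C1c \<Omega> \<phi> (gradient \<phi>)"
proof -
  let ?K = "closure {x. \<phi> x \<noteq> 0}"
  have "Ck (Suc 0) \<phi>" and K: "compact ?K" "?K \<subseteq> \<Omega>"
    using assms unfolding test_functions_def by blast+
  then have d: "\<phi> differentiable_on UNIV"
    and c: "\<And>i. i \<in> Basis \<Longrightarrow> continuous_on UNIV (\<lambda>x. frechet_derivative \<phi> (at x) i)"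
    by simp_all
  have fd: "(\<phi> has_derivative frechet_derivative \<phi> (at x)) (at x)" for x
    using d by (simp add: differentiable_on_def frechet_derivative_works)
  have "frechet_derivative \<phi> (at x) h = gradient \<phi> x \<bullet> h" for x h
  proof -
    interpret linear "frechet_derivative \<phi> (at x)"
      using fd by (rule has_derivative_linear)
    have "frechet_derivative \<phi> (at x) h = frechet_derivative \<phi> (at x) (\<Sum>i\<in>Basis. (h \<bullet> i) *\<^sub>R i)"
      by (simp add: euclidean_representation)
    also have "\<dots> = gradient \<phi> x \<bullet> h"
      by (simp add: sum scale gradient_def inner_sum_left inner_sum_right inner_commute mult.commute)
    finally show ?thesis .
  qed
  then have d': "(\<phi> has_derivative (\<lambda>h. gradient \<phi> x \<bullet> h)) (at x)" for x
    using fd[of x] by presburger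
  have \<phi>0: "\<phi> x = 0" if "x \<notin> ?K" for x
    using that closure_subset[of "{x. \<phi> x \<noteq> 0}"] by blast
  \<comment> \<open>Off its closed support \<open>\<phi>\<close> vanishes on a neighbourhood of the
    point, so its derivative there is that of the zero function.\<close>
  have "gradient \<phi> x = 0" if "x \<notin> ?K" for x
  proof -
    have "((\<lambda>y. 0) has_derivative (\<lambda>h. gradient \<phi> x \<bullet> h)) (at x)"
    proof (rule has_derivative_transform_within_open[OF d'])
      show "open (- ?K)" "x \<in> - ?K"
        using that by auto
      show "\<phi> y = 0" if "y \<in> - ?K" for y
        using that by (intro \<phi>0) (rule ComplD)
    qed
    then have "(\<lambda>h. gradient \<phi> x \<bullet> h) = (\<lambda>h. 0)"
      by (rule has_derivative_unique) simp
    then show ?thesis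
      by (metis inner_eq_zero_iff)
  qed
  moreover have "continuous_on UNIV (gradient \<phi>)"
    unfolding gradient_def[abs_def] by (intro continuous_intros c)
  ultimately show ?thesis
    unfolding C1c_def using d' K \<phi>0 by blast
qed

lemma dirichlet_norm_nonneg [simp]: "0 \<le> dirichlet_norm \<Omega> \<phi>"
  by (simp add: dirichlet_norm_def)

text \<open>Translations and Fubini call for an integral over the whole space. The change is
  harmless because \<open>G\<close> vanishes off \<open>\<Omega>\<close>; and since the integral is
  finite, no default value of the Bochner integral or of \<open>enn2real\<close> intervenes.\<close>

lemma dirichlet_norm_C1c:
  assumes C: "C1c \<Omega> \<phi> G" and \<Omega>: "\<Omega> \<in> sets lebesgue"
  shows "ennreal (dirichlet_norm \<Omega> \<phi>) = esqrt (\<integral>\<^sup>+x. ennreal ((norm (G x))\<^sup>2) \<partial>lborel)"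
proof -
  note [measurable] = C1c_measurable[OF C]
  have [measurable]: "G \<in> borel_measurable lebesgue"
    using C1c_measurable[OF C] by (intro measurable_completion) simp
  have G0: "G x = 0" if "x \<notin> \<Omega>" for x
    using C that unfolding C1c_def by blast
  have "(\<integral>\<^sup>+x. ennreal ((norm (G x))\<^sup>2) \<partial>lebesgue_on \<Omega>) = (\<integral>\<^sup>+x. ennreal ((norm (G x))\<^sup>2) * indicator \<Omega> x \<partial>lebesgue)"
    using \<Omega> by (subst nn_integral_restrict_space) simp_all
  also have "\<dots> = (\<integral>\<^sup>+x. ennreal ((norm (G x))\<^sup>2) \<partial>lebesgue)"
    using G0 by (intro nn_integral_cong) (auto split: split_indicator)
  also have "\<dots> = (\<integral>\<^sup>+x. ennreal ((norm (G x))\<^sup>2) \<partial>lborel)"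
    by (rule nn_integral_completion)
  finally have eq: "(\<integral>\<^sup>+x. ennreal ((norm (G x))\<^sup>2) \<partial>lebesgue_on \<Omega>) = (\<integral>\<^sup>+x. ennreal ((norm (G x))\<^sup>2) \<partial>lborel)" .
  have "(LINT x|lebesgue_on \<Omega>. (norm (gradient \<phi> x))\<^sup>2) = enn2real (\<integral>\<^sup>+x. ennreal ((norm (G x))\<^sup>2) \<partial>lborel)"
    unfolding eq[symmetric] C1c_gradient[OF C]
    by (rule integral_eq_nn_integral) (auto intro!: measurable_restrict_space1)
  then show ?thesis
    using C1c_nn_integral_finite(1)[OF C] by (simp add: dirichlet_norm_def esqrt_def)
qed

lemma dirichlet_norm_triangle:
  assumes C: "C1c \<Omega> \<phi> G" "C1c \<Omega> \<psi> H" and \<Omega>: "\<Omega> \<in> sets lebesgue"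
  shows "dirichlet_norm \<Omega> \<phi> \<le> dirichlet_norm \<Omega> \<psi> + dirichlet_norm \<Omega> (\<lambda>x. \<phi> x - \<psi> x)"
proof -
  note [measurable] = C1c_measurable[OF C(1)] C1c_measurable[OF C(2)]
  have "ennreal (dirichlet_norm \<Omega> \<phi>) = esqrt (\<integral>\<^sup>+x. ennreal ((norm (G x))\<^sup>2) \<partial>lborel)"
    by (rule dirichlet_norm_C1c[OF C(1) \<Omega>])
  also have "\<dots> \<le> esqrt (\<integral>\<^sup>+x. (ennreal (norm (H x)) + ennreal (norm (G x - H x)))\<^sup>2 \<partial>lborel)"
  proof (rule le_esqrt, simp, rule nn_integral_mono)
    fix x
    have "norm (G x) \<le> norm (H x) + norm (G x - H x)"
      by (rule norm_triangle_sub)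
    then have "(norm (G x))\<^sup>2 \<le> (norm (H x) + norm (G x - H x))\<^sup>2"
      by (rule power_mono) simp
    then show "ennreal ((norm (G x))\<^sup>2) \<le> (ennreal (norm (H x)) + ennreal (norm (G x - H x)))\<^sup>2"
      by (simp add: ennreal_power flip: ennreal_plus)
  qed
  also have "\<dots> \<le> esqrt (\<integral>\<^sup>+x. (ennreal (norm (H x)))\<^sup>2 \<partial>lborel) + esqrt (\<integral>\<^sup>+x. (ennreal (norm (G x - H x)))\<^sup>2 \<partial>lborel)"
    by (rule Minkowski_esqrt) measurable
  also have "\<dots> = ennreal (dirichlet_norm \<Omega> \<psi> + dirichlet_norm \<Omega> (\<lambda>x. \<phi> x - \<psi> x))"
    by (simp add: dirichlet_norm_C1c[OF C(2) \<Omega>] dirichlet_norm_C1c[OF C1c_diff[OF C] \<Omega>] ennreal_power)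
  finally show ?thesis by (simp flip: ennreal_plus)
qed

text \<open>
  Fatou's lemma is applied twice to difference quotients of \<open>\<xi> N - \<xi> m\<close>: first as \<open>m\<close> tends to infinity, then
  as the step tends to zero.
\<close>

lemma C1c_closable:
  fixes \<xi> :: "nat \<Rightarrow> 'a::euclidean_space \<Rightarrow> real"
  assumes C: "\<And>n. C1c \<Omega> (\<xi> n) (G n)" and lim: "AE x in lborel. (\<lambda>n. \<xi> n x) \<longlonglongrightarrow> 0"
    and le: "\<And>m. m \<ge> N \<Longrightarrow> (\<integral>\<^sup>+x. ennreal ((norm (G N x - G m x))\<^sup>2) \<partial>lborel) \<le> \<epsilon>"
  shows "(\<integral>\<^sup>+x. ennreal ((norm (G N x))\<^sup>2) \<partial>lborel) \<le> of_nat DIM('a) * \<epsilon>"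
proof -
  note [measurable] = C1c_measurable[OF C]
  have 1: "(\<integral>\<^sup>+x. ennreal ((\<xi> N (x + t) - \<xi> N x)\<^sup>2) \<partial>lborel) \<le> ennreal ((norm t)\<^sup>2) * \<epsilon>" for t
  proof (rule nn_integral_le_of_AE_tendsto)
    let ?w = "\<lambda>m x. \<xi> N x - \<xi> m x"
    show "(\<lambda>x. ennreal ((?w m (x + t) - ?w m x)\<^sup>2)) \<in> borel_measurable lborel" for m
      by measurable
    from lim AE_lborel_shift[OF lim, of t]
    show "AE x in lborel. (\<lambda>m. ennreal ((?w m (x + t) - ?w m x)\<^sup>2)) \<longlonglongrightarrow> ennreal ((\<xi> N (x + t) - \<xi> N x)\<^sup>2)"
    proof eventually_elim
      case (elim x)
      have "(\<lambda>m. (?w m (x + t) - ?w m x)\<^sup>2) \<longlonglongrightarrow> ((\<xi> N (x + t) - 0) - (\<xi> N x - 0))\<^sup>2"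
        by (intro tendsto_intros elim)
      then show ?case by (intro tendsto_ennrealI) simp
    qed
    show "\<forall>\<^sub>F m in sequentially. (\<integral>\<^sup>+x. ennreal ((?w m (x + t) - ?w m x)\<^sup>2) \<partial>lborel) \<le> ennreal ((norm t)\<^sup>2) * \<epsilon>"
    proof (rule eventually_sequentiallyI)
      fix m assume "N \<le> m"
      have "(\<integral>\<^sup>+x. ennreal ((?w m (x + t) - ?w m x)\<^sup>2) \<partial>lborel)
          \<le> ennreal ((norm t)\<^sup>2) * (\<integral>\<^sup>+x. ennreal ((norm (G N x - G m x))\<^sup>2) \<partial>lborel)"
        by (rule C1c_translation[OF C1c_diff[OF C C]])
      also have "\<dots> \<le> ennreal ((norm t)\<^sup>2) * \<epsilon>"
        by (intro mult_left_mono le \<open>N \<le> m\<close>) simp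
      finally show "(\<integral>\<^sup>+x. ennreal ((?w m (x + t) - ?w m x)\<^sup>2) \<partial>lborel) \<le> ennreal ((norm t)\<^sup>2) * \<epsilon>" .
    qed
  qed simp
  have 2: "(\<integral>\<^sup>+x. ennreal ((G N x \<bullet> e)\<^sup>2) \<partial>lborel) \<le> \<epsilon>" if e: "e \<in> Basis" for e
  proof (rule nn_integral_le_of_AE_tendsto)
    define t where "t k = inverse (real (Suc k))" for k
    have t: "t k > 0" for k by (simp add: t_def)
    have t_lim: "t \<longlonglongrightarrow> 0"
      unfolding t_def by (rule LIMSEQ_inverse_real_of_nat)
    let ?f = "\<lambda>k x. ((\<xi> N (x + t k *\<^sub>R e) - \<xi> N x) / t k)\<^sup>2"
    show "(\<lambda>x. ennreal (?f k x)) \<in> borel_measurable lborel" for k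
      by measurable
    have "(\<lambda>k. ennreal (?f k x)) \<longlonglongrightarrow> ennreal ((G N x \<bullet> e)\<^sup>2)" for x
    proof -
      have "((\<lambda>s. \<xi> N (x + s *\<^sub>R e)) has_real_derivative G N x \<bullet> e) (at 0)"
        using C1c_has_real_derivative[OF C, of N x e 0] by simp
      then have "((\<lambda>h. (\<xi> N (x + h *\<^sub>R e) - \<xi> N x) / h) \<longlongrightarrow> G N x \<bullet> e) (at 0)"
        by (simp add: DERIV_def)
      moreover have "filterlim t (at 0) sequentially"
        unfolding filterlim_at using t_lim t by (auto simp: less_le)
      ultimately have "(\<lambda>k. (\<xi> N (x + t k *\<^sub>R e) - \<xi> N x) / t k) \<longlonglongrightarrow> G N x \<bullet> e"
        by (rule filterlim_compose)
      then show ?thesis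
        by (intro tendsto_ennrealI tendsto_power)
    qed
    then show "AE x in lborel. (\<lambda>k. ennreal (?f k x)) \<longlonglongrightarrow> ennreal ((G N x \<bullet> e)\<^sup>2)"
      by simp
    have "(\<integral>\<^sup>+x. ennreal (?f k x) \<partial>lborel) \<le> \<epsilon>" for k
    proof -
      have "(\<integral>\<^sup>+x. ennreal (?f k x) \<partial>lborel)
          = ennreal (inverse ((t k)\<^sup>2)) * (\<integral>\<^sup>+x. ennreal ((\<xi> N (x + t k *\<^sub>R e) - \<xi> N x)\<^sup>2) \<partial>lborel)"
        by (subst nn_integral_cmult[symmetric], measurable)
          (simp add: power_divide divide_inverse mult.commute power_mult_distrib power_inverse flip: ennreal_mult)
      also have "\<dots> \<le> ennreal (inverse ((t k)\<^sup>2)) * (ennreal ((norm (t k *\<^sub>R e))\<^sup>2) * \<epsilon>)"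
        by (intro mult_left_mono 1) simp
      also have "\<dots> = (ennreal (inverse ((t k)\<^sup>2)) * ennreal ((t k)\<^sup>2)) * \<epsilon>"
        using e by (simp add: mult.assoc)
      also have "ennreal (inverse ((t k)\<^sup>2)) * ennreal ((t k)\<^sup>2) = 1"
        using t[of k] by (subst ennreal_mult[symmetric]) simp_all
      finally show ?thesis by simp
    qed
    then show "\<forall>\<^sub>F k in sequentially. (\<integral>\<^sup>+x. ennreal (?f k x) \<partial>lborel) \<le> \<epsilon>"
      by simp
  qed simp
  have norm2: "(norm v)\<^sup>2 = (\<Sum>e\<in>Basis. (v \<bullet> e)\<^sup>2)" for v :: 'a
    unfolding power2_norm_eq_inner by (subst euclidean_inner) (simp add: power2_eq_square)
  have "(\<integral>\<^sup>+x. ennreal ((norm (G N x))\<^sup>2) \<partial>lborel) = (\<integral>\<^sup>+x. (\<Sum>e\<in>Basis. ennreal ((G N x \<bullet> e)\<^sup>2)) \<partial>lborel)"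
    by (simp add: norm2 sum_ennreal)
  also have "\<dots> = (\<Sum>e\<in>Basis. \<integral>\<^sup>+x. ennreal ((G N x \<bullet> e)\<^sup>2) \<partial>lborel)"
    by (rule nn_integral_sum) measurable
  \<comment> \<open>Every coordinate derivative is granted the full bound \<open>\<epsilon>\<close>,
    which costs the factor \<open>DIM('a)\<close>.\<close>
  also have "\<dots> \<le> (\<Sum>e\<in>(Basis::'a set). \<epsilon>)"
    by (intro sum_mono 2)
  finally show ?thesis by simp
qed

lemma AE_lebesgue_on_iff:
  assumes "\<Omega> \<in> sets lebesgue"
  shows "(AE x in lebesgue_on \<Omega>. P x) \<longleftrightarrow> (AE x in lborel. x \<in> \<Omega> \<longrightarrow> P x)"
  using assms by (subst AE_restrict_space_iff) (simp_all add: AE_completion_iff)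

lemma D12_represents_Cauchy:
  assumes "D12_represents \<Omega> \<phi> u" "e > 0"
  shows "\<exists>N. \<forall>m\<ge>N. \<forall>n\<ge>N. dirichlet_norm \<Omega> (\<lambda>x. \<phi> m x - \<phi> n x) < e"
  using assms by (simp add: D12_represents_def)

text \<open>The difference of the two sequences is Cauchy in the norm and tends to 0 almost
  everywhere, so \<open>C1c_closable\<close> forces its norms to 0. Thus \<open>u\<close> determines
  the class of the sequence.\<close>

lemma D12_represents_unique_limit:
  assumes u: "D12_represents \<Omega> \<phi> u" "D12_represents \<Omega> \<psi> u" and \<Omega>: "\<Omega> \<in> sets lebesgue"
  shows "(\<lambda>n. dirichlet_norm \<Omega> (\<lambda>x. \<phi> n x - \<psi> n x)) \<longlonglongrightarrow> 0"
proof (rule LIMSEQ_I)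
  fix r :: real assume r: "r > 0"
  \<comment> \<open>Two tails below \<open>r / 6\<close> keep the differences below
    \<open>r / 3\<close>. The factor 3 for the dimension turns the square of this into a third of
    the square of \<open>r\<close>.\<close>
  then have r6: "r / 6 > 0" by simp
  have C: "C1c \<Omega> (\<phi> n) (gradient (\<phi> n))" "C1c \<Omega> (\<psi> n) (gradient (\<psi> n))" for n
    using u by (auto simp: D12_represents_def intro!: test_functions_C1c)
  define \<xi> where "\<xi> n x = \<phi> n x - \<psi> n x" for n x
  define G where "G n x = gradient (\<phi> n) x - gradient (\<psi> n) x" for n x
  have CG: "C1c \<Omega> (\<xi> n) (G n)" for n
    unfolding \<xi>_def[abs_def] G_def[abs_def] by (intro C1c_diff C)
  obtain M where M: "\<forall>m\<ge>M. \<forall>n\<ge>M. dirichlet_norm \<Omega> (\<lambda>x. \<phi> m x - \<phi> n x) < r / 6"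
    using D12_represents_Cauchy[OF u(1) r6] by blast
  obtain M' where M': "\<forall>m\<ge>M'. \<forall>n\<ge>M'. dirichlet_norm \<Omega> (\<lambda>x. \<psi> m x - \<psi> n x) < r / 6"
    using D12_represents_Cauchy[OF u(2) r6] by blast
  have lim: "AE x in lborel. (\<lambda>n. \<xi> n x) \<longlonglongrightarrow> 0"
  proof -
    have "AE x in lborel. x \<in> \<Omega> \<longrightarrow> (\<lambda>n. \<phi> n x) \<longlonglongrightarrow> u x" "AE x in lborel. x \<in> \<Omega> \<longrightarrow> (\<lambda>n. \<psi> n x) \<longlonglongrightarrow> u x"
      using u \<Omega> by (auto simp: D12_represents_def AE_lebesgue_on_iff)
    then show ?thesis
    proof eventually_elim
      case (elim x)
      show ?case
      proof (cases "x \<in> \<Omega>")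
        case True
        then show ?thesis
          using tendsto_diff[of "\<lambda>n. \<phi> n x" "u x" _ "\<lambda>n. \<psi> n x" "u x"] elim by (simp add: \<xi>_def)
      next
        case False
        then have "\<xi> n x = 0" for n
          using CG[of n] unfolding C1c_def by blast
        then show ?thesis by simp
      qed
    qed
  qed
  show "\<exists>no. \<forall>n\<ge>no. norm (dirichlet_norm \<Omega> (\<lambda>x. \<phi> n x - \<psi> n x) - 0) < r"
  proof (intro exI allI impI)
    fix n assume n: "n \<ge> max M M'"
    have "(\<integral>\<^sup>+x. ennreal ((norm (G n x))\<^sup>2) \<partial>lborel) \<le> of_nat DIM(space3) * ennreal ((r / 3)\<^sup>2)"
    proof (rule C1c_closable[OF CG lim])
      fix m assume "m \<ge> n"
      have "dirichlet_norm \<Omega> (\<lambda>x. \<xi> n x - \<xi> m x) \<le> r / 3"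
      proof -
        have "dirichlet_norm \<Omega> (\<lambda>x. \<xi> n x - \<xi> m x) \<le>
          dirichlet_norm \<Omega> (\<lambda>x. \<phi> n x - \<phi> m x) +
          dirichlet_norm \<Omega> (\<lambda>x. (\<xi> n x - \<xi> m x) - (\<phi> n x - \<phi> m x))"
          by (rule dirichlet_norm_triangle[OF C1c_diff[OF CG CG] C1c_diff[OF C(1) C(1)] \<Omega>])
        also have "(\<lambda>x. (\<xi> n x - \<xi> m x) - (\<phi> n x - \<phi> m x)) = (\<lambda>x. \<psi> m x - \<psi> n x)"
          by (simp add: \<xi>_def fun_eq_iff)
        finally show ?thesis
          using M[rule_format, of n m] M'[rule_format, of m n] n \<open>m \<ge> n\<close> by simp
      qed
      then have "(ennreal (dirichlet_norm \<Omega> (\<lambda>x. \<xi> n x - \<xi> m x)))\<^sup>2 \<le> (ennreal (r / 3))\<^sup>2"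
        by (intro power_mono ennreal_leI) simp_all
      then show "(\<integral>\<^sup>+x. ennreal ((norm (G n x - G m x))\<^sup>2) \<partial>lborel) \<le> ennreal ((r / 3)\<^sup>2)"
        using r by (simp add: dirichlet_norm_C1c[OF C1c_diff[OF CG CG] \<Omega>] ennreal_power)
    qed
    also have "\<dots> = ennreal (3 * (r / 3)\<^sup>2)"
      by (simp add: ennreal_mult)
    also have "\<dots> < ennreal (r\<^sup>2)"
      using r by (intro ennreal_lessI) (simp_all add: power2_eq_square)
    finally have "(ennreal (dirichlet_norm \<Omega> (\<xi> n)))\<^sup>2 < ennreal (r\<^sup>2)"
      by (simp add: dirichlet_norm_C1c[OF CG \<Omega>])
    then have "(dirichlet_norm \<Omega> (\<xi> n))\<^sup>2 < r\<^sup>2"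
      by (simp add: ennreal_power ennreal_less_iff)
    then have "dirichlet_norm \<Omega> (\<xi> n) < r"
      using r by (simp add: power_less_imp_less_base)
    then show "norm (dirichlet_norm \<Omega> (\<lambda>x. \<phi> n x - \<psi> n x) - 0) < r"
      by (simp add: \<xi>_def[abs_def])
  qed
qed

text \<open>By the reverse triangle inequality the norms form a Cauchy sequence of reals, and by
  \<open>D12_represents_unique_limit\<close> all representing sequences share its limit. So the
  description in \<open>D12_norm\<close> denotes, and later proofs can use any representing
  sequence.\<close>

lemma D12_norm_tendsto:
  assumes u: "D12_represents \<Omega> \<phi> u" and \<Omega>: "\<Omega> \<in> sets lebesgue"
  shows "(\<lambda>n. dirichlet_norm \<Omega> (\<phi> n)) \<longlonglongrightarrow> D12_norm \<Omega> u"
proof -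
  have abs: "\<bar>dirichlet_norm \<Omega> \<phi> - dirichlet_norm \<Omega> \<psi>\<bar> \<le> dirichlet_norm \<Omega> (\<lambda>x. \<phi> x - \<psi> x)"
    if "\<phi> \<in> test_functions \<Omega>" "\<psi> \<in> test_functions \<Omega>" for \<phi> \<psi>
  proof -
    note C = that[THEN test_functions_C1c]
    have "dirichlet_norm \<Omega> (\<lambda>x. \<psi> x - \<phi> x) = dirichlet_norm \<Omega> (\<lambda>x. \<phi> x - \<psi> x)"
      unfolding dirichlet_norm_def C1c_gradient[OF C1c_diff[OF C]] C1c_gradient[OF C1c_diff[OF C(2,1)]]
      by (simp only: norm_minus_commute)
    then show ?thesis
      using dirichlet_norm_triangle[OF C \<Omega>] dirichlet_norm_triangle[OF C(2,1) \<Omega>] by simp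
  qed
  have t: "\<phi> n \<in> test_functions \<Omega>" for n
    using u by (simp add: D12_represents_def)
  have "Cauchy (\<lambda>n. dirichlet_norm \<Omega> (\<phi> n))"
  proof (rule CauchyI)
    fix e :: real assume "e > 0"
    then obtain M where M: "\<forall>m\<ge>M. \<forall>n\<ge>M. dirichlet_norm \<Omega> (\<lambda>x. \<phi> m x - \<phi> n x) < e"
      using D12_represents_Cauchy[OF u \<open>e > 0\<close>] by blast
    show "\<exists>M. \<forall>m\<ge>M. \<forall>n\<ge>M. norm (dirichlet_norm \<Omega> (\<phi> m) - dirichlet_norm \<Omega> (\<phi> n)) < e"
    proof (intro exI allI impI)
      fix m n assume "M \<le> m" "M \<le> n"
      then show "norm (dirichlet_norm \<Omega> (\<phi> m) - dirichlet_norm \<Omega> (\<phi> n)) < e"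
        using abs[OF t[of m] t[of n]] M[rule_format, of m n] by simp
    qed
  qed
  then obtain r where r: "(\<lambda>n. dirichlet_norm \<Omega> (\<phi> n)) \<longlonglongrightarrow> r"
    by (auto simp: Cauchy_convergent_iff convergent_def)
  have "D12_norm \<Omega> u = r"
    unfolding D12_norm_def
  proof (rule the_equality)
    show "\<exists>\<phi>. D12_represents \<Omega> \<phi> u \<and> (\<lambda>n. dirichlet_norm \<Omega> (\<phi> n)) \<longlonglongrightarrow> r"
      using u r by blast
    fix r' assume "\<exists>\<phi>. D12_represents \<Omega> \<phi> u \<and> (\<lambda>n. dirichlet_norm \<Omega> (\<phi> n)) \<longlonglongrightarrow> r'"
    then obtain \<psi> where \<psi>: "D12_represents \<Omega> \<psi> u" "(\<lambda>n. dirichlet_norm \<Omega> (\<psi> n)) \<longlonglongrightarrow> r'"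
      by blast
    have t': "\<psi> n \<in> test_functions \<Omega>" for n
      using \<psi>(1) by (simp add: D12_represents_def)
    have "(\<lambda>n. dirichlet_norm \<Omega> (\<psi> n) - dirichlet_norm \<Omega> (\<phi> n)) \<longlonglongrightarrow> 0"
      by (rule Lim_null_comparison[OF _ D12_represents_unique_limit[OF \<psi>(1) u \<Omega>]])
        (use abs[OF t' t] in simp)
    then have "r' - r = 0"
      by (rule LIMSEQ_unique[OF tendsto_diff[OF \<psi>(2) r]])
    then show "r' = r" by simp
  qed
  then show ?thesis using r by simp
qed

section \<open>Representatives of the elements of the completion\<close>

text \<open>These are the estimates that survive the passage to an almost everywhere limit. The
  translation estimate stands in for a gradient with norm at most \<open>D\<close>, and Borel
  measurability keeps translates and slices measurable.\<close>

definition Sobolev_bound :: "real \<Rightarrow> (space3 \<Rightarrow> real) \<Rightarrow> bool" where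
  "Sobolev_bound D w \<longleftrightarrow> w \<in> borel_measurable borel \<and>
     (\<forall>t. (\<integral>\<^sup>+x. ennreal ((w (x + t) - w x)\<^sup>2) \<partial>lborel) \<le> ennreal ((norm t)\<^sup>2 * D\<^sup>2)) \<and>
     (\<integral>\<^sup>+x. ennreal (w x ^ 6) \<partial>lborel) \<le> ennreal (4096 * D ^ 6)"

lemma D12_norm_nonneg:
  assumes "u \<in> D12 \<Omega>" and \<Omega>: "\<Omega> \<in> sets lebesgue"
  shows "0 \<le> D12_norm \<Omega> u"
proof -
  obtain \<phi> where "D12_represents \<Omega> \<phi> u"
    using assms(1) by (auto simp: D12_def)
  then show ?thesis
    by (intro LIMSEQ_le_const[OF D12_norm_tendsto[OF _ \<Omega>]]) auto
qed

lemma D12_representative: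
  assumes u: "u \<in> D12 \<Omega>" and \<Omega>: "open \<Omega>"
  obtains w where "\<And>x. x \<notin> \<Omega> \<Longrightarrow> w x = 0" "AE x in lborel. x \<in> \<Omega> \<longrightarrow> u x = w x"
    "Sobolev_bound (D12_norm \<Omega> u) w"
proof -
  have \<Omega>': "\<Omega> \<in> sets lebesgue" and [measurable]: "\<Omega> \<in> sets borel"
    using \<Omega> by auto
  obtain \<phi> where \<phi>: "D12_represents \<Omega> \<phi> u"
    using u by (auto simp: D12_def)
  define G where "G n = gradient (\<phi> n)" for n
  have C: "C1c \<Omega> (\<phi> n) (G n)" for n
    using \<phi> by (simp add: D12_represents_def G_def test_functions_C1c)
  note [measurable] = C1c_measurable[OF C]
  define d where "d n = dirichlet_norm \<Omega> (\<phi> n)" for n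
  define D where "D = D12_norm \<Omega> u"
  have d: "d \<longlonglongrightarrow> D"
    unfolding d_def D_def by (rule D12_norm_tendsto[OF \<phi> \<Omega>'])
  have dG: "(\<integral>\<^sup>+x. ennreal ((norm (G n x))\<^sup>2) \<partial>lborel) = ennreal ((d n)\<^sup>2)" for n
  proof -
    have "(ennreal (d n))\<^sup>2 = (\<integral>\<^sup>+x. ennreal ((norm (G n x))\<^sup>2) \<partial>lborel)"
      unfolding d_def dirichlet_norm_C1c[OF C \<Omega>'] by simp
    then show ?thesis by (simp add: ennreal_power d_def)
  qed
  \<comment> \<open>\<open>u\<close> itself is only Lebesgue measurable. The limit of the continuous
    \<open>\<phi> n\<close>, with default 0 where it fails to exist and off \<open>\<Omega>\<close>,
    is Borel and agrees with \<open>u\<close> almost everywhere on \<open>\<Omega>\<close>.\<close>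
  define w where "w x = (if x \<in> \<Omega> \<and> Cauchy (\<lambda>n. \<phi> n x) then lim (\<lambda>n. \<phi> n x) else 0)" for x
  have w_meas[measurable]: "w \<in> borel_measurable borel"
    unfolding w_def by measurable
  have uw: "AE x in lborel. x \<in> \<Omega> \<longrightarrow> u x = w x"
  proof -
    have "AE x in lborel. x \<in> \<Omega> \<longrightarrow> (\<lambda>n. \<phi> n x) \<longlonglongrightarrow> u x"
      using \<phi> \<Omega>' by (simp add: D12_represents_def AE_lebesgue_on_iff)
    then show ?thesis
      by eventually_elim (auto simp: w_def limI LIMSEQ_imp_Cauchy)
  qed
  have lim: "AE x in lborel. (\<lambda>n. \<phi> n x) \<longlonglongrightarrow> w x"
  proof -
    have "AE x in lborel. x \<in> \<Omega> \<longrightarrow> (\<lambda>n. \<phi> n x) \<longlonglongrightarrow> u x"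
      using \<phi> \<Omega>' by (simp add: D12_represents_def AE_lebesgue_on_iff)
    then show ?thesis
      using uw
    proof eventually_elim
      case (elim x)
      show ?case
      proof (cases "x \<in> \<Omega>")
        case False
        then have "\<phi> n x = 0" for n
          using C[of n] unfolding C1c_def by blast
        with False show ?thesis by (simp add: w_def)
      qed (use elim in simp)
    qed
  qed
  have "(\<integral>\<^sup>+x. ennreal ((w (x + t) - w x)\<^sup>2) \<partial>lborel) \<le> ennreal ((norm t)\<^sup>2 * D\<^sup>2)" for t
  proof (rule nn_integral_le_of_AE_tendsto)
    show "(\<lambda>x. ennreal ((\<phi> n (x + t) - \<phi> n x)\<^sup>2)) \<in> borel_measurable lborel" for n
      by measurable
    show "AE x in lborel. (\<lambda>n. ennreal ((\<phi> n (x + t) - \<phi> n x)\<^sup>2)) \<longlonglongrightarrow> ennreal ((w (x + t) - w x)\<^sup>2)"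
      using lim AE_lborel_shift[OF lim, of t]
      by eventually_elim (intro tendsto_intros tendsto_ennrealI)
    show "\<forall>\<^sub>F n in sequentially. (\<integral>\<^sup>+x. ennreal ((\<phi> n (x + t) - \<phi> n x)\<^sup>2) \<partial>lborel) \<le> ennreal ((norm t)\<^sup>2 * (d n)\<^sup>2)"
      using C1c_translation[OF C, of _ t] by (simp add: dG ennreal_mult)
    show "(\<lambda>n. ennreal ((norm t)\<^sup>2 * (d n)\<^sup>2)) \<longlonglongrightarrow> ennreal ((norm t)\<^sup>2 * D\<^sup>2)"
      by (intro tendsto_intros tendsto_ennrealI d)
  qed
  moreover have "(\<integral>\<^sup>+x. ennreal (w x ^ 6) \<partial>lborel) \<le> ennreal (4096 * D ^ 6)"
  proof (rule nn_integral_le_of_AE_tendsto)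
    show "(\<lambda>x. ennreal (\<phi> n x ^ 6)) \<in> borel_measurable lborel" for n
      by measurable
    show "AE x in lborel. (\<lambda>n. ennreal (\<phi> n x ^ 6)) \<longlonglongrightarrow> ennreal (w x ^ 6)"
      using lim by eventually_elim (intro tendsto_intros tendsto_ennrealI)
    have "(\<integral>\<^sup>+x. ennreal (\<phi> n x ^ 6) \<partial>lborel) \<le> ennreal (4096 * (d n) ^ 6)" for n
      using C1c_Sobolev[OF C, of n] by (simp add: dG ennreal_mult ennreal_power flip: power_mult)
    then show "\<forall>\<^sub>F n in sequentially. (\<integral>\<^sup>+x. ennreal (\<phi> n x ^ 6) \<partial>lborel) \<le> ennreal (4096 * (d n) ^ 6)"
      by simp
    show "(\<lambda>n. ennreal (4096 * (d n) ^ 6)) \<longlonglongrightarrow> ennreal (4096 * D ^ 6)"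
      by (intro tendsto_intros tendsto_ennrealI d)
  qed
  ultimately have "Sobolev_bound D w"
    using w_meas by (auto simp: Sobolev_bound_def)
  then show thesis
    using that[of w] uw by (simp add: D_def w_def)
qed

text \<open>
  Translating vertically by the height \<open>L\<close> makes the supports of \<open>w\<close> and of its translate disjoint.
\<close>

lemma Poincare_of_translation:
  assumes w: "Sobolev_bound D w" and supp: "\<And>y z. z \<notin> {a..<a + L} \<Longrightarrow> w (y, z) = 0" and "L \<ge> 0"
  shows "(\<integral>\<^sup>+x. ennreal ((w x)\<^sup>2) \<partial>lborel) \<le> ennreal (L\<^sup>2 * D\<^sup>2)"
proof -
  have [measurable]: "w \<in> borel_measurable borel"
    using w by (simp add: Sobolev_bound_def)
  have disj: "w (x + (0, L)) = 0 \<or> w x = 0" for x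
  proof (cases "w x = 0")
    case False
    then have "snd x \<in> {a..<a + L}"
      using supp[of "snd x" "fst x"] by fastforce
    \<comment> \<open>Half-openness matters: a shift by the exact length leaves the interval even
      from its left endpoint.\<close>
    then have "snd x + L \<notin> {a..<a + L}"
      by simp
    then have "w (fst x, snd x + L) = 0"
      by (rule supp)
    then show ?thesis by (cases x) simp
  qed simp
  have "(\<integral>\<^sup>+x. ennreal ((w x)\<^sup>2) \<partial>lborel) \<le> (\<integral>\<^sup>+x. ennreal ((w (x + (0, L)) - w x)\<^sup>2) \<partial>lborel)"
  proof (intro nn_integral_mono ennreal_leI)
    fix x
    show "(w x)\<^sup>2 \<le> (w (x + (0, L)) - w x)\<^sup>2"
      using disj[of x] by auto
  qed
  also have "\<dots> \<le> ennreal ((norm (0::real^2, L))\<^sup>2 * D\<^sup>2)"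
    using w unfolding Sobolev_bound_def by blast
  finally show ?thesis by simp
qed

section \<open>Means over cubes\<close>

text \<open>A grid cube is named by any of its points instead of an index: two points share a cube
  when their rescaled coordinates have equal integer parts. Membership is then a jointly measurable
  relation, as Fubini requires.\<close>

definition cell :: "real \<Rightarrow> 'a::euclidean_space \<Rightarrow> 'a set" where
  "cell h x = {y. \<forall>i\<in>Basis. \<lfloor>y \<bullet> i / h\<rfloor> = \<lfloor>x \<bullet> i / h\<rfloor>}"

definition cellmean :: "real \<Rightarrow> ('a::euclidean_space \<Rightarrow> real) \<Rightarrow> 'a \<Rightarrow> real" where
  "cellmean h w x = (LINT y|lborel. indicator (cell h x) y * w y) / h ^ DIM('a)"

lemma cell_pred [measurable]:
  "Measurable.pred (borel \<Otimes>\<^sub>M borel) (\<lambda>p. snd p \<in> cell h (fst p :: 'a::euclidean_space))"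
  unfolding cell_def mem_Collect_eq by measurable

lemma cell_borel [measurable]: "cell h x \<in> sets borel"
proof -
  have "cell h x = {y \<in> space borel. y \<in> cell h x}" by simp
  also have "\<dots> \<in> sets borel"
    unfolding cell_def mem_Collect_eq by measurable
  finally show ?thesis .
qed

text \<open>The half-open cube lies between an open and a closed box with the same side lengths, and
  these have equal volume.\<close>

lemma emeasure_cell:
  fixes x :: "'a::euclidean_space"
  assumes h: "h > 0"
  shows "emeasure lborel (cell h x) = ennreal (h ^ DIM('a))"
proof -
  define a where "a = (\<Sum>i\<in>Basis. (h * of_int \<lfloor>x \<bullet> i / h\<rfloor>) *\<^sub>R i)"
  have ai: "a \<bullet> i = h * of_int \<lfloor>x \<bullet> i / h\<rfloor>" if "i \<in> Basis" for i
    using that by (simp add: a_def)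
  have le: "\<And>i. i \<in> Basis \<Longrightarrow> a \<bullet> i \<le> (a + h *\<^sub>R One) \<bullet> i"
    using h by (simp add: inner_add_left)
  have "y \<in> cell h x \<longleftrightarrow> (\<forall>i\<in>Basis. a \<bullet> i \<le> y \<bullet> i \<and> y \<bullet> i < a \<bullet> i + h)" for y
    unfolding cell_def mem_Collect_eq floor_eq_iff using h
    by (intro ball_cong) (simp_all add: ai field_simps)
  then have "box a (a + h *\<^sub>R One) \<subseteq> cell h x" "cell h x \<subseteq> cbox a (a + h *\<^sub>R One)"
    by (auto simp: box_def cbox_def inner_add_left intro: less_imp_le)
  then have "emeasure lborel (box a (a + h *\<^sub>R One)) \<le> emeasure lborel (cell h x)"
    "emeasure lborel (cell h x) \<le> emeasure lborel (cbox a (a + h *\<^sub>R One))"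
    by (auto intro!: emeasure_mono)
  then show ?thesis
    using le h by (simp add: inner_add_left)
qed

text \<open>Puts every cell into a translate of one fixed cube, so that an integral over the cell of
  \<open>x\<close> is dominated by one over translations from a set independent of
  \<open>x\<close>.\<close>

lemma cell_subset:
  assumes h: "h > 0" and "y \<in> cell h x"
  shows "y - x \<in> cbox (- (h *\<^sub>R One)) (h *\<^sub>R One)"
  unfolding mem_box
proof (intro ballI conjI)
  fix i :: 'a assume i: "i \<in> Basis"
  have "\<lfloor>y \<bullet> i / h\<rfloor> = \<lfloor>x \<bullet> i / h\<rfloor>"
    using assms i by (simp add: cell_def)
  then have "\<bar>y \<bullet> i / h - x \<bullet> i / h\<bar> \<le> 1"
    by linarith
  then have "\<bar>y \<bullet> i - x \<bullet> i\<bar> \<le> h"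
    using h by (simp add: abs_le_iff field_simps)
  then show "- (h *\<^sub>R One) \<bullet> i \<le> (y - x) \<bullet> i" "(y - x) \<bullet> i \<le> h *\<^sub>R One \<bullet> i"
    using i by (simp_all add: inner_diff_left)
qed

lemma norm_le_cube:
  fixes t :: "'a::euclidean_space" and h :: real
  assumes "t \<in> cbox (- (h *\<^sub>R One)) (h *\<^sub>R One)"
  shows "(norm t)\<^sup>2 \<le> DIM('a) * h\<^sup>2"
proof -
  have "(norm t)\<^sup>2 = (\<Sum>i\<in>Basis. (t \<bullet> i)\<^sup>2)"
    unfolding power2_norm_eq_inner by (subst euclidean_inner) (simp add: power2_eq_square)
  also have "\<dots> \<le> (\<Sum>i\<in>(Basis::'a set). h\<^sup>2)"
  proof (intro sum_mono)
    fix i :: 'a assume "i \<in> Basis"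
    then have "\<bar>t \<bullet> i\<bar> \<le> h"
      using assms by (auto simp: mem_box abs_le_iff dest: bspec[of _ _ i])
    then show "(t \<bullet> i)\<^sup>2 \<le> h\<^sup>2"
      by (simp add: abs_le_square_iff[symmetric])
  qed
  finally show ?thesis by simp
qed

text \<open>A cell is determined by its vector \<open>k\<close> of integer parts, and these are
  bounded on a ball. Restricting \<open>k\<close> to \<open>Basis\<close> makes it extensional,
  hence a member of a finite \<open>PiE\<close> set.\<close>

lemma finite_cells: "finite (cell h ` cball (0::'a::euclidean_space) R)"
proof -
  define k where "k x = (\<lambda>i\<in>(Basis::'a set). \<lfloor>x \<bullet> i / h\<rfloor>)" for x :: 'a
  have c: "cell h x = {y. k y = k x}" for x :: 'a
    by (auto simp: cell_def k_def restrict_def fun_eq_iff split: if_splits)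
  have "k ` cball 0 R \<subseteq> (\<Pi>\<^sub>E i\<in>Basis. {\<lfloor>-(\<bar>R\<bar> / \<bar>h\<bar>)\<rfloor>..\<lfloor>\<bar>R\<bar> / \<bar>h\<bar>\<rfloor>})"
  proof (safe intro!: PiE_I)
    fix x i :: 'a assume x: "x \<in> cball 0 R" and i: "i \<in> Basis"
    have "\<bar>x \<bullet> i\<bar> \<le> \<bar>R\<bar>"
      using Basis_le_norm[OF i, of x] x by simp
    then have "\<bar>x \<bullet> i / h\<bar> \<le> \<bar>R\<bar> / \<bar>h\<bar>"
      by (simp add: divide_right_mono)
    then have "- (\<bar>R\<bar> / \<bar>h\<bar>) \<le> x \<bullet> i / h \<and> x \<bullet> i / h \<le> \<bar>R\<bar> / \<bar>h\<bar>"
      by linarith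
    then show "k x i \<in> {\<lfloor>-(\<bar>R\<bar> / \<bar>h\<bar>)\<rfloor>..\<lfloor>\<bar>R\<bar> / \<bar>h\<bar>\<rfloor>}"
      using i by (simp add: k_def floor_mono)
  qed (simp add: k_def)
  then have "finite (k ` cball 0 R)"
    by (rule finite_subset) (intro finite_PiE, auto)
  moreover have "cell h ` cball 0 R = (\<lambda>a. {y. k y = a}) ` (k ` cball 0 R)"
    by (simp add: c image_image)
  ultimately show ?thesis by simp
qed

lemma countable_cells: "countable (range (cell h :: 'a::euclidean_space \<Rightarrow> 'a set))"
proof -
  have "\<exists>n::nat. x \<in> cball 0 (real n)" for x :: 'a
    using real_arch_simple[of "norm x"] by simp
  then have "range (cell h) = (\<Union>n::nat. cell h ` cball (0::'a) (real n))"
    by blast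
  then show ?thesis
    by (simp add: countable_finite finite_cells)
qed

lemma integrable_cell:
  assumes h: "h > 0" and [measurable]: "w \<in> borel_measurable borel"
    and fin: "(\<integral>\<^sup>+x. ennreal ((w x)\<^sup>2) \<partial>lborel) < \<infinity>"
  shows "integrable lborel (\<lambda>y. indicator (cell h x) y * w y)"
proof (rule Bochner_Integration.integrable_bound)
  have "integrable lborel (\<lambda>x. (w x)\<^sup>2)"
    using fin by (intro integrableI_nonneg) auto
  moreover have "integrable lborel (indicator (cell h x) :: _ \<Rightarrow> real)"
    using h by (simp add: integrable_indicator_iff emeasure_cell)
  ultimately show "integrable lborel (\<lambda>y. indicator (cell h x) y + (w y)\<^sup>2)"
    by simp
  have "\<bar>a\<bar> \<le> 1 + a\<^sup>2" for a :: real
    using zero_le_power2[of "\<bar>a\<bar> - 1"] abs_ge_zero[of a] unfolding power2_diff by (simp del: zero_le_power2)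
  then show "AE y in lborel. norm (indicator (cell h x) y * w y) \<le> norm (indicator (cell h x) y + (w y)\<^sup>2)"
    by (auto split: split_indicator)
qed measurable

lemma cellmean_diff:
  assumes "h > 0" "v \<in> borel_measurable borel" "w \<in> borel_measurable borel"
    and "(\<integral>\<^sup>+x. ennreal ((v x)\<^sup>2) \<partial>lborel) < \<infinity>" "(\<integral>\<^sup>+x. ennreal ((w x)\<^sup>2) \<partial>lborel) < \<infinity>"
  shows "cellmean h (\<lambda>x. v x - w x) x = cellmean h v x - cellmean h w x"
  using integrable_cell[OF assms(1,2,4), of x] integrable_cell[OF assms(1,3,5), of x]
  by (simp add: cellmean_def right_diff_distrib diff_divide_distrib)

lemma cellmean_measurable [measurable]:
  fixes w :: "'a::euclidean_space \<Rightarrow> real"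
  assumes [measurable]: "w \<in> borel_measurable borel"
  shows "cellmean h w \<in> borel_measurable borel"
proof -
  have [measurable]: "(\<lambda>p. indicator (cell h (fst p)) (snd p) :: real) \<in> borel_measurable (borel \<Otimes>\<^sub>M (borel :: 'a measure))"
  proof -
    have "(\<lambda>p. indicator (cell h (fst p)) (snd p) :: real) = (\<lambda>p. if snd p \<in> cell h (fst p :: 'a) then 1 else 0)"
      by (auto simp: fun_eq_iff)
    also have "\<dots> \<in> borel_measurable (borel \<Otimes>\<^sub>M borel)"
      by measurable
    finally show ?thesis .
  qed
  have "(\<lambda>x. LINT y|lborel. indicator (cell h (fst (x, y))) (snd (x, y)) * w y) \<in> borel_measurable borel"
    by measurable
  then show ?thesis
    unfolding cellmean_def by simp
qed

lemma abs_integral_cell_power2_le: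
  fixes x :: "'a::euclidean_space"
  assumes h: "h > 0" and [measurable]: "w \<in> borel_measurable borel"
  shows "ennreal ((LINT y|lborel. indicator (cell h x) y * w y)\<^sup>2) \<le>
    ennreal (h ^ DIM('a)) * (\<integral>\<^sup>+y. ennreal ((w y)\<^sup>2) * indicator (cell h x) y \<partial>lborel)"
proof (cases "integrable lborel (\<lambda>y. indicator (cell h x) y * w y)")
  case True
  have "ennreal \<bar>LINT y|lborel. indicator (cell h x) y * w y\<bar> \<le> (\<integral>\<^sup>+y. norm (indicator (cell h x) y * w y) \<partial>lborel)"
    using integral_norm_bound_ennreal[OF True] by simp
  also have "\<dots> = (\<integral>\<^sup>+y. indicator (cell h x) y * (ennreal \<bar>w y\<bar> * indicator (cell h x) y) \<partial>lborel)"
    by (intro nn_integral_cong) (simp split: split_indicator)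
  finally have "(ennreal \<bar>LINT y|lborel. indicator (cell h x) y * w y\<bar>)\<^sup>2 \<le>
      (\<integral>\<^sup>+y. indicator (cell h x) y * (ennreal \<bar>w y\<bar> * indicator (cell h x) y) \<partial>lborel)\<^sup>2"
    by (rule power_mono) simp
  also have "\<dots> \<le> (\<integral>\<^sup>+y. (indicator (cell h x) y)\<^sup>2 \<partial>lborel) * (\<integral>\<^sup>+y. (ennreal \<bar>w y\<bar> * indicator (cell h x) y)\<^sup>2 \<partial>lborel)"
    by (rule Cauchy_Schwarz_nn_integral) measurable
  also have "(\<integral>\<^sup>+y. (indicator (cell h x) y)\<^sup>2 \<partial>lborel) = ennreal (h ^ DIM('a))"
    using h by (simp add: power2_eq_square emeasure_cell flip: indicator_inter_arith)
  also have "(\<integral>\<^sup>+y. (ennreal \<bar>w y\<bar> * indicator (cell h x) y)\<^sup>2 \<partial>lborel) = (\<integral>\<^sup>+y. ennreal ((w y)\<^sup>2) * indicator (cell h x) y \<partial>lborel)"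
    by (intro nn_integral_cong) (simp add: ennreal_power split: split_indicator)
  finally show ?thesis by (simp add: ennreal_power)
\<comment> \<open>Without integrability the Bochner integral is 0 by convention, so the left side
  vanishes.\<close>
qed (simp add: not_integrable_integral_eq)

text \<open>Jensen's inequality for the square, from the Cauchy-Schwarz bound on the integral over
  the cell.\<close>

lemma cellmean_power2_le:
  fixes x :: "'a::euclidean_space"
  assumes h: "h > 0" and [measurable]: "w \<in> borel_measurable borel"
  shows "ennreal ((cellmean h w x)\<^sup>2) \<le>
    ennreal (inverse (h ^ DIM('a))) * (\<integral>\<^sup>+y. ennreal ((w y)\<^sup>2) * indicator (cell h x) y \<partial>lborel)"
proof -
  let ?I = "LINT y|lborel. indicator (cell h x) y * w y" and ?m = "h ^ DIM('a)"
  have m: "?m > 0" using h by simp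
  have "ennreal ((cellmean h w x)\<^sup>2) = ennreal (inverse (?m\<^sup>2)) * ennreal (?I\<^sup>2)"
    by (simp add: cellmean_def power_divide divide_inverse mult.commute power_mult_distrib power_inverse flip: ennreal_mult)
  also have "\<dots> \<le> ennreal (inverse (?m\<^sup>2)) * (ennreal ?m * (\<integral>\<^sup>+y. ennreal ((w y)\<^sup>2) * indicator (cell h x) y \<partial>lborel))"
    by (intro mult_left_mono abs_integral_cell_power2_le h) simp_all
  also have "\<dots> = (ennreal (inverse (?m\<^sup>2)) * ennreal ?m) * (\<integral>\<^sup>+y. ennreal ((w y)\<^sup>2) * indicator (cell h x) y \<partial>lborel)"
    by (simp add: mult.assoc)
  also have "ennreal (inverse (?m\<^sup>2)) * ennreal ?m = ennreal (inverse ?m)"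
    using m h by (subst ennreal_mult[symmetric]) (simp_all add: power2_eq_square field_simps)
  finally show ?thesis .
qed

text \<open>The deviation is the mean of \<open>w x - w y\<close> over \<open>y\<close> in the cell,
  and \<open>y - x\<close> ranges in a cube of side \<open>2 * h\<close>. After Fubini each
  translation contributes at most \<open>DIM('a) * h\<^sup>2 * c\<close>, and
  \<open>2 ^ DIM('a)\<close> is the ratio of the volumes of that cube and the cell.\<close>

lemma cellmean_deviation:
  fixes w :: "'a::euclidean_space \<Rightarrow> real" and h c :: real
  assumes h: "h > 0" and [measurable]: "w \<in> borel_measurable borel"
    and fin: "(\<integral>\<^sup>+x. ennreal ((w x)\<^sup>2) \<partial>lborel) < \<infinity>"
    and tr: "\<And>t. (\<integral>\<^sup>+x. ennreal ((w (x + t) - w x)\<^sup>2) \<partial>lborel) \<le> ennreal ((norm t)\<^sup>2 * c)"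
    and c: "c \<ge> 0"
  shows "(\<integral>\<^sup>+x. ennreal ((w x - cellmean h w x)\<^sup>2) \<partial>lborel) \<le> ennreal (2 ^ DIM('a) * DIM('a) * h\<^sup>2 * c)"
proof -
  let ?m = "h ^ DIM('a)" and ?Q = "cbox (- (h *\<^sub>R One)) (h *\<^sub>R One) :: 'a set"
  have m: "?m > 0" using h by simp
  have pt: "ennreal ((w x - cellmean h w x)\<^sup>2) \<le>
      ennreal (inverse ?m) * (\<integral>\<^sup>+t. ennreal ((w (x + t) - w x)\<^sup>2) * indicator ?Q t \<partial>lborel)" for x
  proof -
    have eq: "(LINT y|lborel. indicator (cell h x) y * (w x - w y)) = w x * ?m - (LINT y|lborel. indicator (cell h x) y * w y)"
    proof -
      have i: "integrable lborel (indicator (cell h x) :: _ \<Rightarrow> real)"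
        using h by (simp add: integrable_indicator_iff emeasure_cell)
      have "measure lborel (cell h x) = ?m"
        using h by (simp add: measure_def emeasure_cell)
      then show ?thesis
        using i integrable_cell[OF h assms(2) fin, of x]
        by (simp add: right_diff_distrib mult.commute[of _ "w x"])
    qed
    have "w x - cellmean h w x = cellmean h (\<lambda>y. w x - w y) x"
      unfolding cellmean_def eq using m h by (simp add: diff_divide_distrib)
    then have "ennreal ((w x - cellmean h w x)\<^sup>2) \<le> ennreal (inverse ?m) * (\<integral>\<^sup>+y. ennreal ((w x - w y)\<^sup>2) * indicator (cell h x) y \<partial>lborel)"
      using cellmean_power2_le[OF h, of "\<lambda>y. w x - w y" x] by simp
    also have "\<dots> \<le> ennreal (inverse ?m) * (\<integral>\<^sup>+y. ennreal ((w y - w x)\<^sup>2) * indicator ?Q (y - x) \<partial>lborel)"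
      using cell_subset[OF h, of _ x]
      by (intro mult_left_mono nn_integral_mono) (auto simp: power2_commute split: split_indicator)
    also have "(\<integral>\<^sup>+y. ennreal ((w y - w x)\<^sup>2) * indicator ?Q (y - x) \<partial>lborel)
       = (\<integral>\<^sup>+t. ennreal ((w (t + x) - w x)\<^sup>2) * indicator ?Q (t + x - x) \<partial>lborel)"
      by (rule nn_integral_lborel_shift[symmetric]) measurable
    finally show ?thesis by (simp add: add.commute)
  qed
  have "(\<integral>\<^sup>+x. ennreal ((w x - cellmean h w x)\<^sup>2) \<partial>lborel) \<le>
      (\<integral>\<^sup>+x. ennreal (inverse ?m) * (\<integral>\<^sup>+t. ennreal ((w (x + t) - w x)\<^sup>2) * indicator ?Q t \<partial>lborel) \<partial>lborel)"
    by (intro nn_integral_mono pt)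
  also have "\<dots> = ennreal (inverse ?m) * (\<integral>\<^sup>+x. \<integral>\<^sup>+t. ennreal ((w (x + t) - w x)\<^sup>2) * indicator ?Q t \<partial>lborel \<partial>lborel)"
    by (rule nn_integral_cmult) measurable
  also have "(\<integral>\<^sup>+x. \<integral>\<^sup>+t. ennreal ((w (x + t) - w x)\<^sup>2) * indicator ?Q t \<partial>lborel \<partial>lborel)
      = (\<integral>\<^sup>+t. \<integral>\<^sup>+x. ennreal ((w (x + t) - w x)\<^sup>2) * indicator ?Q t \<partial>lborel \<partial>lborel)"
    by (rule lborel_pair.Fubini') measurable
  also have "\<dots> = (\<integral>\<^sup>+t. (\<integral>\<^sup>+x. ennreal ((w (x + t) - w x)\<^sup>2) \<partial>lborel) * indicator ?Q t \<partial>lborel)"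
    by (intro nn_integral_cong nn_integral_multc) measurable
  also have "\<dots> \<le> (\<integral>\<^sup>+t. ennreal (DIM('a) * h\<^sup>2 * c) * indicator ?Q t \<partial>lborel)"
  proof (intro nn_integral_mono)
    fix t :: 'a
    have "t \<in> ?Q \<Longrightarrow> (norm t)\<^sup>2 * c \<le> DIM('a) * h\<^sup>2 * c"
      by (intro mult_right_mono norm_le_cube c)
    then show "(\<integral>\<^sup>+x. ennreal ((w (x + t) - w x)\<^sup>2) \<partial>lborel) * indicator ?Q t \<le> ennreal (DIM('a) * h\<^sup>2 * c) * indicator ?Q t"
      using tr[of t] by (auto split: split_indicator intro: order_trans ennreal_leI)
  qed
  also have "\<dots> = ennreal (DIM('a) * h\<^sup>2 * c) * emeasure lborel ?Q"
    by (rule nn_integral_cmult_indicator) simp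
  also have "emeasure lborel ?Q = ennreal (2 ^ DIM('a) * ?m)"
  proof -
    have "(\<Prod>i\<in>(Basis :: 'a set). (h *\<^sub>R One - - (h *\<^sub>R One)) \<bullet> i) = (\<Prod>i\<in>(Basis :: 'a set). 2 * h)"
      by (intro prod.cong) (simp_all add: inner_add_left)
    then show ?thesis
      using h by (subst emeasure_lborel_cbox) (simp_all add: power_mult_distrib)
  qed
  also have "ennreal (inverse ?m) * (ennreal (DIM('a) * h\<^sup>2 * c) * ennreal (2 ^ DIM('a) * ?m)) = 
      ennreal (2 ^ DIM('a) * DIM('a) * h\<^sup>2 * c)"
    using m c h by (subst ennreal_mult[symmetric], simp, simp)+ (simp add: mult_ac)
  finally show ?thesis
    by (simp add: mult_left_mono)
qed

section \<open>Convergence of all means along one subsequence\<close>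

lemma diagonal_convergent:
  fixes f :: "nat \<Rightarrow> nat \<Rightarrow> real"
  assumes "\<And>k. bounded (range (f k))"
  obtains r where "strict_mono r" "\<And>k. convergent (\<lambda>n. f k (r n))"
proof -
  interpret subseqs "\<lambda>k s. convergent (\<lambda>n. f k (s n))"
  proof
    fix k and s :: "nat \<Rightarrow> nat"
    have "bounded (range (f k \<circ> s))"
      using assms[of k] by (rule bounded_subset) auto
    then obtain l r where "strict_mono r" "((f k \<circ> s) \<circ> r) \<longlonglongrightarrow> l"
      using bounded_imp_convergent_subsequence by blast
    then show "\<exists>r'. strict_mono r' \<and> convergent (\<lambda>n. f k ((s \<circ> r') n))"
      by (auto simp: o_def convergent_def)
  qed
  have "convergent (\<lambda>n. f k (diagseq n))" for k
  proof -
    \<comment> \<open>The diagonal sequence is known to be a subsequence of the one selected for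
      \<open>f k\<close> only from index \<open>Suc k\<close> on; the initial segment does not
      affect convergence.\<close>
    have "convergent (\<lambda>n. f k ((diagseq \<circ> ((+) (Suc k))) n))"
    proof (rule diagseq_holds)
      fix r s :: "nat \<Rightarrow> nat" and n
      assume "strict_mono r" "convergent (\<lambda>m. f n (s m))"
      then show "convergent (\<lambda>m. f n ((s \<circ> r) m))"
        using convergent_subseq_convergent[of "\<lambda>m. f n (s m)" r] by (simp add: o_def)
    qed
    then have "convergent (\<lambda>n. f k (diagseq (n + Suc k)))"
      by (simp add: add.commute)
    then show ?thesis
      by (simp only: convergent_ignore_initial_segment[of "\<lambda>n. f k (diagseq n)"])
  qed
  then show thesis
    using that subseq_diagseq by blast
qed

text \<open>All mesh sizes together produce only countably many cells, and on each of them
  Cauchy-Schwarz bounds the integrals, so a single diagonal extraction serves them all.\<close>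

lemma cellmean_convergent_subsequence:
  fixes w :: "nat \<Rightarrow> 'a::euclidean_space \<Rightarrow> real"
  assumes [measurable]: "\<And>n. w n \<in> borel_measurable borel"
    and le: "\<And>n. (\<integral>\<^sup>+x. ennreal ((w n x)\<^sup>2) \<partial>lborel) \<le> ennreal c" and "c \<ge> 0"
  obtains r where "strict_mono r"
    "\<And>k x. convergent (\<lambda>n. cellmean (inverse (real (Suc k))) (w (r n)) x)"
proof -
  define h where "h k = inverse (real (Suc k))" for k
  define A where "A = (\<Union>k. range (cell (h k) :: 'a \<Rightarrow> 'a set))"
  have A: "countable A" "A \<noteq> {}"
    by (auto simp: A_def countable_cells)
  define L where "L S n = (LINT y|lborel. indicator S y * w n y)" for S n
  have bd: "bounded (range (L S))" if SA: "S \<in> A" for S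
  proof -
    obtain k x where S: "S = cell (h k) x"
      using SA unfolding A_def by blast
    have h: "h k > 0" by (simp add: h_def)
    have "\<bar>L S n\<bar> \<le> sqrt (h k ^ DIM('a) * c)" for n
    proof -
      have "ennreal ((L S n)\<^sup>2) \<le> ennreal (h k ^ DIM('a)) * (\<integral>\<^sup>+y. ennreal ((w n y)\<^sup>2) * indicator S y \<partial>lborel)"
        unfolding L_def S by (rule abs_integral_cell_power2_le[OF h]) simp
      also have "\<dots> \<le> ennreal (h k ^ DIM('a)) * ennreal c"
        by (intro mult_left_mono order_trans[OF nn_integral_mono le]) (auto split: split_indicator)
      finally have "(L S n)\<^sup>2 \<le> h k ^ DIM('a) * c"
        using h \<open>c \<ge> 0\<close> by (simp flip: ennreal_mult)
      then show ?thesis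
        by (simp add: real_le_rsqrt)
    qed
    then show ?thesis by (auto simp: bounded_iff)
  qed
  obtain r where r: "strict_mono r" "\<And>k. convergent (\<lambda>n. L (from_nat_into A k) (r n))"
    by (rule diagonal_convergent[of "\<lambda>k. L (from_nat_into A k)"]) (use bd from_nat_into[OF A(2)] in auto)
  have "convergent (\<lambda>n. L S (r n))" if "S \<in> A" for S
    using r(2)[of "to_nat_on A S"] from_nat_into_to_nat_on[OF A(1) that] by simp
  then have "convergent (\<lambda>n. L (cell (h k) x) (r n))" for k x
    unfolding A_def by blast
  then have "convergent (\<lambda>n. L (cell (h k) x) (r n) / h k ^ DIM('a))" for k x
    unfolding divide_inverse by (intro convergent_mult convergent_const)
  then show thesis
    using that[OF r(1)] by (simp add: L_def cellmean_def h_def)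
qed

section \<open>Mass of radial functions far from the axis\<close>

definition rot :: "real \<Rightarrow> real^2 \<Rightarrow> real^2" where
  "rot a y = (\<chi> i. if i = 1 then cos a * y $ 1 - sin a * y $ 2 else sin a * y $ 1 + cos a * y $ 2)"

lemma rot_nth [simp]: "rot a y $ 1 = cos a * y $ 1 - sin a * y $ 2"
  "rot a y $ 2 = sin a * y $ 1 + cos a * y $ 2"
  by (simp_all add: rot_def)

lemma power2_norm_real2: "(norm (y :: real^2))\<^sup>2 = (y $ 1)\<^sup>2 + (y $ 2)\<^sup>2"
  unfolding power2_norm_eq_inner inner_vec_def by (simp add: sum_2 power2_eq_square)

lemma orthogonal_transformation_rot: "orthogonal_transformation (rot a)"
proof -
  have "linear (rot a)"
    by (rule linearI) (simp_all add: vec_eq_iff forall_2 algebra_simps)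
  moreover have "norm (rot a y) = norm y" for y
  proof -
    have "(norm (rot a y))\<^sup>2 = ((sin a)\<^sup>2 + (cos a)\<^sup>2) * ((y $ 1)\<^sup>2 + (y $ 2)\<^sup>2)"
      unfolding power2_norm_real2 rot_nth by algebra
    then show ?thesis
      by (simp add: power2_norm_real2[symmetric])
  qed
  ultimately show ?thesis
    by (simp add: orthogonal_transformation)
qed

text \<open>The squared chord is the square of the norm times the sum of the squared differences of
  the cosines and of the sines. Dropping the sines is affordable, because the cosine alone separates
  angles between 0 and pi.\<close>

lemma dist_rot_ge: "\<bar>cos a - cos b\<bar> * norm y \<le> dist (rot a y) (rot b y)"
proof (rule power2_le_imp_le)
  have "(dist (rot a y) (rot b y))\<^sup>2 = ((cos a - cos b)\<^sup>2 + (sin a - sin b)\<^sup>2) * (norm y)\<^sup>2"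
    unfolding dist_norm power2_norm_real2 vector_minus_component rot_nth by algebra
  then show "(\<bar>cos a - cos b\<bar> * norm y)\<^sup>2 \<le> (dist (rot a y) (rot b y))\<^sup>2"
    by (simp add: power_mult_distrib mult_right_mono)
qed simp

text \<open>Boxes determine the measure, and the preimage of a box is its image under the inverse
  map, which is orthogonal too and so preserves volume.\<close>

lemma distr_lborel_orthogonal:
  fixes T :: "real^2 \<Rightarrow> real^2"
  assumes T: "orthogonal_transformation T"
  shows "distr lborel borel T = lborel"
proof (rule lborel_eqI[symmetric])
  have lin: "linear T" 
    using T by (rule orthogonal_transformation_linear)
  then have [measurable]: "T \<in> borel_measurable borel"
    by (intro borel_measurable_continuous_onI linear_continuous_on linear_conv_bounded_linear[THEN iffD1])
  fix l u :: "real^2"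
  assume le: "\<And>b. b \<in> Basis \<Longrightarrow> l \<bullet> b \<le> u \<bullet> b"
  have vim: "T -` box l u = inv T ` box l u"
    using bij_vimage_eq_inv_image[OF orthogonal_transformation_bij[OF T]] .
  have inv: "orthogonal_transformation (inv T)"
    using T by (rule orthogonal_transformation_inv)
  have m: "inv T ` box l u \<in> sets borel"
    unfolding vim[symmetric] using measurable_sets[of T borel borel "box l u"] by simp
  have "emeasure (distr lborel borel T) (box l u) = emeasure lborel (inv T ` box l u)"
    by (simp add: emeasure_distr vim)
  also have "\<dots> = emeasure lebesgue (inv T ` box l u)"
    using m by simp
  also have "\<dots> = ennreal (measure lebesgue (inv T ` box l u))"
    using measurable_orthogonal_image[OF inv lmeasurable_box, of l u]
    by (rule emeasure_eq_measure2)
  also have "\<dots> = ennreal (measure lebesgue (box l u))"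
    by (simp add: measure_orthogonal_image[OF inv lmeasurable_box])
  also have "\<dots> = (\<Prod>b\<in>Basis. (u - l) \<bullet> b)"
    using le by (simp add: measure_def emeasure_lborel_box_eq prod_nonneg inner_diff_left)
  finally show "emeasure (distr lborel borel T) (box l u) = (\<Prod>b\<in>Basis. (u - l) \<bullet> b)" .
qed simp

text \<open>
  Rotating by \<open>N\<close> distinct angles produces \<open>N\<close> disjoint balls of equal mass once the centre is far away.
\<close>

lemma radial_ball_mass:
  fixes N :: nat and \<rho> :: real
  shows "\<forall>\<^sub>F R in at_top. \<forall>v y0. v \<in> borel_measurable borel \<longrightarrow> radial_ae v \<longrightarrow> norm y0 \<ge> R \<longrightarrow>
    of_nat N * (\<integral>\<^sup>+y. ennreal ((v y)\<^sup>2) * indicator (ball y0 \<rho>) y \<partial>lborel) \<le> (\<integral>\<^sup>+y. ennreal ((v y)\<^sup>2) \<partial>lborel)"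
proof -
  \<comment> \<open>Distinct angles in the unit interval, hence in the range from 0 to pi where the
    cosine is injective.\<close>
  define a where "a j = inverse (real (Suc j))" for j
  have cos: "\<bar>cos (a i) - cos (a j)\<bar> > 0" if "i \<noteq> j" for i j
  proof -
    have "0 \<le> a k \<and> a k \<le> 1" for k
      by (simp add: a_def field_simps)
    then have "0 \<le> a k \<and> a k \<le> pi" for k
      using pi_gt3 by (meson less_imp_le one_le_numeral order_trans)
    then have "cos (a i) \<noteq> cos (a j)"
      using that cos_inj_pi[of "a i" "a j"] by (auto simp: a_def)
    then show ?thesis by simp
  qed
  have "\<forall>\<^sub>F R in at_top. 2 * \<rho> \<le> \<bar>cos (a (fst p)) - cos (a (snd p))\<bar> * R" if "fst p \<noteq> snd p" for p
    using eventually_ge_at_top[of "2 * \<rho> / \<bar>cos (a (fst p)) - cos (a (snd p))\<bar>"]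
    by eventually_elim (use cos[OF that] in \<open>simp add: field_simps\<close>)
  \<comment> \<open>Only finitely many pairs of angles occur, so one \<open>R\<close> serves them
    all, and it depends neither on \<open>v\<close> nor on the centre.\<close>
  then have "\<forall>\<^sub>F R in at_top. \<forall>p\<in>{p \<in> {..<N} \<times> {..<N}. fst p \<noteq> snd p}. 
      2 * \<rho> \<le> \<bar>cos (a (fst p)) - cos (a (snd p))\<bar> * R"
    by (intro eventually_ball_finite) auto
  then show ?thesis
  proof eventually_elim
    case (elim R)
    show ?case
    proof (intro allI impI)
      fix v :: "real^2 \<Rightarrow> real" and y0 :: "real^2"
      assume [measurable]: "v \<in> borel_measurable borel" and "radial_ae v" and R: "R \<le> norm y0"
      then obtain g where g: "AE y in lborel. v y = g (norm y)"
        by (auto simp: radial_ae_def AE_completion_iff)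
      define B where "B j = ball (rot (a j) y0) \<rho>" for j
      have [measurable]: "B j \<in> sets borel" for j
        by (simp add: B_def)
      have eq: "(\<integral>\<^sup>+y. ennreal ((v y)\<^sup>2) * indicator (B j) y \<partial>lborel)
          = (\<integral>\<^sup>+y. ennreal ((v y)\<^sup>2) * indicator (ball y0 \<rho>) y \<partial>lborel)" for j
      proof -
        let ?T = "rot (a j)"
        note o = orthogonal_transformation_rot[of "a j"]
        have [measurable]: "?T \<in> borel_measurable borel"
          using orthogonal_transformation_linear[OF o]
          by (intro borel_measurable_continuous_onI linear_continuous_on linear_conv_bounded_linear[THEN iffD1])
        \<comment> \<open>Symmetry holds only off a null set, and rotations preserve null sets. The
          profile \<open>g\<close> comes without measurability, so it is never integrated: it only
          links \<open>v\<close> to its rotated copy.\<close>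
        have "AE y in distr lborel borel ?T. v y = g (norm y)"
          using g by (simp only: distr_lborel_orthogonal[OF o])
        then have "AE y in lborel. v (?T y) = g (norm (?T y))"
          by (intro AE_distrD[where M' = borel and f = ?T]) simp_all
        then have AE: "AE y in lborel. v (?T y) = v y"
          using g by eventually_elim (simp add: orthogonal_transformation_norm[OF o])
        have ind: "?T y \<in> B j \<longleftrightarrow> y \<in> ball y0 \<rho>" for y
          by (simp add: B_def conjunct2[OF iffD1[OF orthogonal_transformation_isometry o]])
        have "(\<integral>\<^sup>+y. ennreal ((v y)\<^sup>2) * indicator (B j) y \<partial>lborel)
            = (\<integral>\<^sup>+y. ennreal ((v y)\<^sup>2) * indicator (B j) y \<partial>distr lborel borel ?T)"
          by (simp only: distr_lborel_orthogonal[OF o])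
        also have "\<dots> = (\<integral>\<^sup>+y. ennreal ((v (?T y))\<^sup>2) * indicator (B j) (?T y) \<partial>lborel)"
          by (subst nn_integral_distr) measurable
        also have "\<dots> = (\<integral>\<^sup>+y. ennreal ((v y)\<^sup>2) * indicator (ball y0 \<rho>) y \<partial>lborel)"
          using AE by (intro nn_integral_cong_AE, eventually_elim) (simp add: ind indicator_def)
        finally show ?thesis .
      qed
      have disj: "disjoint_family_on B {..<N}"
      proof (unfold disjoint_family_on_def, intro ballI impI)
        fix i j assume "i \<in> {..<N}" "j \<in> {..<N}" "i \<noteq> j"
        then have "2 * \<rho> \<le> \<bar>cos (a i) - cos (a j)\<bar> * R"
          using elim[rule_format, of "(i, j)"] by simp
        also have "\<dots> \<le> \<bar>cos (a i) - cos (a j)\<bar> * norm y0"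
          using R by (intro mult_left_mono) simp_all
        also have "\<dots> \<le> dist (rot (a i) y0) (rot (a j) y0)"
          by (rule dist_rot_ge)
        finally show "B i \<inter> B j = {}"
          unfolding B_def by (intro disjoint_ballI) simp
      qed
      have "of_nat N * (\<integral>\<^sup>+y. ennreal ((v y)\<^sup>2) * indicator (ball y0 \<rho>) y \<partial>lborel) =
          (\<Sum>j<N. \<integral>\<^sup>+y. ennreal ((v y)\<^sup>2) * indicator (B j) y \<partial>lborel)"
        by (simp add: eq)
      also have "\<dots> = (\<integral>\<^sup>+y. (\<Sum>j<N. ennreal ((v y)\<^sup>2) * indicator (B j) y) \<partial>lborel)"
        by (subst nn_integral_sum) measurable
      also have "\<dots> \<le> (\<integral>\<^sup>+y. ennreal ((v y)\<^sup>2) \<partial>lborel)"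
        by (intro nn_integral_mono)
          (simp add: sum_distrib_left[symmetric] indicator_UN_disjoint[OF _ disj, symmetric] split: split_indicator)
      finally show "of_nat N * (\<integral>\<^sup>+y. ennreal ((v y)\<^sup>2) * indicator (ball y0 \<rho>) y \<partial>lborel) \<le> (\<integral>\<^sup>+y. ennreal ((v y)\<^sup>2) \<partial>lborel)" .
    qed
  qed
qed

text \<open>Almost every horizontal slice is radial, and the planar threshold \<open>R\<close> is
  the same for all slices, so the planar estimate can be integrated over the height.\<close>

lemma radial_cylinder_mass:
  fixes N :: nat and \<rho> :: real
  shows "\<forall>\<^sub>F R in at_top. \<forall>(w :: space3 \<Rightarrow> real) (y0 :: real^2). w \<in> borel_measurable borel \<longrightarrow>
    (AE z in lborel. radial_ae (\<lambda>y. w (y, z))) \<longrightarrow> norm y0 \<ge> R \<longrightarrow>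
    of_nat N * (\<integral>\<^sup>+x. ennreal ((w x)\<^sup>2) * indicator (ball y0 \<rho> \<times> UNIV) x \<partial>lborel) \<le> (\<integral>\<^sup>+x. ennreal ((w x)\<^sup>2) \<partial>lborel)"
  using radial_ball_mass[of N \<rho>]
proof eventually_elim
  case (elim R)
  show ?case
  proof (intro allI impI)
    fix w :: "space3 \<Rightarrow> real" and y0 :: "real^2"
    assume "w \<in> borel_measurable borel" and rad: "AE z in lborel. radial_ae (\<lambda>y. w (y, z))"
      and R: "R \<le> norm y0"
    then have [measurable]: "w \<in> borel_measurable (borel \<Otimes>\<^sub>M borel)"
      by (simp add: borel_prod)
    have [measurable]: "ball y0 \<rho> \<in> sets borel"
      by simp
    have fub: "(\<integral>\<^sup>+x. f x \<partial>(lborel :: space3 measure)) = (\<integral>\<^sup>+z. \<integral>\<^sup>+y. f (y, z) \<partial>lborel \<partial>lborel)"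
      if "f \<in> borel_measurable (borel \<Otimes>\<^sub>M borel)" for f
      unfolding lborel_prod[symmetric] using that by (intro lborel_pair.nn_integral_snd[symmetric]) simp
    have "of_nat N * (\<integral>\<^sup>+x. ennreal ((w x)\<^sup>2) * indicator (ball y0 \<rho> \<times> UNIV) x \<partial>lborel)
        = of_nat N * (\<integral>\<^sup>+z. \<integral>\<^sup>+y. ennreal ((w (y, z))\<^sup>2) * indicator (ball y0 \<rho>) y \<partial>lborel \<partial>lborel)"
      by (subst fub, measurable) (simp add: indicator_times)
    also have "\<dots> = (\<integral>\<^sup>+z. of_nat N * (\<integral>\<^sup>+y. ennreal ((w (y, z))\<^sup>2) * indicator (ball y0 \<rho>) y \<partial>lborel) \<partial>lborel)"
      by (rule nn_integral_cmult[symmetric]) measurable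
    also have "\<dots> \<le> (\<integral>\<^sup>+z. \<integral>\<^sup>+y. ennreal ((w (y, z))\<^sup>2) \<partial>lborel \<partial>lborel)"
    proof (rule nn_integral_mono_AE)
      show "AE z in lborel. of_nat N * (\<integral>\<^sup>+y. ennreal ((w (y, z))\<^sup>2) * indicator (ball y0 \<rho>) y \<partial>lborel)
          \<le> (\<integral>\<^sup>+y. ennreal ((w (y, z))\<^sup>2) \<partial>lborel)"
        using rad
      proof eventually_elim
        case (elim z)
        have "(\<lambda>y. w (y, z)) \<in> borel_measurable borel"
          by measurable
        with elim R show ?case
          using \<open>\<forall>v y0. _\<close>[rule_format, of "\<lambda>y. w (y, z)" y0] by simp
      qed
    qed
    also have "\<dots> = (\<integral>\<^sup>+x. ennreal ((w x)\<^sup>2) \<partial>lborel)"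
      by (subst fub) auto
    finally show "of_nat N * (\<integral>\<^sup>+x. ennreal ((w x)\<^sup>2) * indicator (ball y0 \<rho> \<times> UNIV) x \<partial>lborel) \<le> (\<integral>\<^sup>+x. ennreal ((w x)\<^sup>2) \<partial>lborel)" .
  qed
qed

text \<open>A far cell is far from the axis or far above or below the slab. In the first case the
  mass near it is at most \<open>c / N\<close> by rotation; in the second \<open>w\<close> vanishes
  on it. The order of the quantifiers makes \<open>R\<close> uniform in \<open>w\<close>.\<close>

lemma radial_cellmean_tail:
  fixes \<delta> h c a L :: real
  assumes h: "h > 0" and \<delta>: "\<delta> > 0" and c: "c \<ge> 0"
  shows "\<exists>R. \<forall>w (x :: space3). w \<in> borel_measurable borel \<longrightarrow> (AE z in lborel. radial_ae (\<lambda>y. w (y, z))) \<longrightarrow>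
    (\<forall>y z. z \<notin> {a..<a + L} \<longrightarrow> w (y, z) = 0) \<longrightarrow> (\<integral>\<^sup>+x. ennreal ((w x)\<^sup>2) \<partial>lborel) \<le> ennreal c \<longrightarrow>
    norm x > R \<longrightarrow> \<bar>cellmean h w x\<bar> \<le> \<delta>"
proof -
  \<comment> \<open>Large enough that a mass of \<open>c / N\<close> on a cell of volume
    \<open>h ^ 3\<close> forces the mean below \<open>\<delta>\<close>; the successor keeps
    \<open>N\<close> positive.\<close>
  define N where "N = Suc (nat \<lceil>c / (h ^ 3 * \<delta>\<^sup>2)\<rceil>)"
  have N: "c \<le> real N * (h ^ 3 * \<delta>\<^sup>2)"
  proof -
    have "c / (h ^ 3 * \<delta>\<^sup>2) \<le> real (nat \<lceil>c / (h ^ 3 * \<delta>\<^sup>2)\<rceil>)"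
      by (rule of_nat_ceiling)
    also have "\<dots> \<le> real N"
      by (simp add: N_def)
    finally show ?thesis
      using h \<delta> by (simp add: pos_divide_le_eq)
  qed
  obtain R where R: "\<forall>(w :: space3 \<Rightarrow> real) (y0 :: real^2). w \<in> borel_measurable borel \<longrightarrow>
    (AE z in lborel. radial_ae (\<lambda>y. w (y, z))) \<longrightarrow> norm y0 \<ge> R \<longrightarrow>
    of_nat N * (\<integral>\<^sup>+x. ennreal ((w x)\<^sup>2) * indicator (ball y0 (2 * h) \<times> UNIV) x \<partial>lborel) \<le> (\<integral>\<^sup>+x. ennreal ((w x)\<^sup>2) \<partial>lborel)"
    using eventually_happens'[OF trivial_limit_at_top_linorder radial_cylinder_mass[of N "2 * h"]] ..
  \<comment> \<open>The diagonal of a cell is at most \<open>sqrt 3 * h\<close>, which is below the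
    radius \<open>2 * h\<close> of the disc.\<close>
  have near: "norm (y - x) < 2 * h" if "y \<in> cell h x" for x y :: space3
  proof -
    have "(norm (y - x))\<^sup>2 \<le> 3 * h\<^sup>2"
      using norm_le_cube[OF cell_subset[OF h that]] by simp
    also have "\<dots> < (2 * h)\<^sup>2"
      using h by (simp add: power_mult_distrib)
    finally have "(norm (y - x))\<^sup>2 < (2 * h)\<^sup>2" .
    then show ?thesis
      by (rule power_less_imp_less_base) (use h in simp)
  qed
  show ?thesis
  proof (intro exI[of _ "\<bar>R\<bar> + (\<bar>a\<bar> + \<bar>L\<bar> + 2 * h)"] allI impI)
    fix w and x :: space3
    assume w[measurable]: "w \<in> borel_measurable borel" and rad: "AE z in lborel. radial_ae (\<lambda>y. w (y, z))"
      and supp: "\<forall>y z. z \<notin> {a..<a + L} \<longrightarrow> w (y, z) = 0"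
      and le: "(\<integral>\<^sup>+x. ennreal ((w x)\<^sup>2) \<partial>lborel) \<le> ennreal c"
      and x: "norm x > \<bar>R\<bar> + (\<bar>a\<bar> + \<bar>L\<bar> + 2 * h)"
    have "norm x \<le> norm (fst x) + \<bar>snd x\<bar>"
      using norm_Pair_le[of "fst x" "snd x"] by simp
    with x consider "norm (fst x) \<ge> R" | "\<bar>snd x\<bar> > \<bar>a\<bar> + \<bar>L\<bar> + 2 * h"
      by linarith
    then show "\<bar>cellmean h w x\<bar> \<le> \<delta>"
    proof cases
      case 1
      have "ennreal (real N) * ennreal ((cellmean h w x)\<^sup>2) \<le> 
        ennreal (real N) * (ennreal (inverse (h ^ 3)) * (\<integral>\<^sup>+y. ennreal ((w y)\<^sup>2) * indicator (cell h x) y \<partial>lborel))"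
        using cellmean_power2_le[OF h w, of x] by (intro mult_left_mono) simp_all
      also have "\<dots> \<le> ennreal (real N) * (ennreal (inverse (h ^ 3)) * (\<integral>\<^sup>+y. ennreal ((w y)\<^sup>2) * indicator (ball (fst x) (2 * h) \<times> UNIV) y \<partial>lborel))"
      proof (intro mult_left_mono nn_integral_mono)
        fix y :: space3
        have "y \<in> cell h x \<Longrightarrow> dist (fst x) (fst y) < 2 * h"
          using near[of y x] dist_fst_le[of x y] by (simp add: dist_norm norm_minus_commute)
        then show "indicator (cell h x) y \<le> (indicator (ball (fst x) (2 * h) \<times> UNIV) y :: ennreal)"
          by (auto split: split_indicator simp: mem_Times_iff)
      qed simp_all
      also have "\<dots> = ennreal (inverse (h ^ 3)) * (of_nat N * (\<integral>\<^sup>+y. ennreal ((w y)\<^sup>2) * indicator (ball (fst x) (2 * h) \<times> UNIV) y \<partial>lborel))"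
        by (simp add: ennreal_of_nat_eq_real_of_nat mult_ac)
      also have "\<dots> \<le> ennreal (inverse (h ^ 3)) * ennreal c"
        by (intro mult_left_mono order_trans[OF R[rule_format, OF w rad 1] le]) simp
      finally have "real N * (cellmean h w x)\<^sup>2 \<le> inverse (h ^ 3) * c"
        using h c by (simp flip: ennreal_mult)
      also have "\<dots> \<le> real N * \<delta>\<^sup>2"
        using N h by (simp add: field_simps)
      finally have "(cellmean h w x)\<^sup>2 \<le> \<delta>\<^sup>2"
        by (simp add: N_def)
      then show ?thesis
        using \<delta> by (simp add: abs_le_square_iff[symmetric])
    next
      case 2
      have "w y = 0" if "y \<in> cell h x" for y
      proof -
        have "\<bar>snd y - snd x\<bar> < 2 * h"
          using near[OF that] dist_snd_le[of y x] by (simp add: dist_norm)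
        then have "snd y \<notin> {a..<a + L}"
          using 2 unfolding atLeastLessThan_iff by linarith
        then show ?thesis
          using supp[rule_format, of "snd y" "fst y"] by simp
      qed
      then have "(\<lambda>y. indicator (cell h x) y * w y) = (\<lambda>y. 0)"
        by (simp add: fun_eq_iff indicator_def)
      then show ?thesis
        using \<delta> by (simp add: cellmean_def)
    qed
  qed
qed

section \<open>Compactness in intermediate Lebesgue spaces\<close>

text \<open>
  Here \<open>e\<close> is the cube mean of \<open>w\<close>: the three terms take care of small, intermediate and large values of \<open>w\<close>.
\<close>

lemma powr_interpolation_cell:
  fixes s \<epsilon> :: real
  assumes s: "2 < s" "s < 6" and \<epsilon>: "\<epsilon> > 0"
  obtains \<delta> K where "\<delta> > 0" "K \<ge> 0"
    "\<And>w e :: real. \<bar>e\<bar> \<le> \<delta> \<Longrightarrow> \<bar>w\<bar> powr s \<le> \<epsilon> * w\<^sup>2 + K * (w - e)\<^sup>2 + \<epsilon> * w ^ 6"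
proof -
  \<comment> \<open>\<open>2 * \<delta>\<close> and \<open>T\<close> are the heights where the
    powers \<open>s - 2\<close> and \<open>s - 6\<close> take the value \<open>\<epsilon>\<close>:
    below the first the square dominates, above the second the sixth power. In between
    \<open>w\<close> differs from \<open>e\<close> by at least \<open>\<delta>\<close>, and
    \<open>K\<close> is chosen to make this enough.\<close>
  define \<delta> where "\<delta> = \<epsilon> powr (1 / (s - 2)) / 2"
  define T where "T = \<epsilon> powr (1 / (s - 6))"
  define K where "K = T powr s / \<delta>\<^sup>2"
  have \<delta>: "\<delta> > 0" "(2 * \<delta>) powr (s - 2) = \<epsilon>"
    using s \<epsilon> by (simp_all add: \<delta>_def powr_powr)
  have T: "T > 0" "T powr (s - 6) = \<epsilon>"
    using s \<epsilon> by (simp_all add: T_def powr_powr)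
  have "\<bar>w\<bar> powr s \<le> \<epsilon> * w\<^sup>2 + K * (w - e)\<^sup>2 + \<epsilon> * w ^ 6" if e: "\<bar>e\<bar> \<le> \<delta>" for w e
  proof -
    have nn: "0 \<le> \<epsilon> * w\<^sup>2" "0 \<le> K * (w - e)\<^sup>2" "0 \<le> \<epsilon> * w ^ 6"
      using \<epsilon> by (simp_all add: K_def)
    consider "w = 0" | "w \<noteq> 0" "\<bar>w\<bar> \<le> 2 * \<delta>" | "w \<noteq> 0" "\<bar>w\<bar> \<ge> T" | "\<bar>w\<bar> > 2 * \<delta>" "\<bar>w\<bar> < T"
      by linarith
    then show ?thesis
    proof cases
      case 1
      then show ?thesis using nn by simp
    next
      case 2
      have "\<bar>w\<bar> powr s = \<bar>w\<bar> powr (s - 2) * w\<^sup>2"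
        using 2 powr_add[of "\<bar>w\<bar>" "s - 2" 2] by simp
      also have "\<dots> \<le> (2 * \<delta>) powr (s - 2) * w\<^sup>2"
        using 2 s by (intro mult_right_mono powr_mono2) auto
      finally show ?thesis using nn \<delta>(2) by simp
    next
      case 3
      have "\<bar>w\<bar> powr s = \<bar>w\<bar> powr (s - 6) * w ^ 6"
        using 3 powr_add[of "\<bar>w\<bar>" "s - 6" 6] by (simp add: power_even_abs)
      also have "\<dots> \<le> T powr (s - 6) * w ^ 6"
        using 3 s T by (intro mult_right_mono powr_mono2') auto
      finally show ?thesis using nn T(2) by simp
    next
      case 4
      have "\<bar>w\<bar> powr s \<le> T powr s"
        using 4 s by (intro powr_mono2) auto
      also have "\<dots> = K * \<delta>\<^sup>2"
        using \<delta> by (simp add: K_def)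
      also have "\<dots> \<le> K * (w - e)\<^sup>2"
      proof (rule mult_left_mono)
        have "\<bar>\<delta>\<bar> \<le> \<bar>w - e\<bar>"
          using 4 e \<delta>(1) by linarith
        then show "\<delta>\<^sup>2 \<le> (w - e)\<^sup>2"
          by (simp add: abs_le_square_iff)
      qed (simp add: K_def)
      finally show ?thesis using nn by linarith
    qed
  qed
  then show thesis
    using that[of \<delta> K] \<delta>(1) by (simp add: K_def)
qed

lemma Sobolev_bound_measurable: "Sobolev_bound D w \<Longrightarrow> w \<in> borel_measurable borel"
  by (simp add: Sobolev_bound_def)

lemma Sobolev_bound_translation:
  "Sobolev_bound D w \<Longrightarrow> (\<integral>\<^sup>+x. ennreal ((w (x + t) - w x)\<^sup>2) \<partial>lborel) \<le> ennreal ((norm t)\<^sup>2 * D\<^sup>2)"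
  unfolding Sobolev_bound_def by blast

lemma nn_integral_diff_power2_le:
  fixes v w :: "'a \<Rightarrow> real"
  assumes [measurable]: "v \<in> borel_measurable M" "w \<in> borel_measurable M"
    and "(\<integral>\<^sup>+x. ennreal ((v x)\<^sup>2) \<partial>M) \<le> ennreal c" "(\<integral>\<^sup>+x. ennreal ((w x)\<^sup>2) \<partial>M) \<le> ennreal c" "c \<ge> 0"
  shows "(\<integral>\<^sup>+x. ennreal ((v x - w x)\<^sup>2) \<partial>M) \<le> ennreal (4 * c)"
proof -
  have le: "(a - b)\<^sup>2 \<le> 2 * a\<^sup>2 + 2 * b\<^sup>2" for a b :: real
    using zero_le_power2[of "a + b"] unfolding power2_sum power2_diff by linarith
  have "(\<integral>\<^sup>+x. ennreal ((v x - w x)\<^sup>2) \<partial>M) \<le> (\<integral>\<^sup>+x. ennreal 2 * ennreal ((v x)\<^sup>2) + ennreal 2 * ennreal ((w x)\<^sup>2) \<partial>M)"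
    using le by (intro nn_integral_mono) (simp del: ennreal_numeral flip: ennreal_mult ennreal_plus)
  also have "\<dots> = ennreal 2 * (\<integral>\<^sup>+x. ennreal ((v x)\<^sup>2) \<partial>M) + ennreal 2 * (\<integral>\<^sup>+x. ennreal ((w x)\<^sup>2) \<partial>M)"
    by (simp add: nn_integral_add nn_integral_cmult del: ennreal_numeral)
  also have "\<dots> \<le> ennreal 2 * ennreal c + ennreal 2 * ennreal c"
    by (intro add_mono mult_left_mono assms) simp_all
  also have "\<dots> = ennreal (4 * c)"
    using assms(5) by (simp del: ennreal_numeral flip: ennreal_mult ennreal_plus)
  finally show ?thesis .
qed

text \<open>The factor 4 comes from
  \<open>(a - b)\<^sup>2 \<le> 2 * a\<^sup>2 + 2 * b\<^sup>2\<close>, and 128 is twice the 64 in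
  \<open>(a - b) ^ 6 \<le> 64 * a ^ 6 + 64 * b ^ 6\<close>. Crude constants suffice, since they are
  independent of the mesh.\<close>

lemma Sobolev_bound_diff:
  assumes v: "Sobolev_bound B v" and w: "Sobolev_bound B w"
  shows "(\<integral>\<^sup>+x. ennreal (((v (x + t) - w (x + t)) - (v x - w x))\<^sup>2) \<partial>lborel) \<le> ennreal ((norm t)\<^sup>2 * (4 * B\<^sup>2))"
    and "(\<integral>\<^sup>+x. ennreal ((v x - w x) ^ 6) \<partial>lborel) \<le> ennreal (128 * 4096 * B ^ 6)"
proof -
  note [measurable] = Sobolev_bound_measurable[OF v] Sobolev_bound_measurable[OF w]
  have "(\<integral>\<^sup>+x. ennreal (((v (x + t) - v x) - (w (x + t) - w x))\<^sup>2) \<partial>lborel) \<le> ennreal (4 * ((norm t)\<^sup>2 * B\<^sup>2))"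
    by (rule nn_integral_diff_power2_le[OF _ _ Sobolev_bound_translation[OF v] Sobolev_bound_translation[OF w]]) simp_all
  moreover have "(v (x + t) - v x) - (w (x + t) - w x) = (v (x + t) - w (x + t)) - (v x - w x)" for x
    by simp
  ultimately show "(\<integral>\<^sup>+x. ennreal (((v (x + t) - w (x + t)) - (v x - w x))\<^sup>2) \<partial>lborel) \<le> ennreal ((norm t)\<^sup>2 * (4 * B\<^sup>2))"
    by (simp add: mult_ac)
  have le: "(a - b) ^ 6 \<le> 64 * a ^ 6 + 64 * b ^ 6" for a b :: real
  proof -
    have "\<bar>a - b\<bar> \<le> 2 * max \<bar>a\<bar> \<bar>b\<bar>" by linarith
    then have "\<bar>a - b\<bar> ^ 6 \<le> (2 * max \<bar>a\<bar> \<bar>b\<bar>) ^ 6"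
      by (rule power_mono) simp
    also have "\<dots> \<le> 64 * (\<bar>a\<bar> ^ 6 + \<bar>b\<bar> ^ 6)"
      by (simp add: power_mult_distrib max_def)
    finally show ?thesis by (simp add: power_even_abs)
  qed
  have "(\<integral>\<^sup>+x. ennreal ((v x - w x) ^ 6) \<partial>lborel) \<le> (\<integral>\<^sup>+x. ennreal 64 * ennreal (v x ^ 6) + ennreal 64 * ennreal (w x ^ 6) \<partial>lborel)"
    using le by (intro nn_integral_mono) (simp del: ennreal_numeral flip: ennreal_mult ennreal_plus)
  also have "\<dots> = ennreal 64 * (\<integral>\<^sup>+x. ennreal (v x ^ 6) \<partial>lborel) + ennreal 64 * (\<integral>\<^sup>+x. ennreal (w x ^ 6) \<partial>lborel)"
    by (simp add: nn_integral_add nn_integral_cmult del: ennreal_numeral)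
  also have "\<dots> \<le> ennreal 64 * ennreal (4096 * B ^ 6) + ennreal 64 * ennreal (4096 * B ^ 6)"
    using v w by (intro add_mono mult_left_mono) (simp_all add: Sobolev_bound_def)
  also have "\<dots> = ennreal (128 * 4096 * B ^ 6)"
    by (simp del: ennreal_numeral flip: ennreal_mult ennreal_plus)
  finally show "(\<integral>\<^sup>+x. ennreal ((v x - w x) ^ 6) \<partial>lborel) \<le> ennreal (128 * 4096 * B ^ 6)" .
qed

section \<open>From convergent means to convergence in an intermediate exponent\<close>

lemma cellmean_cong_cell: "cell h x = cell h y \<Longrightarrow> cellmean h w x = cellmean h w y"
  by (simp add: cellmean_def)

text \<open>Only finitely many cells meet the ball, so convergence of the means is uniform on it;
  outside, two means of size at most \<open>\<delta> / 2\<close> differ by at most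
  \<open>\<delta>\<close>.\<close>

lemma cellmean_uniformly_Cauchy:
  fixes w :: "nat \<Rightarrow> 'a::euclidean_space \<Rightarrow> real" and \<delta> R :: real
  assumes conv: "\<And>x. convergent (\<lambda>n. cellmean h (w n) x)"
    and tail: "\<And>n x. norm x > R \<Longrightarrow> \<bar>cellmean h (w n) x\<bar> \<le> \<delta> / 2" and \<delta>: "\<delta> > 0"
  obtains M where "\<And>m n x. m \<ge> M \<Longrightarrow> n \<ge> M \<Longrightarrow> \<bar>cellmean h (w m) x - cellmean h (w n) x\<bar> \<le> \<delta>"
proof -
  \<comment> \<open>The mean becomes a function of the cell itself, through a chosen point, so that
    a finite set of cells can be quantified over in place of points.\<close>
  define \<mu> where "\<mu> S n = cellmean h (w n) (SOME x. cell h x = S)" for S n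
  have \<mu>: "cellmean h (w n) x = \<mu> (cell h x) n" for n x
    unfolding \<mu>_def by (rule cellmean_cong_cell) (metis (mono_tags, lifting) someI)
  have "\<forall>\<^sub>F M in sequentially. \<forall>m\<ge>M. \<forall>n\<ge>M. \<bar>\<mu> (cell h x) m - \<mu> (cell h x) n\<bar> \<le> \<delta>" for x
  proof -
    have "Cauchy (\<lambda>n. \<mu> (cell h x) n)"
      using conv[of x] unfolding \<mu> by (rule convergent_Cauchy)
    then obtain M where "\<forall>m\<ge>M. \<forall>n\<ge>M. norm (\<mu> (cell h x) m - \<mu> (cell h x) n) < \<delta>"
      using CauchyD \<delta> by blast
    then show ?thesis
      by (intro eventually_sequentiallyI[of M]) (auto intro: less_imp_le)
  qed
  then have "\<forall>\<^sub>F M in sequentially. \<forall>S\<in>cell h ` cball 0 R. \<forall>m\<ge>M. \<forall>n\<ge>M. \<bar>\<mu> S m - \<mu> S n\<bar> \<le> \<delta>"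
    by (intro eventually_ball_finite finite_cells) blast
  then obtain M where M: "\<forall>S\<in>cell h ` cball 0 R. \<forall>m\<ge>M. \<forall>n\<ge>M. \<bar>\<mu> S m - \<mu> S n\<bar> \<le> \<delta>"
    using eventually_happens'[OF sequentially_bot] by blast
  show thesis
  proof (rule that[of M])
    fix m n x assume mn: "m \<ge> M" "n \<ge> M"
    show "\<bar>cellmean h (w m) x - cellmean h (w n) x\<bar> \<le> \<delta>"
    proof (cases "norm x > R")
      case True
      then show ?thesis using tail[of x m] tail[of x n] by linarith
    next
      case False
      then show ?thesis using M mn unfolding \<mu> by simp
    qed
  qed
qed

text \<open>The order of choices matters: the uniform bounds fix \<open>\<eta>\<close>, this fixes
  \<open>\<delta>\<close> and \<open>K\<close>, then the mesh is taken so fine that the deviation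
  absorbs \<open>K\<close>, and only then is \<open>M\<close> chosen to bring the means of
  differences below \<open>\<delta>\<close>.\<close>

lemma Cauchy_Ls:
  fixes w :: "nat \<Rightarrow> space3 \<Rightarrow> real" and s B c \<epsilon> :: real
  assumes s: "2 < s" "s < 6"
    and B: "\<And>n. Sobolev_bound B (w n)"
    and le: "\<And>n. (\<integral>\<^sup>+x. ennreal ((w n x)\<^sup>2) \<partial>lborel) \<le> ennreal c" and c: "c \<ge> 0"
    and conv: "\<And>k x. convergent (\<lambda>n. cellmean (inverse (real (Suc k))) (w n) x)"
    and tail: "\<And>k \<delta>. \<delta> > 0 \<Longrightarrow> \<exists>R. \<forall>n x. norm x > R \<longrightarrow> \<bar>cellmean (inverse (real (Suc k))) (w n) x\<bar> \<le> \<delta>"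
    and \<epsilon>: "\<epsilon> > 0"
  shows "\<exists>M. \<forall>m\<ge>M. \<forall>n\<ge>M. (\<integral>\<^sup>+x. ennreal (\<bar>w m x - w n x\<bar> powr s) \<partial>lborel) \<le> ennreal \<epsilon>"
proof -
  note [measurable] = Sobolev_bound_measurable[OF B]
  define S6 where "S6 = 128 * 4096 * B ^ 6"
  have S6: "S6 \<ge> 0" by (simp add: S6_def)
  \<comment> \<open>Half of \<open>\<epsilon>\<close> is reserved for the square and the sixth power
    of a difference, whose integrals are at most \<open>4 * c\<close> and \<open>S6\<close>; the
    added 1 keeps the denominator positive.\<close>
  define \<eta> where "\<eta> = \<epsilon> / (2 * (4 * c + S6 + 1))"
  have \<eta>: "\<eta> > 0" "\<eta> * (4 * c + S6) \<le> \<epsilon> / 2"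
    using \<epsilon> c S6 by (simp_all add: \<eta>_def field_simps add_nonneg_pos)
  obtain \<delta> K where \<delta>: "\<delta> > 0" and K: "K \<ge> 0"
    and pw: "\<And>w e :: real. \<bar>e\<bar> \<le> \<delta> \<Longrightarrow> \<bar>w\<bar> powr s \<le> \<eta> * w\<^sup>2 + K * (w - e)\<^sup>2 + \<eta> * w ^ 6"
    using powr_interpolation_cell[OF s \<eta>(1)] by blast
  \<comment> \<open>24 is \<open>2 ^ 3 * 3\<close> from \<open>cellmean_deviation\<close> in
    dimension 3, and \<open>4 * B\<^sup>2\<close> is the translation constant of a
    difference.\<close>
  have "(\<lambda>k. K * (24 * (inverse (real (Suc k)))\<^sup>2 * (4 * B\<^sup>2))) \<longlonglongrightarrow> K * (24 * 0\<^sup>2 * (4 * B\<^sup>2))"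
    by (intro tendsto_intros LIMSEQ_inverse_real_of_nat)
  then have "\<forall>\<^sub>F k in sequentially. K * (24 * (inverse (real (Suc k)))\<^sup>2 * (4 * B\<^sup>2)) < \<epsilon> / 2"
    using \<epsilon> by (intro order_tendstoD(2)[of _ "K * (24 * 0\<^sup>2 * (4 * B\<^sup>2))"]) simp_all
  then obtain k where k: "K * (24 * (inverse (real (Suc k)))\<^sup>2 * (4 * B\<^sup>2)) < \<epsilon> / 2"
    using eventually_happens'[OF sequentially_bot] by blast
  define h where "h = inverse (real (Suc k))"
  have h: "h > 0" by (simp add: h_def)
  obtain R where R: "\<And>n x. norm x > R \<Longrightarrow> \<bar>cellmean h (w n) x\<bar> \<le> \<delta> / 2"
    using tail[of "\<delta> / 2" k] \<delta> unfolding h_def by auto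
  obtain M where M: "\<And>m n x. m \<ge> M \<Longrightarrow> n \<ge> M \<Longrightarrow> \<bar>cellmean h (w m) x - cellmean h (w n) x\<bar> \<le> \<delta>"
    using cellmean_uniformly_Cauchy[of h w R \<delta>] conv[of k] R \<delta> unfolding h_def by blast
  have "(\<integral>\<^sup>+x. ennreal (\<bar>w m x - w n x\<bar> powr s) \<partial>lborel) \<le> ennreal \<epsilon>" if mn: "m \<ge> M" "n \<ge> M" for m n
  proof -
    define d where "d x = w m x - w n x" for x
    have [measurable]: "d \<in> borel_measurable borel"
      unfolding d_def by measurable
    have d2: "(\<integral>\<^sup>+x. ennreal ((d x)\<^sup>2) \<partial>lborel) \<le> ennreal (4 * c)"
      unfolding d_def by (rule nn_integral_diff_power2_le[OF _ _ le le c]) measurable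
    have d6: "(\<integral>\<^sup>+x. ennreal (d x ^ 6) \<partial>lborel) \<le> ennreal S6"
      unfolding d_def S6_def by (rule Sobolev_bound_diff(2)[OF B B])
    have tr: "(\<integral>\<^sup>+x. ennreal ((d (x + t) - d x)\<^sup>2) \<partial>lborel) \<le> ennreal ((norm t)\<^sup>2 * (4 * B\<^sup>2))" for t
      unfolding d_def by (rule Sobolev_bound_diff(1)[OF B B])
    have fin: "(\<integral>\<^sup>+x. ennreal ((d x)\<^sup>2) \<partial>lborel) < \<infinity>"
      using d2 by (rule le_less_trans) simp
    have dev: "(\<integral>\<^sup>+x. ennreal ((d x - cellmean h d x)\<^sup>2) \<partial>lborel) \<le> ennreal (24 * h\<^sup>2 * (4 * B\<^sup>2))"
      using cellmean_deviation[OF h _ fin tr] by simp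
    have fin': "(\<integral>\<^sup>+x. ennreal ((w i x)\<^sup>2) \<partial>lborel) < \<infinity>" for i
      using le[of i] by (rule le_less_trans) simp
    have mean: "\<bar>cellmean h d x\<bar> \<le> \<delta>" for x
      using M[OF mn, of x] cellmean_diff[OF h _ _ fin'[of m] fin'[of n], of x] unfolding d_def by simp
    have "(\<integral>\<^sup>+x. ennreal (\<bar>d x\<bar> powr s) \<partial>lborel) \<le>
       (\<integral>\<^sup>+x. ennreal \<eta> * ennreal ((d x)\<^sup>2) + ennreal K * ennreal ((d x - cellmean h d x)\<^sup>2) + ennreal \<eta> * ennreal (d x ^ 6) \<partial>lborel)"
    proof (intro nn_integral_mono)
      fix x
      have "ennreal (\<bar>d x\<bar> powr s) \<le> ennreal (\<eta> * (d x)\<^sup>2 + K * (d x - cellmean h d x)\<^sup>2 + \<eta> * d x ^ 6)"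
        by (intro ennreal_leI pw mean)
      also have "\<dots> = ennreal \<eta> * ennreal ((d x)\<^sup>2) + ennreal K * ennreal ((d x - cellmean h d x)\<^sup>2) + ennreal \<eta> * ennreal (d x ^ 6)"
        using \<eta>(1) K by (simp add: ennreal_mult ennreal_plus)
      finally show "ennreal (\<bar>d x\<bar> powr s) \<le> ennreal \<eta> * ennreal ((d x)\<^sup>2) + ennreal K * ennreal ((d x - cellmean h d x)\<^sup>2) + ennreal \<eta> * ennreal (d x ^ 6)" .
    qed
    also have "\<dots> = ennreal \<eta> * (\<integral>\<^sup>+x. ennreal ((d x)\<^sup>2) \<partial>lborel) + ennreal K * (\<integral>\<^sup>+x. ennreal ((d x - cellmean h d x)\<^sup>2) \<partial>lborel)
        + ennreal \<eta> * (\<integral>\<^sup>+x. ennreal (d x ^ 6) \<partial>lborel)"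
      by (simp add: nn_integral_add nn_integral_cmult)
    also have "\<dots> \<le> ennreal \<eta> * ennreal (4 * c) + ennreal K * ennreal (24 * h\<^sup>2 * (4 * B\<^sup>2)) + ennreal \<eta> * ennreal S6"
      by (intro add_mono mult_left_mono d2 d6 dev) simp_all
    also have "\<dots> = ennreal (\<eta> * (4 * c) + K * (24 * h\<^sup>2 * (4 * B\<^sup>2)) + \<eta> * S6)"
      using \<eta>(1) K c S6 by (simp add: ennreal_mult ennreal_plus)
    also have "\<dots> \<le> ennreal \<epsilon>"
      using \<eta>(2) k unfolding h_def[symmetric] by (intro ennreal_leI) (simp add: algebra_simps)
    finally show ?thesis unfolding d_def .
  qed
  then show ?thesis by blast
qed

text \<open>The Riesz-Fischer argument with integrals of powers in place of norms: a rapidly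
  converging subsequence converges almost everywhere, and Fatou's lemma turns the Cauchy estimate
  into convergence to its limit.\<close>

lemma Ls_complete:
  fixes w :: "nat \<Rightarrow> 'a \<Rightarrow> real" and s :: real
  assumes s: "s > 0" and [measurable]: "\<And>n. w n \<in> borel_measurable M"
    and Cau: "\<And>\<epsilon>. \<epsilon> > 0 \<Longrightarrow> \<exists>N. \<forall>m\<ge>N. \<forall>n\<ge>N. (\<integral>\<^sup>+x. ennreal (\<bar>w m x - w n x\<bar> powr s) \<partial>M) \<le> ennreal \<epsilon>"
  obtains v where "v \<in> borel_measurable M"
    "\<And>\<epsilon>. \<epsilon> > 0 \<Longrightarrow> \<exists>N. \<forall>n\<ge>N. (\<integral>\<^sup>+x. ennreal (\<bar>w n x - v x\<bar> powr s) \<partial>M) \<le> ennreal \<epsilon>"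
proof -
  \<comment> \<open>The denominator offsets the weight in \<open>f\<close> below, leaving a
    geometric series of integrals. Then the series of the \<open>f k x\<close> is finite almost
    everywhere, which makes the increments \<open>d k x\<close> eventually smaller than
    \<open>(1 / 2) ^ k\<close>.\<close>
  define e where "e k = (1 / 2) ^ k / (2 ^ k) powr s" for k :: nat
  have "e k > 0" for k
    by (simp add: e_def)
  then have "\<exists>N. \<forall>m\<ge>N. \<forall>n\<ge>N. (\<integral>\<^sup>+x. ennreal (\<bar>w m x - w n x\<bar> powr s) \<partial>M) \<le> ennreal (e k)" for k
    by (rule Cau)
  then obtain N where N: "\<And>k m n. m \<ge> N k \<Longrightarrow> n \<ge> N k \<Longrightarrow> (\<integral>\<^sup>+x. ennreal (\<bar>w m x - w n x\<bar> powr s) \<partial>M) \<le> ennreal (e k)"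
    by metis
  \<comment> \<open>The sum makes \<open>r\<close> increase and puts both \<open>r k\<close> and
    \<open>r (Suc k)\<close> beyond \<open>N k\<close>; the summand \<open>k\<close> drives it to
    infinity.\<close>
  define r where "r k = (\<Sum>j\<le>k. N j) + k" for k
  have rN: "r k \<ge> N k" for k
    by (simp add: r_def member_le_sum trans_le_add1)
  have rS: "r k \<le> r (Suc k)" for k
    by (simp add: r_def)
  have r: "r k \<ge> N k" "r (Suc k) \<ge> N k" "r k \<ge> k" for k
    using rN[of k] order_trans[OF rN rS, of k] by (simp_all, simp add: r_def)
  define d where "d k x = w (r (Suc k)) x - w (r k) x" for k x
  have [measurable]: "d k \<in> borel_measurable M" for k
    unfolding d_def by measurable
  define f where "f k x = ennreal ((2 ^ k) powr s * \<bar>d k x\<bar> powr s)" for k x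
  have [measurable]: "f k \<in> borel_measurable M" for k
    unfolding f_def by measurable
  have "(\<integral>\<^sup>+x. f k x \<partial>M) \<le> ennreal ((1 / 2) ^ k)" for k
  proof -
    have "(\<integral>\<^sup>+x. f k x \<partial>M) = ennreal ((2 ^ k) powr s) * (\<integral>\<^sup>+x. ennreal (\<bar>d k x\<bar> powr s) \<partial>M)"
      by (simp add: f_def ennreal_mult nn_integral_cmult)
    also have "\<dots> \<le> ennreal ((2 ^ k) powr s) * ennreal (e k)"
      unfolding d_def by (intro mult_left_mono N r) simp
    also have "\<dots> = ennreal ((1 / 2) ^ k)"
      by (simp add: e_def flip: ennreal_mult)
    finally show ?thesis .
  qed
  then have "(\<Sum>k. \<integral>\<^sup>+x. f k x \<partial>M) \<le> (\<Sum>k. ennreal ((1 / 2) ^ k))"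
    by (intro suminf_le summableI)
  also have "\<dots> < \<infinity>"
    by (simp add: suminf_ennreal2 summable_geometric ennreal_less_top)
  finally have "(\<integral>\<^sup>+x. (\<Sum>k. f k x) \<partial>M) < \<infinity>"
    by (subst nn_integral_suminf) measurable
  then have "AE x in M. (\<Sum>k. f k x) \<noteq> \<infinity>"
    by (intro nn_integral_noteq_infinite) (auto simp: less_top)
  then have conv: "AE x in M. convergent (\<lambda>k. w (r k) x)"
  proof eventually_elim
    case (elim x)
    have "summable (\<lambda>k. (2 ^ k) powr s * \<bar>d k x\<bar> powr s)"
      using elim by (intro summable_suminf_not_top) (auto simp: f_def)
    then have "(\<lambda>k. (2 ^ k) powr s * \<bar>d k x\<bar> powr s) \<longlonglongrightarrow> 0"
      by (rule summable_LIMSEQ_zero)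
    then have "\<forall>\<^sub>F k in sequentially. (2 ^ k) powr s * \<bar>d k x\<bar> powr s < 1"
      by (rule order_tendstoD) simp
    then have "\<forall>\<^sub>F k in sequentially. norm (d k x) \<le> (1 / 2) ^ k"
    proof eventually_elim
      case (elim k)
      have "(2 ^ k * \<bar>d k x\<bar>) powr s < 1"
        using elim by (simp add: powr_mult)
      then have "2 ^ k * \<bar>d k x\<bar> < 1"
        using s powr_mono2[of s 1 "2 ^ k * \<bar>d k x\<bar>"] by (force simp: not_less[symmetric])
      then show ?case
        by (simp add: field_simps power_one_over)
    qed
    then have "summable (\<lambda>k. d k x)"
      by (rule summable_comparison_test_ev) (simp add: summable_geometric)
    then have "convergent (\<lambda>n. (\<Sum>k<n. d k x) + w (r 0) x)"
      by (intro convergent_add convergent_const) (simp add: summable_iff_convergent)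
    then show ?case
      by (simp add: d_def sum_lessThan_telescope[of "\<lambda>k. w (r k) x"])
  qed
  define v where "v x = (if Cauchy (\<lambda>k. w (r k) x) then lim (\<lambda>k. w (r k) x) else 0)" for x
  have v: "v \<in> borel_measurable M"
    unfolding v_def by measurable
  have lim: "AE x in M. (\<lambda>k. w (r k) x) \<longlonglongrightarrow> v x"
    using conv by eventually_elim (simp add: v_def convergent_Cauchy convergent_LIMSEQ_iff)
  show thesis
  proof (rule that[OF v])
    fix \<epsilon> :: real assume "\<epsilon> > 0"
    then obtain N where N: "\<forall>m\<ge>N. \<forall>n\<ge>N. (\<integral>\<^sup>+x. ennreal (\<bar>w m x - w n x\<bar> powr s) \<partial>M) \<le> ennreal \<epsilon>"
      using Cau by blast
    have "(\<integral>\<^sup>+x. ennreal (\<bar>w n x - v x\<bar> powr s) \<partial>M) \<le> ennreal \<epsilon>" if "n \<ge> N" for n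
    proof (rule nn_integral_le_of_AE_tendsto)
      show "(\<lambda>x. ennreal (\<bar>w n x - w (r k) x\<bar> powr s)) \<in> borel_measurable M" for k
        by measurable
      show "AE x in M. (\<lambda>k. ennreal (\<bar>w n x - w (r k) x\<bar> powr s)) \<longlonglongrightarrow> ennreal (\<bar>w n x - v x\<bar> powr s)"
        using lim
      proof eventually_elim
        case (elim x)
        then show ?case
          using s by (intro tendsto_ennrealI tendsto_powr' tendsto_intros) auto
      qed
      show "\<forall>\<^sub>F k in sequentially. (\<integral>\<^sup>+x. ennreal (\<bar>w n x - w (r k) x\<bar> powr s) \<partial>M) \<le> ennreal \<epsilon>"
        using N that r(3) by (intro eventually_sequentiallyI[of N]) (blast intro: order_trans)
    qed simp
    then show "\<exists>N. \<forall>n\<ge>N. (\<integral>\<^sup>+x. ennreal (\<bar>w n x - v x\<bar> powr s) \<partial>M) \<le> ennreal \<epsilon>"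
      by blast
  qed
qed

section \<open>The sum of two Lebesgue spaces\<close>

lemma Lp_norm_nonneg: "0 \<le> Lp_norm p \<Omega> f"
  by (simp add: Lp_norm_def)

lemma Lp_and_norm_le:
  assumes p: "p > 0" and A: "A > 0" and meas: "f \<in> borel_measurable (lebesgue_on \<Omega>)"
    and le: "(\<integral>\<^sup>+x. ennreal (\<bar>f x\<bar> powr p) \<partial>lebesgue_on \<Omega>) \<le> ennreal (A powr p)"
  shows "f \<in> Lp p \<Omega>" "Lp_norm p \<Omega> f \<le> A"
proof -
  note [measurable] = meas
  have i: "integrable (lebesgue_on \<Omega>) (\<lambda>x. \<bar>f x\<bar> powr p)"
    using le by (intro integrableI_nonneg) (auto intro: le_less_trans)
  then show "f \<in> Lp p \<Omega>"
    using meas by (simp add: Lp_def)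
  have "ennreal (LINT x|lebesgue_on \<Omega>. \<bar>f x\<bar> powr p) \<le> ennreal (A powr p)"
    using le i by (subst nn_integral_eq_integral[symmetric]) auto
  then have "(LINT x|lebesgue_on \<Omega>. \<bar>f x\<bar> powr p) \<le> A powr p"
    by (simp add: ennreal_le_iff)
  then have "Lp_norm p \<Omega> f \<le> (A powr p) powr (1 / p)"
    unfolding Lp_norm_def using p by (intro powr_mono2) auto
  also have "\<dots> = A"
    using p A by (simp add: powr_powr)
  finally show "Lp_norm p \<Omega> f \<le> A" .
qed

text \<open>Above the height \<open>A\<close> the power \<open>p - s\<close>, which is not positive,
  is largest at \<open>A\<close>; below it the same holds for the power \<open>q - s\<close>, which
  is not negative. So each piece inherits from \<open>le\<close> a norm of at most \<open>A\<close>
  in its own exponent.\<close>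

lemma Lsum_and_norm_le:
  fixes p q s A :: real
  assumes p: "0 < p" "p \<le> s" "s \<le> q" and A: "A > 0"
    and meas: "f \<in> borel_measurable (lebesgue_on \<Omega>)"
    and le: "(\<integral>\<^sup>+x. ennreal (\<bar>f x\<bar> powr s) \<partial>lebesgue_on \<Omega>) \<le> ennreal (A powr s)"
  shows "f \<in> Lsum p q \<Omega>" "Lsum_norm p q \<Omega> f \<le> 2 * A"
proof -
  note [measurable] = meas
  define f1 where "f1 x = (if \<bar>f x\<bar> > A then f x else 0)" for x
  define f2 where "f2 x = (if \<bar>f x\<bar> > A then 0 else f x)" for x
  have [measurable]: "f1 \<in> borel_measurable (lebesgue_on \<Omega>)" "f2 \<in> borel_measurable (lebesgue_on \<Omega>)"
    unfolding f1_def f2_def by measurable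
  have scale: "(\<integral>\<^sup>+x. ennreal (\<bar>g x\<bar> powr r) \<partial>lebesgue_on \<Omega>) \<le> ennreal (A powr r)"
    if "\<And>x. \<bar>g x\<bar> powr r \<le> A powr (r - s) * \<bar>f x\<bar> powr s" for g r
  proof -
    have "(\<integral>\<^sup>+x. ennreal (\<bar>g x\<bar> powr r) \<partial>lebesgue_on \<Omega>) \<le>
        (\<integral>\<^sup>+x. ennreal (A powr (r - s)) * ennreal (\<bar>f x\<bar> powr s) \<partial>lebesgue_on \<Omega>)"
      using that by (intro nn_integral_mono) (simp flip: ennreal_mult)
    also have "\<dots> \<le> ennreal (A powr (r - s)) * ennreal (A powr s)"
      using le by (subst nn_integral_cmult) (auto intro: mult_left_mono)
    also have "\<dots> = ennreal (A powr r)"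
      by (simp flip: ennreal_mult powr_add)
    finally show ?thesis .
  qed
  have split: "a powr r = a powr (r - s) * a powr s" for a r :: real
    by (simp flip: powr_add)
  have "(\<integral>\<^sup>+x. ennreal (\<bar>f1 x\<bar> powr p) \<partial>lebesgue_on \<Omega>) \<le> ennreal (A powr p)"
  proof (rule scale)
    show "\<bar>f1 x\<bar> powr p \<le> A powr (p - s) * \<bar>f x\<bar> powr s" for x
      unfolding f1_def split[of _ p] using p A by (auto intro!: mult_right_mono powr_mono2')
  qed
  note 1 = Lp_and_norm_le[OF p(1) A _ this]
  have "(\<integral>\<^sup>+x. ennreal (\<bar>f2 x\<bar> powr q) \<partial>lebesgue_on \<Omega>) \<le> ennreal (A powr q)"
  proof (rule scale)
    show "\<bar>f2 x\<bar> powr q \<le> A powr (q - s) * \<bar>f x\<bar> powr s" for x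
      unfolding f2_def split[of _ q] using p A by (auto intro!: mult_right_mono powr_mono2)
  qed
  note 2 = Lp_and_norm_le[OF _ A _ this]
  have feq: "f x = f1 x + f2 x" for x
    by (simp add: f1_def f2_def)
  have d: "(f1, f2) \<in> Lsum_decomp p q \<Omega> f"
    using 1 2 p feq by (auto simp: Lsum_decomp_def)
  then show "f \<in> Lsum p q \<Omega>"
    by (auto simp: Lsum_def)
  have "Lsum_norm p q \<Omega> f \<le> Lp_norm p \<Omega> f1 + Lp_norm q \<Omega> f2"
    unfolding Lsum_norm_def
    by (rule cINF_lower2[OF _ d]) (auto intro!: bdd_belowI[of _ 0] add_nonneg_nonneg Lp_norm_nonneg)
  also have "\<dots> \<le> A + A"
    using 1 2 p by (intro add_mono) auto
  finally show "Lsum_norm p q \<Omega> f \<le> 2 * A" by simp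
qed

lemma Lsum_norm_nonneg:
  assumes "f \<in> Lsum p q \<Omega>" shows "0 \<le> Lsum_norm p q \<Omega> f"
  unfolding Lsum_norm_def using assms
  by (intro cINF_greatest) (auto simp: Lsum_def intro!: add_nonneg_nonneg Lp_norm_nonneg)

lemma nn_integral_less_of_Lp_norm_less:
  assumes p: "p > 0" and f: "f \<in> Lp p \<Omega>" and less: "Lp_norm p \<Omega> f < \<eta>"
  shows "(\<integral>\<^sup>+x. ennreal (\<bar>f x\<bar> powr p) \<partial>lebesgue_on \<Omega>) \<le> ennreal (\<eta> powr p)"
proof -
  let ?I = "LINT x|lebesgue_on \<Omega>. \<bar>f x\<bar> powr p"
  have "?I = (?I powr (1 / p)) powr p"
    using p by (simp add: powr_powr)
  also have "\<dots> \<le> \<eta> powr p"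
    using p less by (intro powr_mono2) (auto simp: Lp_norm_def)
  finally have "ennreal ?I \<le> ennreal (\<eta> powr p)"
    by (rule ennreal_leI)
  then show ?thesis
    using f by (subst nn_integral_eq_integral) (auto simp: Lp_def)
qed

text \<open>Norm zero provides decompositions with two arbitrarily small pieces, but measured in
  different exponents. The auxiliary \<open>g\<close> is controlled by either piece, so its integral
  is smaller than any bound.\<close>

lemma Lsum_norm_eq_0_AE:
  fixes p q :: real
  assumes p: "0 < p" "p \<le> q" and f: "f \<in> Lsum p q \<Omega>" "Lsum_norm p q \<Omega> f = 0"
    and [measurable]: "f \<in> borel_measurable (lebesgue_on \<Omega>)"
  shows "AE x in lebesgue_on \<Omega>. f x = 0"
proof -
  \<comment> \<open>Halved because one of two summands has at least half the size of the sum; capped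
    at 1 because on the unit interval the power \<open>q\<close> is at most the power
    \<open>p\<close>.\<close>
  define g where "g x = min 1 (\<bar>f x\<bar> / 2) powr q" for x
  have [measurable]: "g \<in> borel_measurable (lebesgue_on \<Omega>)"
    unfolding g_def by measurable
  have le: "(\<integral>\<^sup>+x. ennreal (g x) \<partial>lebesgue_on \<Omega>) \<le> ennreal (\<eta> powr p + \<eta> powr q)" if \<eta>: "\<eta> > 0" for \<eta> :: real
  proof -
    have "Lsum_norm p q \<Omega> f < \<eta>"
      using f \<eta> by simp
    then obtain d where d: "d \<in> Lsum_decomp p q \<Omega> f" "(case d of (v1, v2) \<Rightarrow> Lp_norm p \<Omega> v1 + Lp_norm q \<Omega> v2) < \<eta>"
      unfolding Lsum_norm_def
      by (subst (asm) cINF_less_iff) (use f in \<open>auto simp: Lsum_def intro!: bdd_belowI[of _ 0] add_nonneg_nonneg Lp_norm_nonneg\<close>)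
    obtain v1 v2 where v: "d = (v1, v2)" by (cases d)
    have v1: "v1 \<in> Lp p \<Omega>" and v2: "v2 \<in> Lp q \<Omega>" and eq: "AE x in lebesgue_on \<Omega>. f x = v1 x + v2 x"
      using d(1) by (auto simp: v Lsum_decomp_def)
    have [measurable]: "v1 \<in> borel_measurable (lebesgue_on \<Omega>)" "v2 \<in> borel_measurable (lebesgue_on \<Omega>)"
      using v1 v2 by (auto simp: Lp_def)
    have less: "Lp_norm p \<Omega> v1 < \<eta>" "Lp_norm q \<Omega> v2 < \<eta>"
      using d(2) Lp_norm_nonneg[of p \<Omega> v1] Lp_norm_nonneg[of q \<Omega> v2] by (auto simp: v)
    have pt: "min 1 (\<bar>a + b\<bar> / 2) powr q \<le> \<bar>a\<bar> powr p + \<bar>b\<bar> powr q" for a b :: real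
    proof -
      let ?t = "min 1 (\<bar>a + b\<bar> / 2)"
      have t: "0 \<le> ?t" "?t \<le> 1" by simp_all
      have "\<bar>a + b\<bar> / 2 \<le> \<bar>a\<bar> \<or> \<bar>a + b\<bar> / 2 \<le> \<bar>b\<bar>"
        using abs_triangle_ineq[of a b] by (auto simp: not_le)
      then consider "?t \<le> \<bar>a\<bar>" | "?t \<le> \<bar>b\<bar>"
        by (blast intro: min.coboundedI2)
      then show ?thesis
      proof cases
        case 1
        have "?t powr q \<le> ?t powr p"
          using p t by (cases "?t = 0") (auto intro!: powr_mono')
        also have "\<dots> \<le> \<bar>a\<bar> powr p"
          using p t 1 by (intro powr_mono2) auto
        finally show ?thesis by (simp add: add_increasing2)
      next
        case 2
        have "?t powr q \<le> \<bar>b\<bar> powr q"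
          using p t 2 by (intro powr_mono2) auto
        then show ?thesis by (simp add: add_increasing)
      qed
    qed
    have "(\<integral>\<^sup>+x. ennreal (g x) \<partial>lebesgue_on \<Omega>) \<le> (\<integral>\<^sup>+x. ennreal (\<bar>v1 x\<bar> powr p) + ennreal (\<bar>v2 x\<bar> powr q) \<partial>lebesgue_on \<Omega>)"
      using eq
    proof (intro nn_integral_mono_AE, eventually_elim)
      case (elim x)
      show ?case
        unfolding g_def elim using pt[of "v1 x" "v2 x"] by (simp flip: ennreal_plus)
    qed
    also have "\<dots> = (\<integral>\<^sup>+x. ennreal (\<bar>v1 x\<bar> powr p) \<partial>lebesgue_on \<Omega>) + (\<integral>\<^sup>+x. ennreal (\<bar>v2 x\<bar> powr q) \<partial>lebesgue_on \<Omega>)"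
      by (rule nn_integral_add) measurable
    also have "\<dots> \<le> ennreal (\<eta> powr p) + ennreal (\<eta> powr q)"
      using p v1 v2 less by (intro add_mono nn_integral_less_of_Lp_norm_less) auto
    finally show ?thesis by simp
  qed
  have "(\<integral>\<^sup>+x. ennreal (g x) \<partial>lebesgue_on \<Omega>) \<le> 0"
  proof (rule tendsto_lowerbound)
    have "((\<lambda>\<eta>. \<eta> powr p + \<eta> powr q) \<longlongrightarrow> 0 powr p + 0 powr q) (at_right (0::real))"
      using p by (intro tendsto_intros tendsto_powr') (auto intro: eventually_mono[OF eventually_at_right_less])
    then have "((\<lambda>\<eta>. ennreal (\<eta> powr p + \<eta> powr q)) \<longlongrightarrow> ennreal (0 powr p + 0 powr q)) (at_right (0::real))"
      by (rule tendsto_ennrealI)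
    then show "((\<lambda>\<eta>. ennreal (\<eta> powr p + \<eta> powr q)) \<longlongrightarrow> 0) (at_right (0::real))"
      using p by simp
    show "\<forall>\<^sub>F \<eta> in at_right 0. (\<integral>\<^sup>+x. ennreal (g x) \<partial>lebesgue_on \<Omega>) \<le> ennreal (\<eta> powr p + \<eta> powr q)"
      using eventually_at_right_less[of 0] by eventually_elim (rule le)
  qed simp
  then have "AE x in lebesgue_on \<Omega>. ennreal (g x) = 0"
    by (subst nn_integral_0_iff_AE[symmetric]) auto
  then show ?thesis
    by eventually_elim (use p in \<open>auto simp: g_def min_def split: if_splits\<close>)
qed

section \<open>The compact embedding\<close>

text \<open>The zero sequence represents \<open>u\<close>, and the norm may be read off from any
  representing sequence.\<close>

lemma D12_norm_eq_0:
  assumes \<Omega>: "\<Omega> \<in> sets lebesgue" and u: "AE x in lebesgue_on \<Omega>. u x = 0"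
  shows "D12_norm \<Omega> u = 0"
proof -
  have Ck: "Ck k (\<lambda>x :: space3. 0)" for k
    by (induction k) (auto simp: frechet_derivative_const)
  have 0: "dirichlet_norm \<Omega> (\<lambda>x. 0) = 0"
    by (simp add: dirichlet_norm_def gradient_def frechet_derivative_const)
  have "D12_represents \<Omega> (\<lambda>_ _. 0) u"
    unfolding D12_represents_def
  proof (intro conjI)
    show "\<forall>n. (\<lambda>_. 0) \<in> test_functions \<Omega>"
      by (simp add: test_functions_def Ck)
    show "\<forall>e>0. \<exists>N. \<forall>m\<ge>N. \<forall>n\<ge>N. dirichlet_norm \<Omega> (\<lambda>x. 0 - 0) < e"
      by (simp add: 0)
    show "AE x in lebesgue_on \<Omega>. (\<lambda>n. 0) \<longlonglongrightarrow> u x"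
      using u by eventually_elim simp
  qed
  from D12_norm_tendsto[OF this \<Omega>] show ?thesis
    by (simp add: 0 LIMSEQ_const_iff)
qed

lemma nn_integral_lebesgue_on_le_AE:
  fixes u v :: "'a::euclidean_space \<Rightarrow> ennreal"
  assumes \<Omega>: "\<Omega> \<in> sets lebesgue" and eq: "AE x in lborel. x \<in> \<Omega> \<longrightarrow> u x = v x"
  shows "(\<integral>\<^sup>+x. u x \<partial>lebesgue_on \<Omega>) \<le> (\<integral>\<^sup>+x. v x \<partial>lborel)"
proof -
  have "(\<integral>\<^sup>+x. u x \<partial>lebesgue_on \<Omega>) = (\<integral>\<^sup>+x. u x * indicator \<Omega> x \<partial>lebesgue)"
    using \<Omega> by (subst nn_integral_restrict_space) simp_all
  also have "\<dots> = (\<integral>\<^sup>+x. u x * indicator \<Omega> x \<partial>lborel)"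
    by (rule nn_integral_completion)
  also have "\<dots> \<le> (\<integral>\<^sup>+x. v x \<partial>lborel)"
    using eq by (intro nn_integral_mono_AE) (auto split: split_indicator)
  finally show ?thesis .
qed

text \<open>Fubini for null sets with the height as outer variable; a Borel null set covering the
  exceptional set supplies measurability.\<close>

lemma AE_slice:
  assumes "AE x in (lborel :: space3 measure). P x"
  shows "AE z in lborel. AE y in lborel. P (y, z)"
proof -
  obtain E where E: "{x \<in> space lborel. \<not> P x} \<subseteq> E" "emeasure lborel E = 0" "E \<in> sets lborel"
    by (rule AE_E[OF assms])
  have [measurable]: "E \<in> sets (borel \<Otimes>\<^sub>M borel)"
    using E(3) unfolding borel_prod by simp
  have "(\<integral>\<^sup>+z. \<integral>\<^sup>+y. indicator E (y, z) \<partial>lborel \<partial>lborel) = (\<integral>\<^sup>+x. indicator E x \<partial>(lborel \<Otimes>\<^sub>M lborel))"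
    by (rule lborel_pair.nn_integral_snd) measurable
  also have "\<dots> = 0"
    using E(2,3) by (simp add: lborel_prod)
  finally have "AE z in lborel. (\<integral>\<^sup>+y. indicator E (y, z) \<partial>lborel) = (0 :: ennreal)"
    by (subst nn_integral_0_iff_AE[symmetric]) measurable
  then show ?thesis
  proof eventually_elim
    case (elim z)
    then have "AE y in lborel. indicator E (y, z) = (0 :: ennreal)"
      by (subst nn_integral_0_iff_AE[symmetric]) measurable
    then show ?case
      by eventually_elim (use E(1) in \<open>auto simp: indicator_def split: if_splits\<close>)
  qed
qed

text \<open>On almost every slice a change on a null set of space is a change on a null set of the
  plane, which radiality tolerates. Slices outside \<open>I\<close> are zero, hence radial.\<close>

lemma radial_representative:
  assumes u: "u \<in> D12_cyl I" and I: "I \<in> sets lebesgue"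
    and w0: "\<And>x. x \<notin> UNIV \<times> I \<Longrightarrow> w x = 0" and uw: "AE x in lborel. x \<in> UNIV \<times> I \<longrightarrow> u x = w x"
  shows "AE z in lborel. radial_ae (\<lambda>y. w (y, z))"
proof -
  have "AE z in lborel. z \<in> I \<longrightarrow> radial_ae (\<lambda>y. u (y, z))"
    using u I by (simp add: D12_cyl_def AE_lebesgue_on_iff)
  then show ?thesis
    using AE_slice[OF uw]
  proof eventually_elim
    case (elim z)
    show ?case
    proof (cases "z \<in> I")
      case True
      then obtain g where "AE y in lborel. u (y, z) = g (norm y)"
        using elim(1) by (auto simp: radial_ae_def AE_completion_iff)
      then have "AE y in lborel. w (y, z) = g (norm y)"
        using elim(2) by eventually_elim (use True in simp)
      then show ?thesis
        by (auto simp: radial_ae_def AE_completion_iff)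
    next
      case False
      then show ?thesis
        using w0 by (auto simp: radial_ae_def intro!: exI[of _ "\<lambda>_. 0"])
    qed
  qed
qed

lemma abs_powr_add_le:
  fixes a b s :: real
  assumes "s \<ge> 0"
  shows "\<bar>a + b\<bar> powr s \<le> 2 powr s * (\<bar>a\<bar> powr s + \<bar>b\<bar> powr s)"
proof -
  have "\<bar>a + b\<bar> \<le> 2 * max \<bar>a\<bar> \<bar>b\<bar>" by linarith
  then have "\<bar>a + b\<bar> powr s \<le> (2 * max \<bar>a\<bar> \<bar>b\<bar>) powr s"
    using assms by (intro powr_mono2) auto
  also have "\<dots> \<le> 2 powr s * (\<bar>a\<bar> powr s + \<bar>b\<bar> powr s)"
    by (simp add: powr_mult max_def)
  finally show ?thesis .
qed

lemma powr_le_power2_add_power6: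
  fixes a s :: real
  assumes "2 \<le> s" "s \<le> 6"
  shows "\<bar>a\<bar> powr s \<le> a\<^sup>2 + a ^ 6"
proof (cases "a = 0")
  case False
  have 2: "\<bar>a\<bar> powr 2 = a\<^sup>2" and 6: "\<bar>a\<bar> powr 6 = a ^ 6"
    using False by (simp_all add: power_even_abs)
  show ?thesis
  proof (cases "\<bar>a\<bar> \<le> 1")
    case True
    then have "\<bar>a\<bar> powr s \<le> \<bar>a\<bar> powr 2"
      using assms False by (intro powr_mono') auto
    then show ?thesis by (simp add: 2 add_increasing2)
  next
    case False
    then have "\<bar>a\<bar> powr s \<le> \<bar>a\<bar> powr 6"
      using assms by (intro powr_mono) auto
    then show ?thesis by (simp add: 6 add_increasing)
  qed
qed simp

theorem theorem3p3:
  fixes I :: "real set" and p q :: real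
  assumes "open I" and "is_interval I" and "bounded I" and "I \<noteq> {}"
    and "1 < p" and "p < 6" and "6 < q"
  shows "compactly_embedded (D12_cyl I) (D12_norm (UNIV \<times> I))
           (Lsum p q (UNIV \<times> I)) (Lsum_norm p q (UNIV \<times> I))"
proof -
  define \<Omega> where "\<Omega> = (UNIV :: (real^2) set) \<times> I"
  have \<Omega>: "open \<Omega>" "\<Omega> \<in> sets lebesgue" and I: "I \<in> sets lebesgue"
    using \<open>open I\<close> by (auto simp: \<Omega>_def open_Times)
  obtain b where b: "\<And>z. z \<in> I \<Longrightarrow> \<bar>z\<bar> \<le> b"
    using \<open>bounded I\<close> by (auto simp: bounded_iff)
  \<comment> \<open>The interval from \<open>- \<bar>b\<bar>\<close> to \<open>\<bar>b\<bar>\<close>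
    contains \<open>I\<close>; the extra length 1 keeps its right endpoint inside the half-open
    interval.\<close>
  define a where "a = - \<bar>b\<bar>"
  define L where "L = 2 * \<bar>b\<bar> + 1"
  have aL: "z \<in> {a..<a + L}" if "z \<in> I" for z
    using b[OF that] by (auto simp: a_def L_def)
  have L: "L \<ge> 0" by (simp add: L_def)
  have meas: "u \<in> borel_measurable (lebesgue_on \<Omega>)" if "u \<in> D12_cyl I" for u
    using that by (simp add: D12_cyl_def D12_def \<Omega>_def)
  have nn: "0 \<le> D12_norm \<Omega> u" if "u \<in> D12_cyl I" for u
    using that \<Omega> by (intro D12_norm_nonneg) (auto simp: D12_cyl_def \<Omega>_def)
  have rep: "\<exists>w. (\<forall>x. x \<notin> \<Omega> \<longrightarrow> w x = 0) \<and> (AE x in lborel. x \<in> \<Omega> \<longrightarrow> u x = w x) \<and> Sobolev_bound (D12_norm \<Omega> u) w"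
    if "u \<in> D12_cyl I" for u
  proof -
    have "u \<in> D12 \<Omega>"
      using that by (simp add: D12_cyl_def \<Omega>_def)
    then show ?thesis
      by (rule D12_representative[OF _ \<Omega>(1)]) blast
  qed
  \<comment> \<open>4096 is \<open>4 ^ 6\<close>, so four times the norm bounds the norm in exponent
    6. The cutting height must be positive, so \<open>A\<close> is kept free above this value, which
    covers elements of norm zero.\<close>
  have bound: "u \<in> Lsum p q \<Omega> \<and> Lsum_norm p q \<Omega> u \<le> 2 * A"
    if u: "u \<in> D12_cyl I" and A: "A > 0" "4 * D12_norm \<Omega> u \<le> A" for u A
  proof -
    let ?D = "D12_norm \<Omega> u"
    obtain w where uw: "AE x in lborel. x \<in> \<Omega> \<longrightarrow> u x = w x" and w: "Sobolev_bound ?D w"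
      using rep[OF u] by blast
    have "(\<integral>\<^sup>+x. ennreal (\<bar>u x\<bar> powr 6) \<partial>lebesgue_on \<Omega>) \<le> (\<integral>\<^sup>+x. ennreal (w x ^ 6) \<partial>lborel)"
    proof (rule nn_integral_lebesgue_on_le_AE[OF \<Omega>(2)])
      show "AE x in lborel. x \<in> \<Omega> \<longrightarrow> ennreal (\<bar>u x\<bar> powr 6) = ennreal (w x ^ 6)"
        using uw by eventually_elim (auto simp: power_even_abs)
    qed
    also have "\<dots> \<le> ennreal ((4 * ?D) ^ 6)"
      using w by (simp add: Sobolev_bound_def power_mult_distrib)
    also have "\<dots> \<le> ennreal (A powr 6)"
    proof (rule ennreal_leI)
      have "(4 * ?D) ^ 6 \<le> A ^ 6"
        by (rule power_mono[OF A(2)]) (simp add: nn[OF u])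
      then show "(4 * ?D) ^ 6 \<le> A powr 6"
        using A(1) by (simp only: powr_numeral)
    qed
    finally have le: "(\<integral>\<^sup>+x. ennreal (\<bar>u x\<bar> powr 6) \<partial>lebesgue_on \<Omega>) \<le> ennreal (A powr 6)" .
    have "0 < p" "p \<le> 6" "6 \<le> q"
      using assms by simp_all
    from Lsum_and_norm_le[OF this A(1) meas[OF u] le] show ?thesis ..
  qed
  have c1: "D12_cyl I \<subseteq> Lsum p q \<Omega>"
  proof
    fix u assume u: "u \<in> D12_cyl I"
    then show "u \<in> Lsum p q \<Omega>"
      using bound[OF u, of "4 * D12_norm \<Omega> u + 1"] nn[OF u] by simp
  qed
  \<comment> \<open>The height is taken slightly above \<open>4 * D12_norm \<Omega> u\<close>;
    cutting doubles it, and the excess \<open>e\<close> is arbitrary.\<close>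
  have c2: "Lsum_norm p q \<Omega> u \<le> 8 * D12_norm \<Omega> u" if u: "u \<in> D12_cyl I" for u
  proof (rule field_le_epsilon)
    fix e :: real assume "e > 0"
    then show "Lsum_norm p q \<Omega> u \<le> 8 * D12_norm \<Omega> u + e"
      using bound[OF u, of "4 * D12_norm \<Omega> u + e / 2"] nn[OF u] by simp
  qed
  have c3: "D12_norm \<Omega> u = 0" if u: "u \<in> D12_cyl I" and 0: "Lsum_norm p q \<Omega> u = 0" for u
    using Lsum_norm_eq_0_AE[OF _ _ _ 0 meas[OF u]] c1 u assms by (intro D12_norm_eq_0[OF \<Omega>(2)]) auto
  have c4: "\<exists>r v. strict_mono r \<and> v \<in> Lsum p q \<Omega> \<and> (\<lambda>n. Lsum_norm p q \<Omega> (\<lambda>x. u (r n) x - v x)) \<longlonglongrightarrow> 0"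
    if u: "\<And>n. u n \<in> D12_cyl I" and B: "\<And>n. D12_norm \<Omega> (u n) \<le> B" for u :: "nat \<Rightarrow> space3 \<Rightarrow> real" and B
  proof -
    \<comment> \<open>Any exponent strictly between 2 and 6 that is at least \<open>p\<close> would
      serve; it is below \<open>q\<close> because \<open>q\<close> exceeds 6.\<close>
    define s where "s = max p 4"
    have s: "2 < s" "s < 6" "p \<le> s" "s \<le> q"
      using assms by (auto simp: s_def)
    have "\<forall>n. \<exists>w. (\<forall>x. x \<notin> \<Omega> \<longrightarrow> w x = 0) \<and> (AE x in lborel. x \<in> \<Omega> \<longrightarrow> u n x = w x) \<and> Sobolev_bound (D12_norm \<Omega> (u n)) w"
      using rep[OF u] by blast
    from choice[OF this] obtain w where W: "\<forall>n. (\<forall>x. x \<notin> \<Omega> \<longrightarrow> w n x = 0) \<and>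
        (AE x in lborel. x \<in> \<Omega> \<longrightarrow> u n x = w n x) \<and> Sobolev_bound (D12_norm \<Omega> (u n)) (w n)" ..
    have w0: "\<And>n x. x \<notin> \<Omega> \<Longrightarrow> w n x = 0"
      and uw: "\<And>n. AE x in lborel. x \<in> \<Omega> \<longrightarrow> u n x = w n x"
      and wD: "\<And>n. Sobolev_bound (D12_norm \<Omega> (u n)) (w n)"
      using W by blast+
    \<comment> \<open>Norms are nonnegative, so their powers are monotone and all terms of the
      sequence share the constant \<open>B\<close>.\<close>
    have w: "Sobolev_bound B (w n)" for n
    proof -
      have "(D12_norm \<Omega> (u n)) ^ k \<le> B ^ k" for k
        using B nn[OF u] by (intro power_mono)
      then have le: "ennreal ((norm t)\<^sup>2 * (D12_norm \<Omega> (u n))\<^sup>2) \<le> ennreal ((norm t)\<^sup>2 * B\<^sup>2)"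
        "ennreal (4096 * D12_norm \<Omega> (u n) ^ 6) \<le> ennreal (4096 * B ^ 6)" for t :: space3
        by (simp_all add: ennreal_leI mult_left_mono)
      show ?thesis
        unfolding Sobolev_bound_def
      proof (intro conjI allI)
        show "w n \<in> borel_measurable borel"
          by (rule Sobolev_bound_measurable[OF wD])
        show "(\<integral>\<^sup>+x. ennreal ((w n (x + t) - w n x)\<^sup>2) \<partial>lborel) \<le> ennreal ((norm t)\<^sup>2 * B\<^sup>2)" for t
          by (rule order_trans[OF Sobolev_bound_translation[OF wD] le(1)])
        have "(\<integral>\<^sup>+x. ennreal (w n x ^ 6) \<partial>lborel) \<le> ennreal (4096 * D12_norm \<Omega> (u n) ^ 6)"
          using wD[of n] by (simp add: Sobolev_bound_def)
        then show "(\<integral>\<^sup>+x. ennreal (w n x ^ 6) \<partial>lborel) \<le> ennreal (4096 * B ^ 6)"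
          by (rule order_trans[OF _ le(2)])
      qed
    qed
    note [measurable] = Sobolev_bound_measurable[OF w]
    have supp: "w n (y, z) = 0" if "z \<notin> {a..<a + L}" for n y z
      using w0[of "(y, z)" n] aL[of z] that by (auto simp: \<Omega>_def)
    define c where "c = L\<^sup>2 * B\<^sup>2"
    have c: "c \<ge> 0" by (simp add: c_def)
    have le: "(\<integral>\<^sup>+x. ennreal ((w n x)\<^sup>2) \<partial>lborel) \<le> ennreal c" for n
      unfolding c_def by (rule Poincare_of_translation[OF w supp L])
    have rad: "AE z in lborel. radial_ae (\<lambda>y. w n (y, z))" for n
      by (rule radial_representative[OF u I w0[unfolded \<Omega>_def] uw[unfolded \<Omega>_def]])
    obtain r where r: "strict_mono r"
      "\<And>k x. convergent (\<lambda>n. cellmean (inverse (real (Suc k))) (w (r n)) x)"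
      by (rule cellmean_convergent_subsequence[where w = w, OF Sobolev_bound_measurable[OF w] le c]) (rule that)
    have tail: "\<exists>R. \<forall>n x. norm x > R \<longrightarrow> \<bar>cellmean (inverse (real (Suc k))) (w (r n)) x\<bar> \<le> \<delta>" if \<delta>: "\<delta> > 0" for k \<delta>
    proof -
      have h: "inverse (real (Suc k)) > 0" by simp
      have "\<forall>y z. z \<notin> {a..<a + L} \<longrightarrow> w (r n) (y, z) = 0" for n
        using supp by simp
      then show ?thesis
        using radial_cellmean_tail[OF h \<delta> c, of a L] Sobolev_bound_measurable[OF w] rad le by meson
    qed
    have Cau: "\<exists>N. \<forall>m\<ge>N. \<forall>n\<ge>N. (\<integral>\<^sup>+x. ennreal (\<bar>w (r m) x - w (r n) x\<bar> powr s) \<partial>lborel) \<le> ennreal \<epsilon>"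
      if "\<epsilon> > 0" for \<epsilon>
      by (rule Cauchy_Ls[OF s(1,2) w le c r(2) tail that])
    have s0: "s > 0" and w_meas: "w (r n) \<in> borel_measurable lborel" for n
      using s by simp_all
    obtain v where v: "v \<in> borel_measurable lborel"
      and lim: "\<And>\<epsilon>. \<epsilon> > 0 \<Longrightarrow> \<exists>N. \<forall>n\<ge>N. (\<integral>\<^sup>+x. ennreal (\<bar>w (r n) x - v x\<bar> powr s) \<partial>lborel) \<le> ennreal \<epsilon>"
      by (rule Ls_complete[where w = "\<lambda>n. w (r n)", OF s0 w_meas Cau]) (assumption, rule that)
    have [measurable]: "v \<in> borel_measurable borel"
      using v by simp
    have v_meas: "v \<in> borel_measurable (lebesgue_on \<Omega>)"
      using v by (intro measurable_restrict_space1 measurable_completion)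
    \<comment> \<open>\<open>v\<close> is compared with one term of the sequence close to it; that
      term has a finite integral in exponent \<open>s\<close> by its bounds in exponents 2 and
      6.\<close>
    have "v \<in> Lsum p q \<Omega>"
    proof -
      obtain n where n: "(\<integral>\<^sup>+x. ennreal (\<bar>w (r n) x - v x\<bar> powr s) \<partial>lborel) \<le> ennreal 1"
        using lim[OF zero_less_one] by blast
      have "(\<integral>\<^sup>+x. ennreal (\<bar>w (r n) x\<bar> powr s) \<partial>lborel) \<le> (\<integral>\<^sup>+x. ennreal ((w (r n) x)\<^sup>2) + ennreal (w (r n) x ^ 6) \<partial>lborel)"
        using s powr_le_power2_add_power6[of s] by (intro nn_integral_mono) (simp flip: ennreal_plus)
      also have "\<dots> = (\<integral>\<^sup>+x. ennreal ((w (r n) x)\<^sup>2) \<partial>lborel) + (\<integral>\<^sup>+x. ennreal (w (r n) x ^ 6) \<partial>lborel)"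
        by (rule nn_integral_add) measurable
      also have "\<dots> \<le> ennreal c + ennreal (4096 * B ^ 6)"
        using w[of "r n"] by (intro add_mono le) (simp add: Sobolev_bound_def)
      finally have wn: "(\<integral>\<^sup>+x. ennreal (\<bar>w (r n) x\<bar> powr s) \<partial>lborel) \<le> ennreal (c + 4096 * B ^ 6)"
        using c by simp
      define Q where "Q = 2 powr s * (c + 4096 * B ^ 6 + 1)"
      have Q: "Q > 0" using c by (simp add: Q_def add_nonneg_pos)
      have "(\<integral>\<^sup>+x. ennreal (\<bar>v x\<bar> powr s) \<partial>lebesgue_on \<Omega>) \<le> (\<integral>\<^sup>+x. ennreal (\<bar>v x\<bar> powr s) \<partial>lborel)"
        by (rule nn_integral_lebesgue_on_le_AE[OF \<Omega>(2)]) simp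
      also have "\<dots> \<le> (\<integral>\<^sup>+x. ennreal (2 powr s) * (ennreal (\<bar>w (r n) x\<bar> powr s) + ennreal (\<bar>w (r n) x - v x\<bar> powr s)) \<partial>lborel)"
      proof (intro nn_integral_mono)
        fix x
        have "\<bar>v x\<bar> powr s \<le> 2 powr s * (\<bar>w (r n) x\<bar> powr s + \<bar>w (r n) x - v x\<bar> powr s)"
          using abs_powr_add_le[of s "w (r n) x" "v x - w (r n) x"] s by (simp add: abs_minus_commute)
        then show "ennreal (\<bar>v x\<bar> powr s) \<le> ennreal (2 powr s) * (ennreal (\<bar>w (r n) x\<bar> powr s) + ennreal (\<bar>w (r n) x - v x\<bar> powr s))"
          by (simp flip: ennreal_plus ennreal_mult)
      qed
      also have "\<dots> = ennreal (2 powr s) * ((\<integral>\<^sup>+x. ennreal (\<bar>w (r n) x\<bar> powr s) \<partial>lborel) + (\<integral>\<^sup>+x. ennreal (\<bar>w (r n) x - v x\<bar> powr s) \<partial>lborel))"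
        by (simp add: nn_integral_cmult nn_integral_add)
      also have "\<dots> \<le> ennreal (2 powr s) * (ennreal (c + 4096 * B ^ 6) + ennreal 1)"
        by (intro mult_left_mono add_mono wn n) simp
      also have "\<dots> = ennreal ((Q powr (1 / s)) powr s)"
        using Q c s by (simp add: Q_def powr_powr del: ennreal_1 flip: ennreal_plus ennreal_mult)
      finally show ?thesis
        using Lsum_and_norm_le(1)[of p s q "Q powr (1 / s)" v \<Omega>] s assms Q v_meas by simp
    qed
    moreover have "(\<lambda>n. Lsum_norm p q \<Omega> (\<lambda>x. u (r n) x - v x)) \<longlonglongrightarrow> 0"
    proof (rule LIMSEQ_I)
      fix e :: real assume e: "e > 0"
      \<comment> \<open>The cut at height \<open>A\<close> gives norm at most \<open>2 * A\<close>,
        that is \<open>e / 2\<close>, which is strictly below \<open>e\<close>.\<close>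
      define A where "A = e / 4"
      have A: "A > 0" using e by (simp add: A_def)
      have "A powr s > 0" using A by simp
      then obtain N where N: "\<forall>n\<ge>N. (\<integral>\<^sup>+x. ennreal (\<bar>w (r n) x - v x\<bar> powr s) \<partial>lborel) \<le> ennreal (A powr s)"
        using lim by blast
      show "\<exists>N. \<forall>n\<ge>N. norm (Lsum_norm p q \<Omega> (\<lambda>x. u (r n) x - v x) - 0) < e"
      proof (intro exI[of _ N] allI impI)
        fix n assume "N \<le> n"
        have "(\<integral>\<^sup>+x. ennreal (\<bar>u (r n) x - v x\<bar> powr s) \<partial>lebesgue_on \<Omega>) \<le> (\<integral>\<^sup>+x. ennreal (\<bar>w (r n) x - v x\<bar> powr s) \<partial>lborel)"
          using uw[of "r n"] by (intro nn_integral_lebesgue_on_le_AE[OF \<Omega>(2)]) (auto elim!: eventually_mono)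
        also have "\<dots> \<le> ennreal (A powr s)"
          using N \<open>N \<le> n\<close> by blast
        finally have *: "(\<integral>\<^sup>+x. ennreal (\<bar>u (r n) x - v x\<bar> powr s) \<partial>lebesgue_on \<Omega>) \<le> ennreal (A powr s)" .
        have m: "(\<lambda>x. u (r n) x - v x) \<in> borel_measurable (lebesgue_on \<Omega>)"
          using meas[OF u, of "r n"] v_meas by measurable
        have "0 < p" using assms by simp
        note l = Lsum_and_norm_le[OF this s(3,4) A m *]
        show "norm (Lsum_norm p q \<Omega> (\<lambda>x. u (r n) x - v x) - 0) < e"
          using l(2) Lsum_norm_nonneg[OF l(1)] e by (simp add: A_def)
      qed
    qed
    ultimately show ?thesis
      using r(1) by blast
  qed
  show ?thesis
    unfolding compactly_embedded_def \<Omega>_def[symmetric]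
  proof (intro conjI allI impI)
    show "\<exists>C. \<forall>u\<in>D12_cyl I. Lsum_norm p q \<Omega> u \<le> C * D12_norm \<Omega> u"
      using c2 by blast
    show "\<forall>u\<in>D12_cyl I. Lsum_norm p q \<Omega> u = 0 \<longrightarrow> D12_norm \<Omega> u = 0"
      using c3 by blast
    fix u :: "nat \<Rightarrow> space3 \<Rightarrow> real"
    assume "(\<forall>n. u n \<in> D12_cyl I) \<and> (\<exists>B. \<forall>n. D12_norm \<Omega> (u n) \<le> B)"
    then obtain B where "\<And>n. u n \<in> D12_cyl I" "\<And>n. D12_norm \<Omega> (u n) \<le> B"
      by blast
    then show "\<exists>r v. strict_mono r \<and> v \<in> Lsum p q \<Omega> \<and> (\<lambda>n. Lsum_norm p q \<Omega> (\<lambda>x. u (r n) x - v x)) \<longlonglongrightarrow> 0"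
      by (rule c4)
  qed (rule c1)
qed

end
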